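(* Let $a>0$, $b$, $c$ be smooth functions of $x$ on an interval. The equation $u_t=a(x)u_{xx}+b(x)u_x+c(x)u$ can be mapped to the heat equation $\tilde u_{\tilde t}=\tilde u_{\tilde x\tilde x}$ by an invertible point transformation if and only if $K=c_2I^2+c_1I+c_0$ for some constants $c_0,c_1,c_2$. Moreover, in that case, for any function $T(t)$ with $\dot T>0$ satisfying $\{T,t\}=8c_2$, any solution $\omega(t)$ of $\ddot\omega+4c_2\omega=2c_1$, and any constant $C\neq0$, the transformation $$\tilde t=T(t),\quad \tilde x=\sqrt{\dot T}\,(I(x)+\omega(t)),$$ $$u=C(\dot T a)^{1/4}\exp\!\Big[-\!\int\frac{b}{2a}dx+\frac{\ddot T}{8\dot T}(I+\omega)^2+\frac{\dot\omega I}{2}-\int\big(c_2\omega^2-\tfrac14\dot\omega^2-c_0\big)dt\Big]\tilde u(\tilde x,\tilde t)$$ maps solutions $\tilde u$ of the heat equation to solutions $u$ of the given equation (and conversely).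
   Context: $I(x)=\int^x a(s)^{-1/2}ds$, $J=\frac{d}{dx}\sqrt a-\frac{b}{\sqrt a}$, $K=\tfrac12\sqrt a\,J'-\tfrac14J^2+c$. $\{T,t\}=\dddot T/\dot T-\tfrac32(\ddot T/\dot T)^2$ is the Schwarzian derivative; dots denote $d/dt$. $\int\frac{b}{2a}dx$ denotes a fixed antiderivative in $x$, and $\int(\cdot)dt$ a fixed antiderivative in $t$. *)

theory Defs
  imports "HOL-Analysis.Analysis"
begin

definition dir_deriv :: "'a::real_normed_vector \<Rightarrow> ('a \<Rightarrow> real) \<Rightarrow> 'a \<Rightarrow> real" where
  "dir_deriv v f x = deriv (\<lambda>h. f (x + h *\<^sub>R v)) 0"

definition smooth_on :: "'a::euclidean_space set \<Rightarrow> ('a \<Rightarrow> 'b::euclidean_space) \<Rightarrow> bool" where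
  "smooth_on U f \<longleftrightarrow>
     (\<forall>b\<in>Basis. \<forall>vs. set vs \<subseteq> Basis \<longrightarrow>
        continuous_on U (foldr dir_deriv vs (\<lambda>x. f x \<bullet> b)) \<and>
        (\<forall>v\<in>Basis. \<forall>x\<in>U.
           (\<lambda>h. foldr dir_deriv vs (\<lambda>y. f y \<bullet> b) (x + h *\<^sub>R v)) differentiable (at 0)))"

definition pt :: "(real \<Rightarrow> real \<Rightarrow> real) \<Rightarrow> real \<Rightarrow> real \<Rightarrow> real" where
  "pt u t x = deriv (\<lambda>s. u s x) t"
definition px :: "(real \<Rightarrow> real \<Rightarrow> real) \<Rightarrow> real \<Rightarrow> real \<Rightarrow> real" where
  "px u t x = deriv (\<lambda>y. u t y) x"
definition pxx :: "(real \<Rightarrow> real \<Rightarrow> real) \<Rightarrow> real \<Rightarrow> real \<Rightarrow> real" where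
  "pxx u t x = deriv (\<lambda>y. px u t y) x"

definition lsol :: "(real \<Rightarrow> real) \<Rightarrow> (real \<Rightarrow> real) \<Rightarrow> (real \<Rightarrow> real) \<Rightarrow> real set
    \<Rightarrow> (real \<times> real) set \<Rightarrow> (real \<Rightarrow> real \<Rightarrow> real) \<Rightarrow> bool" where
  "lsol a b c S Om u \<longleftrightarrow> open Om \<and> Om \<subseteq> UNIV \<times> S \<and>
     smooth_on Om (\<lambda>p. u (fst p) (snd p)) \<and>
     (\<forall>(t,x)\<in>Om. pt u t x = a x * pxx u t x + b x * px u t x + c x * u t x)"

definition heatsol :: "(real \<times> real) set \<Rightarrow> (real \<Rightarrow> real \<Rightarrow> real) \<Rightarrow> bool" where
  "heatsol = lsol (\<lambda>_. 1) (\<lambda>_. 0) (\<lambda>_. 0) UNIV"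

definition graph :: "(real \<Rightarrow> real \<Rightarrow> real) \<Rightarrow> (real \<times> real) set \<Rightarrow> (real \<times> real \<times> real) set" where
  "graph u Om = {(t, x, u t x) | t x. (t, x) \<in> Om}"

definition maps_solutions ::
  "((real \<times> real) set \<Rightarrow> (real \<Rightarrow> real \<Rightarrow> real) \<Rightarrow> bool) \<Rightarrow>
   ((real \<times> real) set \<Rightarrow> (real \<Rightarrow> real \<Rightarrow> real) \<Rightarrow> bool) \<Rightarrow>
   (real \<times> real \<times> real \<Rightarrow> real \<times> real \<times> real) \<Rightarrow> (real \<times> real \<times> real) set \<Rightarrow> bool" where
  "maps_solutions E1 E2 Phi D \<longleftrightarrow>
     (\<forall>Om u. E1 Om u \<and> graph u Om \<subseteq> D \<longrightarrow>
        (\<forall>Om' u'. open Om' \<and> smooth_on Om' (\<lambda>p. u' (fst p) (snd p)) \<and>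
                  graph u' Om' \<subseteq> Phi ` graph u Om \<longrightarrow> E2 Om' u'))"

definition point_transformation ::
  "(real \<times> real \<times> real) set \<Rightarrow> (real \<times> real \<times> real \<Rightarrow> real \<times> real \<times> real) \<Rightarrow> bool" where
  "point_transformation D Phi \<longleftrightarrow> open D \<and> D \<noteq> {} \<and> inj_on Phi D \<and> open (Phi ` D) \<and>
     smooth_on D Phi \<and> smooth_on (Phi ` D) (inv_into D Phi)"

definition maps_to_heat ::
  "(real \<Rightarrow> real) \<Rightarrow> (real \<Rightarrow> real) \<Rightarrow> (real \<Rightarrow> real) \<Rightarrow> real set \<Rightarrow> real set
   \<Rightarrow> (real \<times> real \<times> real \<Rightarrow> real \<times> real \<times> real) \<Rightarrow> bool" where
  "maps_to_heat a b c S Tint Phi \<longleftrightarrow>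
     (let D = Tint \<times> S \<times> UNIV in
        point_transformation D Phi \<and>
        maps_solutions (lsol a b c S) heatsol Phi D \<and>
        maps_solutions heatsol (lsol a b c S) (inv_into D Phi) (Phi ` D))"

definition Jf :: "(real \<Rightarrow> real) \<Rightarrow> (real \<Rightarrow> real) \<Rightarrow> real \<Rightarrow> real" where
  "Jf a b x = deriv (\<lambda>y. sqrt (a y)) x - b x / sqrt (a x)"

definition Kf :: "(real \<Rightarrow> real) \<Rightarrow> (real \<Rightarrow> real) \<Rightarrow> (real \<Rightarrow> real) \<Rightarrow> real \<Rightarrow> real" where
  "Kf a b c x = 1/2 * sqrt (a x) * deriv (Jf a b) x - 1/4 * (Jf a b x)^2 + c x"

definition schwarzian :: "(real \<Rightarrow> real) \<Rightarrow> real \<Rightarrow> real" where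
  "schwarzian T t = deriv (deriv (deriv T)) t / deriv T t
     - 3/2 * (deriv (deriv T) t / deriv T t)^2"

end

theory Submission
  imports Defs
begin

text \<open>
  In the coordinate $y = I(x)$ and after the gauge $u = a^{1/4} e^{-B} v$ the equation reads
  $v_t = v_{yy} + K v$. For quadratic $K$ the Schwarzian equation for $T$, the oscillator equation for
  $\omega$ and the integral $W$ are exactly what turns the heat operator in $(T(t), \sqrt{\dot T}(y + \omega))$
  into $\partial_t - \partial_y^2 - K$, up to a nonvanishing factor.

  Conversely, let $(\tau, \xi, \upsilon)(s, y, w)$ be the inverse of a point transformation to the heat equation.
  Heat polynomials $w(s,y)$ realise every jet $(w, w_y, w_{yy}, w_{ss})$ at a given point, and the transformed
  functions must solve the given equation. Varying $w_{ss}$ gives $\tau = \tau(s)$; varying $w_{yy}$ gives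
  $\xi_w = 0$ and $\xi_y^2 = a(\xi) \tau_s$; varying $w_y$ gives two equations for $\upsilon$. With
  $\sigma = \xi_y / \sqrt{a(\xi)}$, which depends on $s$ only, and $\eta = \xi_s / \sqrt{a(\xi)}$, these
  determine both logarithmic derivatives of $\upsilon_w$; equality of its mixed derivatives then reads
  $2 \sigma^5 \, dK/dI = 2 \eta \sigma_s - \eta_s \sigma$, whose right-hand side is affine in $y$. Differentiating
  twice in $y$ yields $d^3K/dI^3 = 0$.
\<close>

section \<open>Smooth functions\<close>

text \<open>The obstacle is that nothing is known in advance about the shape of the transformation:
  the new time may depend on position and on the unknown, and the dependence on the unknown may be
  nonlinear. The test functions must be genuine solutions on open sets, so a transformed heat
  polynomial has to be constructed: along its graph, \<open>(\<tau>, \<xi>)\<close> is a map of the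
  plane, and this map is inverted locally. That demands a nonzero planar Jacobian. As a function of
  the slopes w_y and w_s this Jacobian is affine, and its coefficients cannot all vanish because the
  three-dimensional Jacobian is nonzero; hence enough slopes remain available to separate
  coefficients. Nonlinearity in w is never ruled out. Instead the equation left for
  \<open>\<upsilon>\<close> is differentiated in w, which gives a linear equation for the derivative
  of \<open>\<upsilon>\<close> in w alone. In the other direction, \<open>T\<close> and
  \<open>\<omega>\<close> come only with the derivatives that their equations mention; the equations
  themselves supply smoothness.\<close>

text \<open>Move from \<open>x\<close> to \<open>y\<close> one coordinate at a time and bound each
  increment by the mean value inequality. This is the bridge from \<open>smooth_on\<close>, which
  speaks only of derivatives along basis vectors, to total derivatives and the chain rule.\<close>

lemma has_derivative_continuous_partials:
  fixes f :: "'a::euclidean_space \<Rightarrow> real"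
  assumes U: "open U" "x \<in> U"
    and D: "\<And>y v. y \<in> U \<Longrightarrow> v \<in> Basis \<Longrightarrow> ((\<lambda>h. f (y + h *\<^sub>R v)) has_real_derivative d v y) (at 0)"
    and C: "\<And>v. v \<in> Basis \<Longrightarrow> continuous_on U (d v)"
  shows "(f has_derivative (\<lambda>h. \<Sum>v\<in>Basis. (h \<bullet> v) * d v x)) (at x)"
  unfolding has_derivative_at_alt
proof (intro conjI allI impI)
  show "bounded_linear (\<lambda>h. \<Sum>v\<in>Basis. (h \<bullet> v) * d v x)"
    by (intro bounded_linear_sum bounded_linear_mult_const bounded_linear_inner_left)
next
  fix e :: real assume e: "e > 0"
  define n where "n = real (DIM('a))"
  have n: "n > 0" by (simp add: n_def)
  \<comment> \<open>The permitted error is shared equally among the coordinates, since the sum of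
    the absolute coordinates of h is at most \<open>n * norm h\<close>.\<close>
  define e' where "e' = e / n"
  have e': "e' > 0" using e n by (simp add: e'_def)
  obtain r where r: "r > 0" "ball x r \<subseteq> U" using U by (meson openE)
  have "\<exists>\<delta>>0. \<forall>y. dist y x < \<delta> \<longrightarrow> \<bar>d v y - d v x\<bar> < e'" if "v \<in> Basis" for v
  proof -
    have "isCont (d v) x"
      using C[OF that] U by (simp add: continuous_on_eq_continuous_at)
    then show ?thesis using e' unfolding continuous_at_eps_delta
      by (metis dist_real_def)
  qed
  then obtain \<delta> where \<delta>: "\<And>v. v \<in> Basis \<Longrightarrow> \<delta> v > 0"
      "\<And>v y. v \<in> Basis \<Longrightarrow> dist y x < \<delta> v \<Longrightarrow> \<bar>d v y - d v x\<bar> < e'"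
    by metis
  define m where "m = min r (Min (\<delta> ` Basis))"
  have m: "m > 0" using r \<delta>(1) by (simp add: m_def)
  have mr: "y \<in> U" if "dist y x < m" for y
    using that r by (auto simp: m_def dist_commute)
  have md: "\<bar>d v y - d v x\<bar> < e'" if "v \<in> Basis" "dist y x < m" for v y
  proof -
    have "m \<le> \<delta> v" using that(1) unfolding m_def by (simp add: min.coboundedI2)
    then show ?thesis using \<delta>(2) that by force
  qed
  show "\<exists>dd>0. \<forall>y. norm (y - x) < dd \<longrightarrow>
          norm (f y - f x - (\<Sum>v\<in>Basis. (y - x) \<bullet> v * d v x)) \<le> e * norm (y - x)"
  proof (intro exI conjI allI impI)
    \<comment> \<open>With this radius the sum of the absolute coordinates of \<open>y - x\<close>
      is below \<open>m\<close>, so every intermediate point of the coordinate path stays where all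
      the estimates hold.\<close>
    show "m / n > 0" using m n by simp
    fix y assume y: "norm (y - x) < m / n"
    define h where "h = y - x"
    have hn: "(\<Sum>v\<in>Basis. \<bar>h \<bullet> v\<bar>) \<le> n * norm h"
      unfolding n_def using sum_bounded_above[of Basis "\<lambda>v. \<bar>h \<bullet> v\<bar>" "norm h"] Basis_le_norm by auto
    also have "\<dots> < m" using y n by (simp add: h_def field_simps)
    finally have hm: "(\<Sum>v\<in>Basis. \<bar>h \<bullet> v\<bar>) < m" .
    \<comment> \<open>\<open>B\<close> is the set of coordinates already moved; the induction adds
      one leg of the path at a time.\<close>
    have main: "\<bar>f (x + (\<Sum>v\<in>B. (h \<bullet> v) *\<^sub>R v)) - f x - (\<Sum>v\<in>B. (h \<bullet> v) * d v x)\<bar>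
                 \<le> (\<Sum>v\<in>B. e' * \<bar>h \<bullet> v\<bar>)" if "finite B" "B \<subseteq> Basis" for B
      using that
    proof (induction B rule: finite_induct)
      case empty then show ?case by simp
    next
      case (insert v B)
      define z where "z = x + (\<Sum>v\<in>B. (h \<bullet> v) *\<^sub>R v)"
      have near: "dist (z + s *\<^sub>R v) x < m" if s: "\<bar>s\<bar> \<le> \<bar>h \<bullet> v\<bar>" for s
      proof -
        have "dist (z + s *\<^sub>R v) x = norm ((\<Sum>v\<in>B. (h \<bullet> v) *\<^sub>R v) + s *\<^sub>R v)"
          by (simp add: z_def dist_norm)
        also have "\<dots> \<le> (\<Sum>v\<in>B. norm ((h \<bullet> v) *\<^sub>R v)) + norm (s *\<^sub>R v)"
          by (rule norm_triangle_le) (simp add: norm_sum del: norm_scaleR)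
        also have "\<dots> = (\<Sum>v\<in>B. \<bar>h \<bullet> v\<bar>) + \<bar>s\<bar>"
          using insert.prems by (auto intro!: sum.cong)
        also have "\<dots> \<le> (\<Sum>v\<in>insert v B. \<bar>h \<bullet> v\<bar>)"
          using insert.hyps s by simp
        also have "\<dots> \<le> (\<Sum>v\<in>Basis. \<bar>h \<bullet> v\<bar>)"
          by (rule sum_mono2) (use insert.prems in auto)
        finally show ?thesis using hm by simp
      qed
      have vB: "v \<in> Basis" using insert.prems by simp
      have seg: "\<bar>s\<bar> \<le> \<bar>h \<bullet> v\<bar>" if "s \<in> closed_segment 0 (h \<bullet> v)" for s
        using that by (auto simp: closed_segment_eq_real_ivl split: if_splits)
      have der: "((\<lambda>s. f (z + s *\<^sub>R v) - s * d v x) has_field_derivative (d v (z + s *\<^sub>R v) - d v x))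
             (at s within closed_segment 0 (h \<bullet> v))" if s: "s \<in> closed_segment 0 (h \<bullet> v)" for s
      proof -
        have "((\<lambda>k. f ((z + s *\<^sub>R v) + k *\<^sub>R v)) has_real_derivative d v (z + s *\<^sub>R v)) (at (s - s))"
          using D[OF mr[OF near[OF seg[OF s]]] vB] by simp
        then have "((\<lambda>k. f ((z + s *\<^sub>R v) + (k - s) *\<^sub>R v)) has_real_derivative d v (z + s *\<^sub>R v)) (at s)"
          using DERIV_shift[of "\<lambda>k. f ((z + s *\<^sub>R v) + k *\<^sub>R v)" "d v (z + s *\<^sub>R v)" s "-s"] by simp
        then have "((\<lambda>k. f (z + k *\<^sub>R v)) has_real_derivative d v (z + s *\<^sub>R v)) (at s)"
          by (simp add: algebra_simps)
        then show ?thesis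
          by (auto intro!: derivative_eq_intros intro: has_field_derivative_at_within)
      qed
      have "norm ((f (z + (h \<bullet> v) *\<^sub>R v) - (h \<bullet> v) * d v x) - (f (z + 0 *\<^sub>R v) - 0 * d v x))
              \<le> e' * norm (h \<bullet> v - 0)"
        by (rule field_differentiable_bound[OF convex_closed_segment der])
           (use md[OF vB near[OF seg]] in \<open>auto intro: less_imp_le\<close>)
      then have step: "\<bar>f (z + (h \<bullet> v) *\<^sub>R v) - f z - (h \<bullet> v) * d v x\<bar> \<le> e' * \<bar>h \<bullet> v\<bar>"
        by (simp add: algebra_simps)
      have ih: "\<bar>f z - f x - (\<Sum>v\<in>B. (h \<bullet> v) * d v x)\<bar> \<le> (\<Sum>v\<in>B. e' * \<bar>h \<bullet> v\<bar>)"
        using insert by (simp add: z_def)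
      have "x + (\<Sum>v\<in>insert v B. (h \<bullet> v) *\<^sub>R v) = z + (h \<bullet> v) *\<^sub>R v"
        using insert.hyps by (simp add: z_def algebra_simps)
      then show ?case
        unfolding sum.insert[OF insert.hyps] using step ih by (simp only: abs_le_iff) linarith
    qed
    have "x + (\<Sum>v\<in>Basis. (h \<bullet> v) *\<^sub>R v) = y" by (simp add: euclidean_representation h_def)
    then have "\<bar>f y - f x - (\<Sum>v\<in>Basis. (h \<bullet> v) * d v x)\<bar> \<le> e' * (\<Sum>v\<in>Basis. \<bar>h \<bullet> v\<bar>)"
      using main[of Basis] by (simp add: sum_distrib_left)
    also have "\<dots> \<le> e' * (n * norm h)" using hn e' by simp
    also have "\<dots> = e * norm h" using n by (simp add: e'_def)
    finally show "norm (f y - f x - (\<Sum>v\<in>Basis. (y - x) \<bullet> v * d v x)) \<le> e * norm (y - x)"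
      by (simp add: h_def)
  qed
qed

section \<open>Differentiability of finite order\<close>

text \<open>Total derivatives obey the product and chain rules without side conditions on partial
  derivatives, so closure properties become inductions on the order. Requiring the next order only
  along basis vectors keeps the recursion within real-valued functions.\<close>

primrec Ck :: "nat \<Rightarrow> 'a::euclidean_space set \<Rightarrow> ('a \<Rightarrow> real) \<Rightarrow> bool" where
  "Ck 0 U f = continuous_on U f"
| "Ck (Suc k) U f = (\<exists>f'. (\<forall>x\<in>U. (f has_derivative f' x) (at x)) \<and> (\<forall>v\<in>Basis. Ck k U (\<lambda>x. f' x v)))"

lemma Ck_cong:
  assumes "open U" "\<And>x. x \<in> U \<Longrightarrow> f x = g x" "Ck k U f"
  shows "Ck k U g"
proof (cases k)
  case 0
  then show ?thesis using assms continuous_on_cong by force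
next
  case (Suc n)
  then obtain f' where f': "\<forall>x\<in>U. (f has_derivative f' x) (at x)" "\<forall>v\<in>Basis. Ck n U (\<lambda>x. f' x v)"
    using assms(3) by auto
  have "(g has_derivative f' x) (at x)" if "x \<in> U" for x
    using has_derivative_transform_within_open[OF f'(1)[rule_format, OF that] assms(1) that] assms(2) by blast
  then show ?thesis using f'(2) Suc by (auto intro!: exI[of _ f'])
qed

lemma Ck_subset: "V \<subseteq> U \<Longrightarrow> Ck k U f \<Longrightarrow> Ck k V f"
proof (induction k arbitrary: f)
  case 0 then show ?case by (auto intro: continuous_on_subset)
next
  case (Suc k)
  then obtain f' where f': "\<forall>x\<in>U. (f has_derivative f' x) (at x)" "\<forall>v\<in>Basis. Ck k U (\<lambda>x. f' x v)"
    by auto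
  then show ?case using Suc by (auto intro!: exI[of _ f'])
qed

lemma Ck_Suc_imp: "Ck (Suc k) U f \<Longrightarrow> Ck k U f"
proof (induction k arbitrary: f)
  case 0
  then obtain f' where "\<forall>x\<in>U. (f has_derivative f' x) (at x)" by auto
  then have "continuous_on U f"
    by (meson has_derivative_continuous_on has_derivative_at_withinI)
  then show ?case by simp
next
  case (Suc k)
  from Suc.prems obtain f' where "\<forall>x\<in>U. (f has_derivative f' x) (at x)"
      "\<forall>v\<in>Basis. Ck (Suc k) U (\<lambda>x. f' x v)"
    unfolding Ck.simps(2)[of "Suc k"] by blast
  then show ?case using Suc.IH unfolding Ck.simps(2)[of k] by blast
qed

lemma Ck_const: "Ck k U (\<lambda>x. c)"
proof (induction k arbitrary: c)
  case (Suc k)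
  then show ?case by (auto intro!: exI[of _ "\<lambda>x h. 0"])
qed simp

lemma Ck_linear:
  assumes "bounded_linear f"
  shows "Ck k U f"
proof (cases k)
  case 0
  then show ?thesis using assms by (simp add: linear_continuous_on)
next
  case (Suc n)
  then show ?thesis using assms
    by (auto intro!: exI[of _ "\<lambda>x. f"] bounded_linear_imp_has_derivative Ck_const)
qed

lemma Ck_add: "Ck k U f \<Longrightarrow> Ck k U g \<Longrightarrow> Ck k U (\<lambda>x. f x + g x)"
proof (induction k arbitrary: f g)
  case (Suc k)
  then obtain f' g' where "\<forall>x\<in>U. (f has_derivative f' x) (at x)" "\<forall>v\<in>Basis. Ck k U (\<lambda>x. f' x v)"
    "\<forall>x\<in>U. (g has_derivative g' x) (at x)" "\<forall>v\<in>Basis. Ck k U (\<lambda>x. g' x v)"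
    by auto
  then show ?case using Suc.IH
    by (auto intro!: exI[of _ "\<lambda>x h. f' x h + g' x h"] has_derivative_add)
qed (auto intro: continuous_intros)

lemma Ck_mult: "Ck k U f \<Longrightarrow> Ck k U g \<Longrightarrow> Ck k U (\<lambda>x. f x * g x)"
proof (induction k arbitrary: f g)
  case (Suc k)
  then obtain f' g' where *: "\<forall>x\<in>U. (f has_derivative f' x) (at x)" "\<forall>v\<in>Basis. Ck k U (\<lambda>x. f' x v)"
    "\<forall>x\<in>U. (g has_derivative g' x) (at x)" "\<forall>v\<in>Basis. Ck k U (\<lambda>x. g' x v)"
    by auto
  have "Ck k U (\<lambda>x. f x * g' x v + f' x v * g x)" if "v \<in> Basis" for v
    using * that Suc.prems by (intro Ck_add Suc.IH) (auto simp del: Ck.simps intro: Ck_Suc_imp)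
  then show ?case using *
    by (auto intro!: exI[of _ "\<lambda>x h. f x * g' x h + f' x h * g x"] has_derivative_mult)
qed (auto intro: continuous_intros)

lemma Ck_sum: "finite A \<Longrightarrow> (\<And>i. i \<in> A \<Longrightarrow> Ck k U (f i)) \<Longrightarrow> Ck k U (\<lambda>x. \<Sum>i\<in>A. f i x)"
  by (induction A rule: finite_induct) (auto intro: Ck_const Ck_add)

text \<open>The derivative along v is the sum over b of (derivative of the b-component of f along v)
  times (derivative of g along b, composed with f). The induction hypothesis is applied to the
  derivatives of g, with f lowered by one order, and products and sums do the rest.\<close>

lemma Ck_compose:
  fixes f :: "'a::euclidean_space \<Rightarrow> 'b::euclidean_space"
  assumes "Ck k V g" "\<And>b. b \<in> Basis \<Longrightarrow> Ck k U (\<lambda>x. f x \<bullet> b)" "f ` U \<subseteq> V"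
  shows "Ck k U (\<lambda>x. g (f x))"
  using assms(1,2)
proof (induction k arbitrary: g)
  case 0
  have "continuous_on U f" using 0 by (simp add: continuous_on_componentwise[of U f])
  then show ?case using 0 assms(3) by (auto intro: continuous_on_compose2)
next
  case (Suc k)
  from Suc.prems(1) obtain g' where g': "\<forall>x\<in>V. (g has_derivative g' x) (at x)"
    "\<forall>v\<in>Basis. Ck k V (\<lambda>x. g' x v)" by auto
  from Suc.prems(2) have "\<forall>b\<in>Basis. \<exists>f'. (\<forall>x\<in>U. ((\<lambda>x. f x \<bullet> b) has_derivative f' x) (at x)) \<and>
      (\<forall>v\<in>Basis. Ck k U (\<lambda>x. f' x v))" by auto
  then obtain f' where f': "\<And>b x. b \<in> Basis \<Longrightarrow> x \<in> U \<Longrightarrow> ((\<lambda>x. f x \<bullet> b) has_derivative f' b x) (at x)"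
    "\<And>b v. b \<in> Basis \<Longrightarrow> v \<in> Basis \<Longrightarrow> Ck k U (\<lambda>x. f' b x v)"
    by metis
  have df: "(f has_derivative (\<lambda>h. \<Sum>b\<in>Basis. f' b x h *\<^sub>R b)) (at x)" if "x \<in> U" for x
  proof -
    have "((\<lambda>x. f x \<bullet> i) has_derivative (\<lambda>h. (\<Sum>b\<in>Basis. f' b x h *\<^sub>R b) \<bullet> i)) (at x)"
      if "i \<in> Basis" for i
    proof -
      have "(\<lambda>h. (\<Sum>b\<in>Basis. f' b x h *\<^sub>R b) \<bullet> i) = f' i x"
        using that by (auto simp: inner_sum_left_Basis)
      then show ?thesis using f'(1)[OF that \<open>x \<in> U\<close>] by simp
    qed
    then show ?thesis by (subst has_derivative_componentwise_within) auto
  qed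
  have d: "((\<lambda>x. g (f x)) has_derivative (\<lambda>h. \<Sum>b\<in>Basis. f' b x h * g' (f x) b)) (at x)" if "x \<in> U" for x
  proof -
    have fx: "f x \<in> V" using that assms(3) by auto
    then have G: "(g has_derivative g' (f x)) (at (f x))" using g' by auto
    then interpret bounded_linear "g' (f x)" by (rule has_derivative_bounded_linear)
    have "((\<lambda>x. g (f x)) has_derivative (\<lambda>h. g' (f x) (\<Sum>b\<in>Basis. f' b x h *\<^sub>R b))) (at x)"
      by (rule has_derivative_compose[OF df[OF that] G])
    then show ?thesis by (simp add: sum scaleR)
  qed
  have "Ck k U (\<lambda>x. \<Sum>b\<in>Basis. f' b x v * g' (f x) b)" if "v \<in> Basis" for v
  proof (intro Ck_sum Ck_mult)
    fix b :: 'b assume b: "b \<in> Basis"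
    show "Ck k U (\<lambda>x. f' b x v)" by (rule f'(2)[OF b that])
    show "Ck k U (\<lambda>x. g' (f x) b)"
      by (rule Suc.IH) (use g' b Suc.prems in \<open>auto simp del: Ck.simps intro: Ck_Suc_imp\<close>)
  qed simp
  then show ?case using d
    by (auto intro!: exI[of _ "\<lambda>x h. \<Sum>b\<in>Basis. f' b x h * g' (f x) b"])
qed

lemma dir_deriv_eq:
  assumes "(f has_derivative f') (at x)"
  shows "((\<lambda>h. f (x + h *\<^sub>R v)) has_real_derivative f' v) (at 0)" "dir_deriv v f x = f' v"
proof -
  have l: "((\<lambda>h. x + h *\<^sub>R v) has_derivative (\<lambda>h. h *\<^sub>R v)) (at 0)"
    by (auto intro!: derivative_eq_intros)
  have "((\<lambda>h. f (x + h *\<^sub>R v)) has_derivative (\<lambda>h. f' (h *\<^sub>R v))) (at 0)"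
    by (rule has_derivative_compose[OF l]) (use assms in simp)
  moreover have "f' (h *\<^sub>R v) = f' v * h" for h
    using assms by (metis has_derivative_linear linear_cmul mult.commute real_scaleR_def)
  ultimately show *: "((\<lambda>h. f (x + h *\<^sub>R v)) has_real_derivative f' v) (at 0)"
    by (simp add: has_field_derivative_def)
  show "dir_deriv v f x = f' v" unfolding dir_deriv_def by (rule DERIV_imp_deriv[OF *])
qed

lemma dir_deriv_cong:
  assumes "open U" "x \<in> U" "\<And>y. y \<in> U \<Longrightarrow> f y = g y"
  shows "dir_deriv v f x = dir_deriv v g x"
  unfolding dir_deriv_def
proof (rule deriv_cong_ev)
  have "((\<lambda>h::real. x + h *\<^sub>R v) \<longlongrightarrow> x + 0 *\<^sub>R v) (nhds 0)"
    by (intro tendsto_intros) (simp add: filterlim_ident)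
  then have "\<forall>\<^sub>F h in nhds 0. x + h *\<^sub>R v \<in> U" using assms(1,2) by (auto dest: topological_tendstoD)
  then show "\<forall>\<^sub>F h in nhds 0. f (x + h *\<^sub>R v) = g (x + h *\<^sub>R v)"
    by eventually_elim (use assms(3) in auto)
qed simp

lemma smooth_on_real_def:
  fixes f :: "'a::euclidean_space \<Rightarrow> real"
  shows "smooth_on U f \<longleftrightarrow> (\<forall>vs. set vs \<subseteq> Basis \<longrightarrow> continuous_on U (foldr dir_deriv vs f) \<and>
        (\<forall>v\<in>Basis. \<forall>x\<in>U. (\<lambda>h. foldr dir_deriv vs f (x + h *\<^sub>R v)) differentiable (at 0)))"
  by (simp add: smooth_on_def)

lemma smooth_on_componentwise: "smooth_on U f \<longleftrightarrow> (\<forall>b\<in>Basis. smooth_on U (\<lambda>x. f x \<bullet> b))"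
  by (simp add: smooth_on_def)

lemma smooth_on_dir_deriv:
  fixes f :: "'a::euclidean_space \<Rightarrow> real"
  assumes "smooth_on U f" "v \<in> Basis"
  shows "smooth_on U (dir_deriv v f)"
  unfolding smooth_on_real_def
proof (intro allI impI)
  fix vs :: "'a list" assume "set vs \<subseteq> Basis"
  then have "set (vs @ [v]) \<subseteq> Basis" using assms by simp
  then show "continuous_on U (foldr dir_deriv vs (dir_deriv v f)) \<and>
        (\<forall>va\<in>Basis. \<forall>x\<in>U. (\<lambda>h. foldr dir_deriv vs (dir_deriv v f) (x + h *\<^sub>R va)) differentiable (at 0))"
    using assms(1)[unfolded smooth_on_real_def, rule_format, of "vs @ [v]"] by simp
qed

lemma smooth_on_imp_has_derivative:
  fixes f :: "'a::euclidean_space \<Rightarrow> real"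
  assumes "smooth_on U f" "open U" "x \<in> U"
  shows "(f has_derivative (\<lambda>h. \<Sum>v\<in>Basis. (h \<bullet> v) * dir_deriv v f x)) (at x)"
proof (rule has_derivative_continuous_partials[OF assms(2,3)])
  fix v :: 'a assume v: "v \<in> Basis"
  show "continuous_on U (dir_deriv v f)"
    using smooth_on_dir_deriv[OF assms(1) v, unfolded smooth_on_real_def, rule_format, of "[]"] by simp
  fix y assume "y \<in> U"
  then have "(\<lambda>h. f (y + h *\<^sub>R v)) differentiable (at 0)"
    using assms(1)[unfolded smooth_on_real_def, rule_format, of "[]"] v by simp
  then show "((\<lambda>h. f (y + h *\<^sub>R v)) has_real_derivative dir_deriv v f y) (at 0)"
    unfolding dir_deriv_def by (metis DERIV_deriv_iff_real_differentiable)
qed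

text \<open>Forwards, the coefficients of the total derivative are directional derivatives, which
  are smooth again. Backwards, lying in every \<open>Ck k\<close> is preserved by each
  \<open>dir_deriv\<close>, hence by any iteration of them.\<close>

lemma smooth_on_iff_Ck:
  fixes f :: "'a::euclidean_space \<Rightarrow> real"
  assumes U: "open U"
  shows "smooth_on U f \<longleftrightarrow> (\<forall>k. Ck k U f)"
proof
  assume "smooth_on U f"
  then have "Ck k U f" for k
  proof (induction k arbitrary: f)
    case 0
    then show ?case using 0[unfolded smooth_on_real_def, rule_format, of "[]"] by simp
  next
    case (Suc k)
    have d: "\<forall>x\<in>U. (f has_derivative (\<lambda>h. \<Sum>v\<in>Basis. (h \<bullet> v) * dir_deriv v f x)) (at x)"
      using smooth_on_imp_has_derivative[OF Suc.prems U] by blast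
    have "Ck k U (\<lambda>x. \<Sum>w\<in>Basis. (v \<bullet> w) * dir_deriv w f x)" if "v \<in> Basis" for v
      by (intro Ck_sum Ck_mult Ck_const Suc.IH smooth_on_dir_deriv[OF Suc.prems]) auto
    with d show ?case by auto
  qed
  then show "\<forall>k. Ck k U f" ..
next
  have step: "\<forall>k. Ck k U (dir_deriv v g)" if "\<forall>k. Ck k U g" and v: "v \<in> Basis" for g v
  proof
    fix k
    have "Ck (Suc k) U g" using \<open>\<forall>k. Ck k U g\<close> by blast
    then obtain g' where g': "\<forall>x\<in>U. (g has_derivative g' x) (at x)" "Ck k U (\<lambda>x. g' x v)"
      using v by auto
    show "Ck k U (dir_deriv v g)"
      by (rule Ck_cong[OF U _ g'(2)]) (use g'(1) dir_deriv_eq(2) in force)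
  qed
  assume f: "\<forall>k. Ck k U f"
  have *: "\<forall>k. Ck k U (foldr dir_deriv vs f)" if "set vs \<subseteq> Basis" for vs
    using that by (induction vs) (use f step in auto)
  show "smooth_on U f" unfolding smooth_on_real_def
  proof (intro allI impI conjI ballI)
    fix vs :: "'a list" assume vs: "set vs \<subseteq> Basis"
    show "continuous_on U (foldr dir_deriv vs f)" using *[OF vs] by (metis Ck.simps(1))
    fix v x assume "(v::'a) \<in> Basis" "x \<in> U"
    then obtain g' where "(foldr dir_deriv vs f has_derivative g') (at x)"
      using *[OF vs, rule_format, of 1] by auto
    from dir_deriv_eq(1)[OF this] 
    show "(\<lambda>h. foldr dir_deriv vs f (x + h *\<^sub>R v)) differentiable (at 0)"
      using real_differentiable_def by blast
  qed
qed

section \<open>Closure properties of smooth functions and symmetry of mixed derivatives\<close>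

lemma smooth_on_const: "open U \<Longrightarrow> smooth_on U (\<lambda>x. c::real)"
  by (simp add: smooth_on_iff_Ck Ck_const)

lemma smooth_on_linear:
  fixes f :: "'a::euclidean_space \<Rightarrow> real"
  shows "open U \<Longrightarrow> bounded_linear f \<Longrightarrow> smooth_on U f"
  by (simp add: smooth_on_iff_Ck Ck_linear)

lemma smooth_on_add:
  fixes f g :: "'a::euclidean_space \<Rightarrow> real"
  shows "open U \<Longrightarrow> smooth_on U f \<Longrightarrow> smooth_on U g \<Longrightarrow> smooth_on U (\<lambda>x. f x + g x)"
  by (simp add: smooth_on_iff_Ck Ck_add)

lemma smooth_on_mult:
  fixes f g :: "'a::euclidean_space \<Rightarrow> real"
  shows "open U \<Longrightarrow> smooth_on U f \<Longrightarrow> smooth_on U g \<Longrightarrow> smooth_on U (\<lambda>x. f x * g x)"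
  by (simp add: smooth_on_iff_Ck Ck_mult)

lemma smooth_on_subset:
  fixes f :: "'a::euclidean_space \<Rightarrow> real"
  shows "open U \<Longrightarrow> open V \<Longrightarrow> V \<subseteq> U \<Longrightarrow> smooth_on U f \<Longrightarrow> smooth_on V f"
  by (simp add: smooth_on_iff_Ck Ck_subset)

lemma smooth_on_cong:
  assumes "open U" "\<And>x. x \<in> U \<Longrightarrow> f x = g x" "smooth_on U f"
  shows "smooth_on U g"
proof -
  have "smooth_on U (\<lambda>x. g x \<bullet> b)" if "smooth_on U (\<lambda>x. f x \<bullet> b)" for b
    using that unfolding smooth_on_iff_Ck[OF assms(1)]
    by (auto intro: Ck_cong[OF assms(1), of "\<lambda>x. f x \<bullet> b"] simp: assms(2))
  then show ?thesis using assms(3) by (metis smooth_on_componentwise)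
qed

lemma smooth_on_minus:
  fixes f :: "'a::euclidean_space \<Rightarrow> real"
  shows "open U \<Longrightarrow> smooth_on U f \<Longrightarrow> smooth_on U (\<lambda>x. - f x)"
  using smooth_on_mult[of U "\<lambda>_. -1" f] smooth_on_const[of U "-1"] by simp

lemma smooth_on_diff:
  fixes f g :: "'a::euclidean_space \<Rightarrow> real"
  shows "open U \<Longrightarrow> smooth_on U f \<Longrightarrow> smooth_on U g \<Longrightarrow> smooth_on U (\<lambda>x. f x - g x)"
  using smooth_on_add[of U f "\<lambda>x. - g x"] smooth_on_minus[of U g] by simp

lemma smooth_on_power:
  fixes f :: "'a::euclidean_space \<Rightarrow> real"
  shows "open U \<Longrightarrow> smooth_on U f \<Longrightarrow> smooth_on U (\<lambda>x. f x ^ n)"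
  by (induction n) (auto intro: smooth_on_const smooth_on_mult)

lemma smooth_on_compose:
  fixes f :: "'a::euclidean_space \<Rightarrow> 'b::euclidean_space" and g :: "'b \<Rightarrow> real"
  assumes "open U" "open V" "smooth_on V g" "smooth_on U f" "f ` U \<subseteq> V"
  shows "smooth_on U (\<lambda>x. g (f x))"
  using assms smooth_on_componentwise[of U f] by (simp add: smooth_on_iff_Ck) (blast intro: Ck_compose)

lemma smooth_on_Pair:
  "smooth_on U (\<lambda>x. (f x, g x)) \<longleftrightarrow> smooth_on U f \<and> smooth_on U g"
  by (subst smooth_on_componentwise, subst (2) smooth_on_componentwise, subst (3) smooth_on_componentwise)
     (auto simp: Basis_prod_def ball_Un)

lemma smooth_on_imp_continuous_on:
  fixes f :: "'a::euclidean_space \<Rightarrow> real"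
  shows "smooth_on U f \<Longrightarrow> continuous_on U f"
  unfolding smooth_on_real_def by (drule spec[of _ "[]"]) simp

lemma smooth_on_DERIV_line:
  fixes g :: "'a::euclidean_space \<Rightarrow> real"
  assumes "smooth_on U g" "open U" "y + s *\<^sub>R w \<in> U"
  shows "((\<lambda>s. g (y + s *\<^sub>R w)) has_real_derivative dir_deriv w g (y + s *\<^sub>R w)) (at s)"
proof -
  note d = dir_deriv_eq[OF smooth_on_imp_has_derivative[OF assms], of w]
  have "((\<lambda>k. g ((y + s *\<^sub>R w) + k *\<^sub>R w)) has_real_derivative dir_deriv w g (y + s *\<^sub>R w)) (at (s - s))"
    unfolding d(2) using d(1) by simp
  then have "((\<lambda>k. g ((y + s *\<^sub>R w) + (k - s) *\<^sub>R w)) has_real_derivative dir_deriv w g (y + s *\<^sub>R w)) (at s)"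
    using DERIV_shift[of "\<lambda>k. g ((y + s *\<^sub>R w) + k *\<^sub>R w)" "dir_deriv w g (y + s *\<^sub>R w)" s "-s"] by simp
  then show ?thesis by (simp add: algebra_simps)
qed

text \<open>The second difference of \<open>f\<close> over a small square is symmetric in the two
  directions. Two applications of the mean value theorem, in either order, turn it into
  \<open>h * h\<close> times one of the mixed derivatives at some point of the square; continuity
  finishes as the square shrinks.\<close>

lemma dir_deriv_commute:
  fixes f :: "'a::euclidean_space \<Rightarrow> real"
  assumes f: "smooth_on U f" and U: "open U" "x \<in> U" and uv: "u \<in> Basis" "v \<in> Basis"
  shows "dir_deriv u (dir_deriv v f) x = dir_deriv v (dir_deriv u f) x"
proof -
  note der = smooth_on_DERIV_line[OF _ U(1)]
  have mvt: "\<exists>s t. 0 < s \<and> s < h \<and> 0 < t \<and> t < h \<and>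
      f (x + h *\<^sub>R p + h *\<^sub>R q) - f (x + h *\<^sub>R p) - f (x + h *\<^sub>R q) + f x
        = h * h * dir_deriv q (dir_deriv p f) (x + s *\<^sub>R p + t *\<^sub>R q)"
    if h: "h > 0" and box: "\<And>s t. 0 \<le> s \<Longrightarrow> s \<le> h \<Longrightarrow> 0 \<le> t \<Longrightarrow> t \<le> h \<Longrightarrow> x + s *\<^sub>R p + t *\<^sub>R q \<in> U"
      and pq: "p \<in> Basis" "q \<in> Basis" for h p q
  proof -
    have d1: "((\<lambda>s. f (x + s *\<^sub>R p + h *\<^sub>R q) - f (x + s *\<^sub>R p)) has_real_derivative
        dir_deriv p f (x + s *\<^sub>R p + h *\<^sub>R q) - dir_deriv p f (x + s *\<^sub>R p)) (at s)"
      if "0 \<le> s" "s \<le> h" for s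
    proof -
      have "x + h *\<^sub>R q + s *\<^sub>R p \<in> U" "x + s *\<^sub>R p \<in> U"
        using box[of s h] box[of s 0] that h by (auto simp: algebra_simps)
      from der[OF f this(1)] der[OF f this(2)] show ?thesis
        by (auto intro!: derivative_eq_intros simp: algebra_simps)
    qed
    from MVT2[OF h d1] obtain s where s: "0 < s" "s < h" and
      1: "(f (x + h *\<^sub>R p + h *\<^sub>R q) - f (x + h *\<^sub>R p)) - (f (x + 0 *\<^sub>R p + h *\<^sub>R q) - f (x + 0 *\<^sub>R p))
        = (h - 0) * (dir_deriv p f (x + s *\<^sub>R p + h *\<^sub>R q) - dir_deriv p f (x + s *\<^sub>R p))" by blast
    have d2: "((\<lambda>t. dir_deriv p f (x + s *\<^sub>R p + t *\<^sub>R q)) has_real_derivative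
        dir_deriv q (dir_deriv p f) (x + s *\<^sub>R p + t *\<^sub>R q)) (at t)" if "0 \<le> t" "t \<le> h" for t
      by (rule der[OF smooth_on_dir_deriv[OF f pq(1)]]) (use box that s in auto)
    from MVT2[OF h d2] obtain t where t: "0 < t" "t < h" and
      2: "dir_deriv p f (x + s *\<^sub>R p + h *\<^sub>R q) - dir_deriv p f (x + s *\<^sub>R p + 0 *\<^sub>R q)
        = (h - 0) * dir_deriv q (dir_deriv p f) (x + s *\<^sub>R p + t *\<^sub>R q)" by blast
    show ?thesis using s t 1 2 by (intro exI[of _ s] exI[of _ t]) (simp add: algebra_simps)
  qed
  let ?A = "dir_deriv u (dir_deriv v f)" and ?B = "dir_deriv v (dir_deriv u f)"
  have cont: "isCont ?A x" "isCont ?B x"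
    using smooth_on_imp_continuous_on[OF smooth_on_dir_deriv[OF smooth_on_dir_deriv[OF f]]] uv U
    by (simp_all add: continuous_on_eq_continuous_at)
  have "\<bar>?A x - ?B x\<bar> < e" if e: "e > 0" for e :: real
  proof -
    obtain d1 where d1: "d1 > 0" "\<And>y. dist y x < d1 \<Longrightarrow> \<bar>?A y - ?A x\<bar> < e/2"
      using cont(1) e unfolding continuous_at_eps_delta by (metis dist_real_def half_gt_zero)
    obtain d2 where d2: "d2 > 0" "\<And>y. dist y x < d2 \<Longrightarrow> \<bar>?B y - ?B x\<bar> < e/2"
      using cont(2) e unfolding continuous_at_eps_delta by (metis dist_real_def half_gt_zero)
    obtain r where r: "r > 0" "ball x r \<subseteq> U" using U by (meson openE)
    \<comment> \<open>A point of the square is at distance at most \<open>2 * h\<close> from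
      \<open>x\<close>; the factor one third makes this strictly less than all three radii.\<close>
    define h where "h = min r (min d1 d2) / 3"
    have h: "h > 0" using r d1 d2 by (simp add: h_def)
    have near: "dist (x + s *\<^sub>R p + t *\<^sub>R q) x < min r (min d1 d2)"
      if "0 \<le> s" "s \<le> h" "0 \<le> t" "t \<le> h" "p \<in> Basis" "q \<in> Basis" for s t p q
    proof -
      have "dist (x + s *\<^sub>R p + t *\<^sub>R q) x = norm (s *\<^sub>R p + t *\<^sub>R q)"
        by (simp add: dist_norm add.assoc)
      also have "\<dots> \<le> norm (s *\<^sub>R p) + norm (t *\<^sub>R q)" by (rule norm_triangle_ineq)
      also have "\<dots> \<le> 2 * h" using that by simp
      also have "\<dots> < 3 * h" using h by simp
      finally show ?thesis by (simp add: h_def)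
    qed
    have box: "x + s *\<^sub>R p + t *\<^sub>R q \<in> U"
      if "0 \<le> s" "s \<le> h" "0 \<le> t" "t \<le> h" "p \<in> Basis" "q \<in> Basis" for s t p q
      using near[OF that] r by (auto simp: dist_commute)
    obtain s t where 1: "0 < s" "s < h" "0 < t" "t < h"
      "f (x + h *\<^sub>R v + h *\<^sub>R u) - f (x + h *\<^sub>R v) - f (x + h *\<^sub>R u) + f x
        = h * h * ?A (x + s *\<^sub>R v + t *\<^sub>R u)"
      using mvt[OF h box uv(2,1)] uv by blast
    obtain s' t' where 2: "0 < s'" "s' < h" "0 < t'" "t' < h"
      "f (x + h *\<^sub>R u + h *\<^sub>R v) - f (x + h *\<^sub>R u) - f (x + h *\<^sub>R v) + f x
        = h * h * ?B (x + s' *\<^sub>R u + t' *\<^sub>R v)"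
      using mvt[OF h box uv] uv by blast
    have "f (x + h *\<^sub>R u + h *\<^sub>R v) = f (x + h *\<^sub>R v + h *\<^sub>R u)" by (simp only: ac_simps)
    then have "h * h * ?A (x + s *\<^sub>R v + t *\<^sub>R u) = h * h * ?B (x + s' *\<^sub>R u + t' *\<^sub>R v)"
      using 1(5) 2(5) by linarith
    then have eq: "?A (x + s *\<^sub>R v + t *\<^sub>R u) = ?B (x + s' *\<^sub>R u + t' *\<^sub>R v)" using h by simp
    have "\<bar>?A (x + s *\<^sub>R v + t *\<^sub>R u) - ?A x\<bar> < e/2"
      using near[of s t v u] 1 uv by (intro d1) auto
    moreover have "\<bar>?B (x + s' *\<^sub>R u + t' *\<^sub>R v) - ?B x\<bar> < e/2"
      using near[of s' t' u v] 2 uv by (intro d2) auto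
    ultimately show ?thesis using eq by linarith
  qed
  then have "\<not> \<bar>?A x - ?B x\<bar> > 0" by blast
  then show ?thesis by simp
qed

section \<open>Smooth functions of one and several real variables\<close>

lemma Ck_DERIV:
  fixes f :: "real \<Rightarrow> real"
  assumes "\<And>x. x \<in> S \<Longrightarrow> (f has_real_derivative f' x) (at x)" "Ck k S f'"
  shows "Ck (Suc k) S f"
  using assms by (auto intro!: exI[of _ "\<lambda>x. (*) (f' x)"] simp: has_field_derivative_def)

lemma smooth_on_antiderivative:
  fixes f :: "real \<Rightarrow> real"
  assumes "open S" "\<And>x. x \<in> S \<Longrightarrow> (f has_real_derivative f' x) (at x)" "smooth_on S f'"
  shows "smooth_on S f"
  using assms Ck_DERIV Ck_Suc_imp by (metis smooth_on_iff_Ck)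

text \<open>Regularity gained from an equation: if the right-hand side is as regular as the
  solution, each order of differentiability yields the next. It serves \<open>exp\<close>, inverse
  functions and the ordinary differential equations for \<open>T\<close> and
  \<open>\<omega>\<close>.\<close>

lemma smooth_on_bootstrap:
  fixes f :: "real \<Rightarrow> real"
  assumes "open S" "\<And>x. x \<in> S \<Longrightarrow> (f has_real_derivative f' x) (at x)"
    and "\<And>k. Ck k S f \<Longrightarrow> Ck k S f'"
  shows "smooth_on S f"
proof -
  have "Ck k S f" for k
  proof (induction k)
    case 0
    have "continuous_on S f" using assms(1,2) DERIV_isCont
      by (metis continuous_at_imp_continuous_on)
    then show ?case by simp
  next
    case (Suc k)
    then show ?case using Ck_DERIV assms by blast
  qed
  then show ?thesis using assms(1) by (simp add: smooth_on_iff_Ck)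
qed

lemma smooth_on_real_deriv:
  fixes f :: "real \<Rightarrow> real"
  assumes "open S" "smooth_on S f"
  shows "x \<in> S \<Longrightarrow> (f has_real_derivative deriv f x) (at x)" "smooth_on S (deriv f)"
proof -
  have *: "(f has_real_derivative dir_deriv 1 f x) (at x)" if "x \<in> S" for x
    using smooth_on_DERIV_line[of S f 0 x 1] assms that by simp
  then have "deriv f x = dir_deriv 1 f x" if "x \<in> S" for x
    using DERIV_imp_deriv that by blast
  then show "x \<in> S \<Longrightarrow> (f has_real_derivative deriv f x) (at x)" "smooth_on S (deriv f)"
    using * smooth_on_cong[OF assms(1), of "dir_deriv 1 f" "deriv f"] smooth_on_dir_deriv[OF assms(2), of 1]
    by auto
qed

lemma Ck_inverse: "Ck k (- {0}) (inverse :: real \<Rightarrow> real)"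
proof (induction k)
  case 0
  show ?case by (auto intro!: continuous_intros)
next
  case (Suc k)
  have "Ck k (- {0}) (\<lambda>x::real. (-1) * (inverse x * inverse x))"
    by (intro Ck_mult Ck_const Suc)
  then show ?case
    by (rule Ck_DERIV[rotated]) (auto intro!: derivative_eq_intros simp: power2_eq_square)
qed

lemma smooth_on_inverse:
  fixes f :: "'a::euclidean_space \<Rightarrow> real"
  assumes "open U" "smooth_on U f" "\<And>x. x \<in> U \<Longrightarrow> f x \<noteq> 0"
  shows "smooth_on U (\<lambda>x. inverse (f x))"
proof (rule smooth_on_compose[of U "- {0}" inverse f])
  show "smooth_on (- {0}) (inverse :: real \<Rightarrow> real)"
    by (subst smooth_on_iff_Ck) (auto simp: Ck_inverse open_Compl)
qed (use assms in auto)

lemma smooth_on_divide: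
  fixes f g :: "'a::euclidean_space \<Rightarrow> real"
  assumes "open U" "smooth_on U f" "smooth_on U g" "\<And>x. x \<in> U \<Longrightarrow> g x \<noteq> 0"
  shows "smooth_on U (\<lambda>x. f x / g x)"
  unfolding divide_inverse by (intro smooth_on_mult smooth_on_inverse assms)

lemma smooth_on_exp:
  fixes f :: "'a::euclidean_space \<Rightarrow> real"
  assumes "open U" "smooth_on U f"
  shows "smooth_on U (\<lambda>x. exp (f x))"
proof (rule smooth_on_compose[of U UNIV exp f])
  show "smooth_on UNIV (exp :: real \<Rightarrow> real)"
    by (rule smooth_on_bootstrap[of _ _ exp]) auto
qed (use assms in auto)

lemma smooth_on_ln:
  fixes f :: "'a::euclidean_space \<Rightarrow> real"
  assumes "open U" "smooth_on U f" "\<And>x. x \<in> U \<Longrightarrow> f x > 0"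
  shows "smooth_on U (\<lambda>x. ln (f x))"
proof (rule smooth_on_compose[of U "{0<..}" ln f])
  show "smooth_on {0<..} (ln :: real \<Rightarrow> real)"
  proof (rule smooth_on_antiderivative)
    show "smooth_on {0<..} (inverse :: real \<Rightarrow> real)"
      using smooth_on_inverse[of "{0<..}" "\<lambda>x::real. x"] smooth_on_linear[of "{0<..}" "\<lambda>x::real. x"]
      by (simp add: bounded_linear_ident)
  qed (auto intro!: derivative_eq_intros simp: divide_inverse)
qed (use assms in auto)

lemma smooth_on_powr:
  fixes f :: "'a::euclidean_space \<Rightarrow> real"
  assumes "open U" "smooth_on U f" "\<And>x. x \<in> U \<Longrightarrow> f x > 0"
  shows "smooth_on U (\<lambda>x. f x powr c)"
proof (rule smooth_on_cong[of _ "\<lambda>x. exp (c * ln (f x))"])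
  show "smooth_on U (\<lambda>x. exp (c * ln (f x)))"
    by (intro smooth_on_exp smooth_on_mult smooth_on_const smooth_on_ln assms)
qed (use assms in \<open>force simp: powr_def\<close>)+

lemma smooth_on_sqrt:
  fixes f :: "'a::euclidean_space \<Rightarrow> real"
  assumes "open U" "smooth_on U f" "\<And>x. x \<in> U \<Longrightarrow> f x > 0"
  shows "smooth_on U (\<lambda>x. sqrt (f x))"
  by (rule smooth_on_cong[OF assms(1) _ smooth_on_powr[OF assms, of "1/2"]])
     (use assms(3) in \<open>auto simp: powr_half_sqrt less_imp_le\<close>)

text \<open>A positive derivative on an interval makes \<open>f\<close> strictly increasing, and
  invariance of domain opens its image. The inverse g has derivative 1 / f'(g), as regular as g
  itself, so the bootstrap applies.\<close>

lemma smooth_on_inv_into: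
  fixes f :: "real \<Rightarrow> real"
  assumes S: "open S" "is_interval S" and f: "smooth_on S f" and pos: "\<And>x. x \<in> S \<Longrightarrow> deriv f x > 0"
  shows "inj_on f S" "open (f ` S)" "smooth_on (f ` S) (inv_into S f)"
proof -
  have "f x < f y" if "x \<in> S" "y \<in> S" "x < y" for x y
  proof (rule DERIV_pos_imp_increasing[OF that(3)])
    fix z assume "x \<le> z" "z \<le> y"
    then have "z \<in> S" using S(2) that by (meson mem_is_interval_1_I)
    then show "\<exists>d. DERIV f z :> d \<and> d > 0" using smooth_on_real_deriv(1)[OF S(1) f] pos by blast
  qed
  then show inj: "inj_on f S" by (metis inj_onI linorder_neqE_linordered_idom less_irrefl)
  have cont: "continuous_on S f" by (rule smooth_on_imp_continuous_on[OF f])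
  then show op: "open (f ` S)" using inj S by (intro invariance_of_domain)
  let ?g = "inv_into S f"
  have d: "(?g has_real_derivative inverse (deriv f (?g y))) (at y)" if y: "y \<in> f ` S" for y
  proof -
    obtain x where x: "x \<in> S" "y = f x" using y by blast
    have "(?g has_real_derivative inverse (deriv f x)) (at (f x))"
      unfolding has_field_derivative_def
    proof (rule has_derivative_inverse_strong[OF S(1) x(1) cont])
      show "(f has_derivative (*) (deriv f x)) (at x)"
        using smooth_on_real_deriv(1)[OF S(1) f x(1)] by (simp add: has_field_derivative_def)
      show "(*) (deriv f x) \<circ> (*) (inverse (deriv f x)) = id"
        using pos[OF x(1)] by (auto simp: fun_eq_iff)
    qed (use inj in auto)
    then show ?thesis using x inj by simp
  qed
  show "smooth_on (f ` S) ?g"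
  proof (rule smooth_on_bootstrap[OF op d])
    fix k assume k: "Ck k (f ` S) ?g"
    have "smooth_on S (\<lambda>x. inverse (deriv f x))"
      by (rule smooth_on_inverse[OF S(1) smooth_on_real_deriv(2)[OF S(1) f]]) (use pos in force)
    then have "Ck k S (\<lambda>x. inverse (deriv f x))" using S(1) by (simp add: smooth_on_iff_Ck)
    then show "Ck k (f ` S) (\<lambda>y. inverse (deriv f (?g y)))"
      by (rule Ck_compose) (use k in \<open>auto simp: inv_into_into\<close>)
  qed
qed

section \<open>Partial derivatives in two and three variables, local inverses in the plane\<close>

abbreviation Dt :: "(real \<times> real \<Rightarrow> real) \<Rightarrow> real \<times> real \<Rightarrow> real" where "Dt \<equiv> dir_deriv (1, 0)"
abbreviation Dx :: "(real \<times> real \<Rightarrow> real) \<Rightarrow> real \<times> real \<Rightarrow> real" where "Dx \<equiv> dir_deriv (0, 1)"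
abbreviation D1 :: "(real \<times> real \<times> real \<Rightarrow> real) \<Rightarrow> real \<times> real \<times> real \<Rightarrow> real"
  where "D1 \<equiv> dir_deriv (1, 0, 0)"
abbreviation D2 :: "(real \<times> real \<times> real \<Rightarrow> real) \<Rightarrow> real \<times> real \<times> real \<Rightarrow> real"
  where "D2 \<equiv> dir_deriv (0, 1, 0)"
abbreviation D3 :: "(real \<times> real \<times> real \<Rightarrow> real) \<Rightarrow> real \<times> real \<times> real \<Rightarrow> real"
  where "D3 \<equiv> dir_deriv (0, 0, 1)"

lemma Basis_real2: "(Basis :: (real \<times> real) set) = {(1, 0), (0, 1)}"
  by (auto simp: Basis_prod_def)

lemma Basis_real3: "(Basis :: (real \<times> real \<times> real) set) = {(1, 0, 0), (0, 1, 0), (0, 0, 1)}"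
  by (auto simp: Basis_prod_def zero_prod_def)

lemma basis2: "(1, 0) \<in> (Basis :: (real \<times> real) set)" "(0, 1) \<in> (Basis :: (real \<times> real) set)"
  by (auto simp: Basis_real2)

lemma basis3: "(1, 0, 0) \<in> (Basis :: (real \<times> real \<times> real) set)"
  "(0, 1, 0) \<in> (Basis :: (real \<times> real \<times> real) set)"
  "(0, 0, 1) \<in> (Basis :: (real \<times> real \<times> real) set)"
  by (auto simp: Basis_real3)

lemma has_derivative2:
  assumes "smooth_on U f" "open U" "p \<in> U"
  shows "(f has_derivative (\<lambda>h. fst h * Dt f p + snd h * Dx f p)) (at p)"
  using smooth_on_imp_has_derivative[OF assms]
  by (simp add: Basis_real2 inner_prod_def)

lemma has_derivative3:
  assumes "smooth_on U f" "open U" "p \<in> U"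
  shows "(f has_derivative (\<lambda>h. fst h * D1 f p + fst (snd h) * D2 f p + snd (snd h) * D3 f p)) (at p)"
  using smooth_on_imp_has_derivative[OF assms]
  by (simp add: Basis_real3 inner_prod_def add.assoc)

lemma DERIV_curve2:
  assumes "smooth_on U f" "open U" "(\<alpha> t, \<beta> t) \<in> U"
    and "(\<alpha> has_real_derivative \<alpha>') (at t)" "(\<beta> has_real_derivative \<beta>') (at t)"
  shows "((\<lambda>t. f (\<alpha> t, \<beta> t)) has_real_derivative \<alpha>' * Dt f (\<alpha> t, \<beta> t) + \<beta>' * Dx f (\<alpha> t, \<beta> t)) (at t)"
proof -
  have "((\<lambda>t. (\<alpha> t, \<beta> t)) has_derivative (\<lambda>h. (\<alpha>' * h, \<beta>' * h))) (at t)"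
    using assms(4,5) by (intro has_derivative_Pair) (auto simp: has_field_derivative_def)
  from has_derivative_compose[OF this has_derivative2[OF assms(1-3)]]
  show ?thesis unfolding has_field_derivative_def
    by (rule has_derivative_eq_rhs) (auto simp: algebra_simps)
qed

lemma DERIV_curve3:
  assumes "smooth_on U f" "open U" "(\<alpha> t, \<beta> t, \<gamma> t) \<in> U"
    and "(\<alpha> has_real_derivative \<alpha>') (at t)" "(\<beta> has_real_derivative \<beta>') (at t)"
      "(\<gamma> has_real_derivative \<gamma>') (at t)"
  shows "((\<lambda>t. f (\<alpha> t, \<beta> t, \<gamma> t)) has_real_derivative
     \<alpha>' * D1 f (\<alpha> t, \<beta> t, \<gamma> t) + \<beta>' * D2 f (\<alpha> t, \<beta> t, \<gamma> t) + \<gamma>' * D3 f (\<alpha> t, \<beta> t, \<gamma> t)) (at t)"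
proof -
  have "((\<lambda>t. (\<alpha> t, \<beta> t, \<gamma> t)) has_derivative (\<lambda>h. (\<alpha>' * h, \<beta>' * h, \<gamma>' * h))) (at t)"
    using assms(4-6) by (intro has_derivative_Pair) (auto simp: has_field_derivative_def)
  from has_derivative_compose[OF this has_derivative3[OF assms(1-3)]]
  show ?thesis unfolding has_field_derivative_def
    by (rule has_derivative_eq_rhs) (auto simp: algebra_simps)
qed

lemma smooth_on_fst: "open U \<Longrightarrow> smooth_on U (fst :: real \<times> 'a::euclidean_space \<Rightarrow> real)"
  by (rule smooth_on_linear) (auto intro: bounded_linear_fst)

lemma smooth_on_fst_snd: "open U \<Longrightarrow> smooth_on U (\<lambda>p :: real \<times> real \<times> 'a::euclidean_space. fst (snd p))"
  by (rule smooth_on_linear) (auto intro!: bounded_linear_intros)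

lemma smooth_on_snd: "open U \<Longrightarrow> smooth_on U (snd :: 'a::euclidean_space \<times> real \<Rightarrow> real)"
  by (rule smooth_on_linear) (auto intro: bounded_linear_snd)

lemma smooth_on_snd_snd:
  "open U \<Longrightarrow> smooth_on U (\<lambda>p :: 'a::euclidean_space \<times> 'b::euclidean_space \<times> real. snd (snd p))"
  by (rule smooth_on_linear) (auto intro!: bounded_linear_intros)

text \<open>The inverse function theorem supplies a differentiable inverse g with known derivative.
  By Cramer's rule the entries of that derivative are smooth functions composed with g, so
  differentiability of order k for g gives order k + 1.\<close>

lemma smooth_inverse_function2:
  assumes \<alpha>: "smooth_on U \<alpha>" and \<beta>: "smooth_on U \<beta>" and U: "open U" "p \<in> U"
    and nz: "Dt \<alpha> p * Dx \<beta> p - Dx \<alpha> p * Dt \<beta> p \<noteq> 0"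
  obtains U' V g where "open U'" "U' \<subseteq> U" "p \<in> U'" "open V"
    "homeomorphism U' V (\<lambda>q. (\<alpha> q, \<beta> q)) g" "smooth_on V g"
proof -
  define J where "J = (\<lambda>p. Dt \<alpha> p * Dx \<beta> p - Dx \<alpha> p * Dt \<beta> p)"
  have s: "smooth_on U (Dt \<alpha>)" "smooth_on U (Dx \<alpha>)" "smooth_on U (Dt \<beta>)" "smooth_on U (Dx \<beta>)"
    using \<alpha> \<beta> by (auto intro: smooth_on_dir_deriv basis2)
  have J: "smooth_on U J" unfolding J_def by (intro smooth_on_diff smooth_on_mult s U)
  \<comment> \<open>On this open set the Jacobian \<open>J\<close> has no zero, so the entries of
    the inverse matrix are smooth quotients there.\<close>
  define U0 where "U0 = U \<inter> J -` (- {0})"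
  have U0: "open U0" unfolding U0_def
    by (rule continuous_open_preimage[OF smooth_on_imp_continuous_on[OF J] U(1)]) auto
  have U0U: "U0 \<subseteq> U" by (auto simp: U0_def)
  have pU0: "p \<in> U0" using U nz by (simp add: U0_def J_def)
  have bl: "bounded_linear (\<lambda>h::real \<times> real. (fst h * a + snd h * b, fst h * c + snd h * d))" for a b c d
    by (intro bounded_linear_Pair bounded_linear_add bounded_linear_mult_const bounded_linear_fst bounded_linear_snd)
  define M where "M = (\<lambda>q. Blinfun (\<lambda>h. (fst h * Dt \<alpha> q + snd h * Dx \<alpha> q, fst h * Dt \<beta> q + snd h * Dx \<beta> q)))"
  have M: "blinfun_apply (M q) = (\<lambda>h. (fst h * Dt \<alpha> q + snd h * Dx \<alpha> q, fst h * Dt \<beta> q + snd h * Dx \<beta> q))" for q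
    unfolding M_def by (rule bounded_linear_Blinfun_apply[OF bl])
  \<comment> \<open>The inverse of the Jacobian matrix at \<open>p\<close>, from Cramer's
    rule.\<close>
  define N where "N = Blinfun (\<lambda>h. (fst h * (Dx \<beta> p / J p) + snd h * (- Dx \<alpha> p / J p), fst h * (- Dt \<beta> p / J p) + snd h * (Dt \<alpha> p / J p)))"
  have N: "blinfun_apply N = (\<lambda>h. (fst h * (Dx \<beta> p / J p) + snd h * (- Dx \<alpha> p / J p), fst h * (- Dt \<beta> p / J p) + snd h * (Dt \<alpha> p / J p)))"
    unfolding N_def by (rule bounded_linear_Blinfun_apply[OF bl])
  let ?f = "\<lambda>q. (\<alpha> q, \<beta> q)"
  have der: "(?f has_derivative blinfun_apply (M q)) (at q)" if "q \<in> U0" for q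
    unfolding M using that U0U by (intro has_derivative_Pair has_derivative2[OF \<alpha> U(1)] has_derivative2[OF \<beta> U(1)]) auto
  have cont: "continuous_on U0 M"
  proof (rule continuous_on_blinfun_componentwise)
    fix i :: "real \<times> real"
    show "continuous_on U0 (\<lambda>x. blinfun_apply (M x) i)"
      unfolding M by (rule continuous_on_subset[OF _ U0U])
       (intro continuous_intros smooth_on_imp_continuous_on s)
  qed
  have Jp: "J p \<noteq> 0" using nz by (simp add: J_def)
  have inv: "N o\<^sub>L M p = id_blinfun"
  proof (rule blinfun_eqI)
    fix h :: "real \<times> real"
    have "(fst h * Dt \<alpha> p + snd h * Dx \<alpha> p) * Dx \<beta> p - (fst h * Dt \<beta> p + snd h * Dx \<beta> p) * Dx \<alpha> p = fst h * J p"
      "(fst h * Dt \<beta> p + snd h * Dx \<beta> p) * Dt \<alpha> p - (fst h * Dt \<alpha> p + snd h * Dx \<alpha> p) * Dt \<beta> p = snd h * J p"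
      by (simp_all add: J_def algebra_simps)
    then show "blinfun_apply (N o\<^sub>L M p) h = blinfun_apply id_blinfun h"
      using Jp by (simp add: M N prod_eq_iff field_simps)
  qed
  obtain U' V g g' where *: "open U'" "U' \<subseteq> U0" "p \<in> U'" "open V" "?f p \<in> V" "homeomorphism U' V ?f g"
      "\<And>y. y \<in> V \<Longrightarrow> (g has_derivative (g' y)) (at y)"
      "\<And>y. y \<in> V \<Longrightarrow> g' y = inv (blinfun_apply (M (g y)))"
      "\<And>y. y \<in> V \<Longrightarrow> bij (blinfun_apply (M (g y)))"
    using inverse_function_theorem[OF U0 der cont pU0 inv] by blast
  have gV: "g ` V \<subseteq> U0" using *(2,6) by (auto simp: homeomorphism_def)
  have g': "g' y (1,0) = (Dx \<beta> (g y) / J (g y), - Dt \<beta> (g y) / J (g y))"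
    "g' y (0,1) = (- Dx \<alpha> (g y) / J (g y), Dt \<alpha> (g y) / J (g y))" if "y \<in> V" for y
  proof -
    have Jn: "J (g y) \<noteq> 0" using gV that by (auto simp: U0_def)
    have "M (g y) (Dx \<beta> (g y) / J (g y), - Dt \<beta> (g y) / J (g y)) = (1, 0)"
      "M (g y) (- Dx \<alpha> (g y) / J (g y), Dt \<alpha> (g y) / J (g y)) = (0, 1)"
      using Jn by (simp_all add: M field_simps) (simp_all add: J_def algebra_simps)
    then show "g' y (1,0) = (Dx \<beta> (g y) / J (g y), - Dt \<beta> (g y) / J (g y))"
      "g' y (0,1) = (- Dx \<alpha> (g y) / J (g y), Dt \<alpha> (g y) / J (g y))"
      using *(8,9)[OF that] by (auto intro!: inv_f_eq bij_is_inj)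
  qed
  have quot: "Ck k U0 (\<lambda>q. h q / J q)" if "smooth_on U h" for k h
  proof -
    have "smooth_on U0 (\<lambda>q. h q / J q)"
      by (intro smooth_on_divide smooth_on_subset[OF U(1) U0 U0U] that J U0) (auto simp: U0_def)
    then show ?thesis using U0 by (simp add: smooth_on_iff_Ck)
  qed
  have Ckg: "Ck k V (\<lambda>y. fst (g y)) \<and> Ck k V (\<lambda>y. snd (g y))" for k
  proof (induction k)
    case 0
    have "continuous_on V g" using *(6) by (simp add: homeomorphism_def)
    then show ?case by (auto intro!: continuous_intros)
  next
    case (Suc k)
    have comp: "Ck k V (\<lambda>y. h (g y))" if "Ck k U0 h" for h
      by (rule Ck_compose[OF that _ gV]) (use Suc in \<open>auto simp: Basis_prod_def inner_prod_def\<close>)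
    have fd: "((\<lambda>y. fst (g y)) has_derivative (\<lambda>h. fst (g' y h))) (at y)"
      "((\<lambda>y. snd (g y)) has_derivative (\<lambda>h. snd (g' y h))) (at y)" if "y \<in> V" for y
      using has_derivative_fst[OF *(7)[OF that]] has_derivative_snd[OF *(7)[OF that]] by auto
    have "Ck k V (\<lambda>y. fst (g' y v))" "Ck k V (\<lambda>y. snd (g' y v))" if v: "v \<in> Basis" for v
    proof -
      have mDt: "smooth_on U (\<lambda>p. - Dt \<beta> p)" "smooth_on U (\<lambda>p. - Dx \<alpha> p)"
        by (intro smooth_on_minus U s)+
      consider "v = (1,0)" | "v = (0,1)" using v by (auto simp: Basis_real2)
      then show "Ck k V (\<lambda>y. fst (g' y v))" "Ck k V (\<lambda>y. snd (g' y v))"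
      proof (atomize (full), cases)
        case 1
        have "Ck k V (\<lambda>y. Dx \<beta> (g y) / J (g y))" "Ck k V (\<lambda>y. - Dt \<beta> (g y) / J (g y))"
          using comp[OF quot[OF s(4)]] comp[OF quot[OF mDt(1)]] by auto
        then show "Ck k V (\<lambda>y. fst (g' y v)) \<and> Ck k V (\<lambda>y. snd (g' y v))"
          unfolding 1 using g' Ck_cong[OF *(4)] by (metis (mono_tags, lifting) fst_conv snd_conv)
      next
        case 2
        have "Ck k V (\<lambda>y. - Dx \<alpha> (g y) / J (g y))" "Ck k V (\<lambda>y. Dt \<alpha> (g y) / J (g y))"
          using comp[OF quot[OF s(1)]] comp[OF quot[OF mDt(2)]] by auto
        then show "Ck k V (\<lambda>y. fst (g' y v)) \<and> Ck k V (\<lambda>y. snd (g' y v))"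
          unfolding 2 using g' Ck_cong[OF *(4)] by (metis (mono_tags, lifting) fst_conv snd_conv)
      qed
    qed
    then show ?case using fd
      unfolding Ck.simps
      by (intro conjI exI[of _ "\<lambda>y h. fst (g' y h)"] exI[of _ "\<lambda>y h. snd (g' y h)"]) auto
  qed
  then have "smooth_on V (\<lambda>y. fst (g y))" "smooth_on V (\<lambda>y. snd (g y))"
    using *(4) by (simp_all add: smooth_on_iff_Ck)
  then have "smooth_on V g" using smooth_on_Pair[of V "\<lambda>y. fst (g y)" "\<lambda>y. snd (g y)"] by simp
  then show thesis using that *(1-4,6) U0U by blast
qed

text \<open>The equations are stated with iterated one-variable \<open>deriv\<close>, the calculus
  uses \<open>dir_deriv\<close>. For the second derivative the agreement of the first ones is needed
  on a whole neighbourhood, which openness of \<open>Om\<close> provides.\<close>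

lemma partials_eq_dir_deriv:
  assumes "smooth_on Om (\<lambda>p. u (fst p) (snd p))" "open Om" "(t, x) \<in> Om"
  shows "pt u t x = Dt (\<lambda>p. u (fst p) (snd p)) (t, x)"
    "px u t x = Dx (\<lambda>p. u (fst p) (snd p)) (t, x)"
    "pxx u t x = Dx (Dx (\<lambda>p. u (fst p) (snd p))) (t, x)"
proof -
  let ?F = "\<lambda>p. u (fst p) (snd p)"
  show "pt u t x = Dt ?F (t, x)"
    unfolding pt_def using DERIV_curve2[OF assms(1,2), of "\<lambda>s. s" t "\<lambda>s. x" 1 0] assms(3)
    by (intro DERIV_imp_deriv) (auto intro: derivative_intros)
  have px: "px u t y = Dx ?F (t, y)" if "(t, y) \<in> Om" for y
    unfolding px_def using DERIV_curve2[OF assms(1,2), of "\<lambda>s. t" y "\<lambda>s. s" 0 1] that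
    by (intro DERIV_imp_deriv) (auto intro: derivative_intros)
  then show "px u t x = Dx ?F (t, x)" using assms by blast
  have "((\<lambda>y. (t, y)) \<longlongrightarrow> (t, x)) (nhds x)" by (intro tendsto_intros) (simp add: filterlim_ident)
  then have "\<forall>\<^sub>F y in nhds x. (t, y) \<in> Om" using assms(2,3) by (auto dest: topological_tendstoD)
  then have "\<forall>\<^sub>F y in nhds x. px u t y = Dx ?F (t, y)" by eventually_elim (use px in auto)
  then have "pxx u t x = deriv (\<lambda>y. Dx ?F (t, y)) x" unfolding pxx_def by (intro deriv_cong_ev) auto
  also have "\<dots> = Dx (Dx ?F) (t, x)"
    using DERIV_curve2[OF smooth_on_dir_deriv[OF assms(1) basis2(2)] assms(2), of "\<lambda>s. t" x "\<lambda>s. s" 0 1] assms(3)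
    by (intro DERIV_imp_deriv) (auto intro: derivative_intros)
  finally show "pxx u t x = Dx (Dx ?F) (t, x)" .
qed

lemma smooth_on_imp_continuous_on_vec:
  assumes "smooth_on U f"
  shows "continuous_on U f"
  using assms smooth_on_componentwise[of U f] smooth_on_imp_continuous_on continuous_on_componentwise[of U f]
  by blast

lemma DERIV_cong_open:
  fixes f g :: "real \<Rightarrow> real"
  assumes "(f has_real_derivative d) (at x)" "open V" "x \<in> V" "\<And>y. y \<in> V \<Longrightarrow> f y = g y"
  shows "(g has_real_derivative d) (at x)"
  using assms unfolding has_field_derivative_def by (rule has_derivative_transform_within_open)

lemma deriv_eqI_ev:
  fixes f g :: "real \<Rightarrow> real"
  assumes "(g has_real_derivative d) (at x)" "\<forall>\<^sub>F y in nhds x. f y = g y"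
  shows "deriv f x = d"
  using deriv_cong_ev[OF assms(2) refl] DERIV_imp_deriv[OF assms(1)] by simp

lemma DERIV_const_exp:
  fixes f :: "real \<Rightarrow> real"
  assumes "(f has_real_derivative d) (at x)"
  shows "((\<lambda>x. C * exp (f x)) has_real_derivative C * exp (f x) * d) (at x)"
  by (rule derivative_eq_intros assms refl)+ simp

section \<open>The explicit transformation\<close>

locale parabolic =
  fixes a b c I B :: "real \<Rightarrow> real" and S :: "real set"
  assumes S: "is_interval S" "open S" "S \<noteq> {}"
    and smooth: "smooth_on S a" "smooth_on S b" "smooth_on S c"
    and apos: "x \<in> S \<Longrightarrow> a x > 0"
    and I: "x \<in> S \<Longrightarrow> (I has_real_derivative 1 / sqrt (a x)) (at x)"
    and B: "x \<in> S \<Longrightarrow> (B has_real_derivative b x / (2 * a x)) (at x)"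
begin

text \<open>Writing \<open>a\<close> as the square of \<open>r\<close> makes all later identities
  rational, without square roots, and \<open>r\<close> times d/dx is the derivative with respect to
  \<open>I\<close>.\<close>

definition r :: "real \<Rightarrow> real" where "r x = sqrt (a x)"
abbreviation J :: "real \<Rightarrow> real" where "J \<equiv> Jf a b"
abbreviation K :: "real \<Rightarrow> real" where "K \<equiv> Kf a b c"

lemma r: "x \<in> S \<Longrightarrow> r x > 0" "x \<in> S \<Longrightarrow> a x = r x ^ 2"
  using apos by (auto simp: r_def less_imp_le)

lemma smooth_r: "smooth_on S r"
  unfolding r_def[abs_def] by (rule smooth_on_sqrt[OF S(2) smooth(1) apos])

lemma DERIV_r: "x \<in> S \<Longrightarrow> (r has_real_derivative deriv r x) (at x)"
  by (rule smooth_on_real_deriv[OF S(2) smooth_r])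

lemma J_eq: "J x = deriv r x - b x / r x"
  by (simp add: Jf_def r_def[abs_def])

lemma smooth_J: "smooth_on S J"
proof -
  have "smooth_on S (\<lambda>x. deriv r x - b x / r x)"
    by (intro smooth_on_diff smooth_on_divide smooth_on_real_deriv smooth_r smooth S) (use r in force)
  then show ?thesis by (simp add: J_eq[abs_def])
qed

lemma DERIV_J: "x \<in> S \<Longrightarrow> (J has_real_derivative deriv J x) (at x)"
  by (rule smooth_on_real_deriv[OF S(2) smooth_J])

lemma K_eq: "K x = r x * deriv J x / 2 - (J x)^2 / 4 + c x"
  by (simp add: Kf_def r_def)

lemma smooth_K: "smooth_on S K"
proof -
  have "smooth_on S (\<lambda>x. r x * deriv J x * (1/2) - (J x)^2 * (1/4) + c x)"
    by (intro smooth_on_diff smooth_on_add smooth_on_mult smooth_on_power smooth_on_const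
        smooth_on_real_deriv smooth_r smooth_J smooth S)
  then show ?thesis by (simp add: K_eq[abs_def])
qed

lemma DERIV_I: "x \<in> S \<Longrightarrow> (I has_real_derivative 1 / r x) (at x)"
  using I by (simp add: r_def)

lemma smooth_I: "smooth_on S I"
proof (rule smooth_on_antiderivative[OF S(2) DERIV_I])
  show "smooth_on S (\<lambda>x. 1 / r x)"
    by (intro smooth_on_divide smooth_on_const smooth_r S) (use r in force)
qed

lemma smooth_B: "smooth_on S B"
proof (rule smooth_on_antiderivative[OF S(2) B])
  show "smooth_on S (\<lambda>x. b x / (2 * a x))"
    by (intro smooth_on_divide smooth_on_mult smooth_on_const smooth S) (use apos in force)
qed

lemma deriv_I_pos: "x \<in> S \<Longrightarrow> deriv I x > 0"
  using DERIV_imp_deriv[OF DERIV_I] r by simp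

lemmas inv_I = smooth_on_inv_into[OF S(2,1) smooth_I deriv_I_pos]

end

locale heat_map = parabolic +
  fixes c0 c1 c2 :: real and Tint :: "real set" and T \<omega> W :: "real \<Rightarrow> real" and C :: real
  assumes K_quadratic: "x \<in> S \<Longrightarrow> Kf a b c x = c2 * (I x)^2 + c1 * I x + c0"
    and Tint: "is_interval Tint" "open Tint" "Tint \<noteq> {}"
    and T: "t \<in> Tint \<Longrightarrow> T differentiable (at t)" "t \<in> Tint \<Longrightarrow> deriv T differentiable (at t)"
      "t \<in> Tint \<Longrightarrow> deriv (deriv T) differentiable (at t)" "t \<in> Tint \<Longrightarrow> deriv T t > 0"
      "t \<in> Tint \<Longrightarrow> schwarzian T t = 8 * c2"
    and \<omega>: "t \<in> Tint \<Longrightarrow> \<omega> differentiable (at t)" "t \<in> Tint \<Longrightarrow> deriv \<omega> differentiable (at t)"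
      "t \<in> Tint \<Longrightarrow> deriv (deriv \<omega>) t + 4 * c2 * \<omega> t = 2 * c1"
    and W: "t \<in> Tint \<Longrightarrow> (W has_real_derivative (c2 * (\<omega> t)^2 - 1/4 * (deriv \<omega> t)^2 - c0)) (at t)"
    and C: "C \<noteq> 0"
begin

section \<open>Regularity of the parameter functions\<close>

text \<open>The logarithmic derivative of \<open>deriv T\<close>. In terms of \<open>q\<close> the
  Schwarzian is q' - q^2/2, so the third-order condition on \<open>T\<close> becomes a Riccati
  equation.\<close>

definition q :: "real \<Rightarrow> real" where "q t = deriv (deriv T) t / deriv T t"

lemma DERIV_T: "t \<in> Tint \<Longrightarrow> (T has_real_derivative deriv T t) (at t)"
  "t \<in> Tint \<Longrightarrow> (deriv T has_real_derivative q t * deriv T t) (at t)"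
  "t \<in> Tint \<Longrightarrow> (q has_real_derivative (q t)^2 / 2 + 8 * c2) (at t)"
proof -
  assume t: "t \<in> Tint"
  have d: "(T has_real_derivative deriv T t) (at t)"
    "(deriv T has_real_derivative deriv (deriv T) t) (at t)"
    "(deriv (deriv T) has_real_derivative deriv (deriv (deriv T)) t) (at t)"
    using T t by (auto simp: DERIV_deriv_iff_real_differentiable)
  have p: "deriv T t > 0" using T t by simp
  show "(T has_real_derivative deriv T t) (at t)" by (rule d)
  show "(deriv T has_real_derivative q t * deriv T t) (at t)" using d p by (simp add: q_def)
  have "deriv (deriv (deriv T)) t / deriv T t - 3/2 * (q t)^2 = 8 * c2"
    using T(5)[OF t] by (simp add: schwarzian_def q_def)
  then have t3: "deriv (deriv (deriv T)) t / deriv T t = 8 * c2 + 3/2 * (q t)^2" by simp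
  have "(q has_real_derivative deriv (deriv (deriv T)) t / deriv T t - (q t)^2) (at t)"
    unfolding q_def[abs_def] using p
    by (auto intro!: derivative_eq_intros d simp: field_simps power2_eq_square)
  then show "(q has_real_derivative (q t)^2 / 2 + 8 * c2) (at t)" unfolding t3 by (simp add: field_simps)
qed

text \<open>The right-hand side of the Riccati equation is polynomial in \<open>q\<close>, so it
  inherits the order of differentiability of \<open>q\<close>. Smoothness then passes to
  \<open>deriv T\<close>, which satisfies f' = \<open>q\<close> f, and by integration to
  \<open>T\<close>.\<close>

lemma smooth_q: "smooth_on Tint q"
proof (rule smooth_on_bootstrap[OF Tint(2) DERIV_T(3)])
  fix k assume "Ck k Tint q"
  then have "Ck k Tint (\<lambda>t. q t * q t * (1/2) + 8 * c2)"
    by (intro Ck_add Ck_mult Ck_const)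
  then show "Ck k Tint (\<lambda>t. (q t)^2 / 2 + 8 * c2)" by (simp add: power2_eq_square)
qed

lemma smooth_dT: "smooth_on Tint (deriv T)"
proof (rule smooth_on_bootstrap[OF Tint(2) DERIV_T(2)])
  fix k assume "Ck k Tint (deriv T)"
  then show "Ck k Tint (\<lambda>t. q t * deriv T t)"
    using smooth_q Tint(2) by (intro Ck_mult) (simp_all add: smooth_on_iff_Ck)
qed

lemma smooth_T: "smooth_on Tint T"
  by (rule smooth_on_antiderivative[OF Tint(2) DERIV_T(1) smooth_dT])

lemmas inv_T = smooth_on_inv_into[OF Tint(2,1) smooth_T T(4)]

lemma DERIV_\<omega>: "t \<in> Tint \<Longrightarrow> (\<omega> has_real_derivative deriv \<omega> t) (at t)"
  "t \<in> Tint \<Longrightarrow> (deriv \<omega> has_real_derivative 2 * c1 - 4 * c2 * \<omega> t) (at t)"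
proof -
  assume t: "t \<in> Tint"
  have "deriv (deriv \<omega>) t = 2 * c1 - 4 * c2 * \<omega> t" using \<omega>(3)[OF t] by linarith
  then show "(\<omega> has_real_derivative deriv \<omega> t) (at t)"
    "(deriv \<omega> has_real_derivative 2 * c1 - 4 * c2 * \<omega> t) (at t)"
    using \<omega>(1,2)[OF t] by (metis DERIV_deriv_iff_real_differentiable)+
qed

text \<open>For a second-order equation the bootstrap goes through the second derivative: if
  \<open>\<omega>\<close> has order k, so has its second derivative, hence
  \<open>deriv \<omega>\<close> has order k + 1.\<close>

lemma smooth_\<omega>: "smooth_on Tint \<omega>"
proof (rule smooth_on_bootstrap[OF Tint(2) DERIV_\<omega>(1)])
  fix k assume "Ck k Tint \<omega>"
  then have "Ck k Tint (\<lambda>t. 2 * c1 + (- 4 * c2) * \<omega> t)"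
    by (intro Ck_add Ck_mult Ck_const)
  then have "Ck k Tint (\<lambda>t. 2 * c1 - 4 * c2 * \<omega> t)" by simp
  from Ck_Suc_imp[OF Ck_DERIV[OF DERIV_\<omega>(2) this]] show "Ck k Tint (deriv \<omega>)" by simp
qed

lemma smooth_d\<omega>: "smooth_on Tint (deriv \<omega>)"
  by (rule smooth_on_real_deriv[OF Tint(2) smooth_\<omega>])

lemma smooth_W: "smooth_on Tint W"
proof (rule smooth_on_antiderivative[OF Tint(2) W])
  show "smooth_on Tint (\<lambda>x. c2 * (\<omega> x)\<^sup>2 - 1 / 4 * (deriv \<omega> x)\<^sup>2 - c0)"
    by (intro smooth_on_diff smooth_on_mult smooth_on_power smooth_on_const smooth_\<omega> smooth_d\<omega> Tint)
qed

section \<open>The multiplier and the operator identity\<close>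

definition X :: "real \<Rightarrow> real \<Rightarrow> real" where "X t x = sqrt (deriv T t) * (I x + \<omega> t)"
definition M :: "real \<Rightarrow> real \<Rightarrow> real" where
  "M t x = C * (deriv T t * a x) powr (1/4) * exp (- B x
      + deriv (deriv T) t / (8 * deriv T t) * (I x + \<omega> t)^2 + deriv \<omega> t * I x / 2 - W t)"

text \<open>With the fourth root absorbed into the exponent, logarithmic derivatives of
  \<open>M\<close> are plain derivatives of the exponent.\<close>

lemma M_eq: "t \<in> Tint \<Longrightarrow> x \<in> S \<Longrightarrow>
  M t x = C * exp ((ln (deriv T t) + ln (a x)) / 4 - B x + q t / 8 * (I x + \<omega> t)^2 + deriv \<omega> t * I x / 2 - W t)"
  using T(4)[of t] apos[of x]
  by (simp add: M_def q_def powr_def ln_mult mult.assoc add_divide_distrib flip: exp_add)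

lemma M_nz: "t \<in> Tint \<Longrightarrow> x \<in> S \<Longrightarrow> M t x \<noteq> 0"
  using C by (simp add: M_eq)

text \<open>Twice the logarithmic derivative of \<open>M\<close> with respect to \<open>I\<close>,
  that is, 2 r M_x / M.\<close>

definition n :: "real \<Rightarrow> real \<Rightarrow> real" where "n t x = J x + q t * (I x + \<omega> t) / 2 + deriv \<omega> t"

lemma DERIV_M_x:
  assumes t: "t \<in> Tint" and x: "x \<in> S"
  shows "((\<lambda>x. M t x) has_real_derivative M t x * (n t x / (2 * r x))) (at x)"
proof (rule DERIV_cong_open[OF _ S(2) x M_eq[symmetric, OF t]])
  have a1: "(a has_real_derivative deriv a x) (at x)" by (rule smooth_on_real_deriv(1)[OF S(2) smooth(1) x])
  have "((\<lambda>x. r x ^ 2) has_real_derivative 2 * r x * deriv r x) (at x)"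
    by (auto intro!: derivative_eq_intros DERIV_r x)
  then have "(a has_real_derivative 2 * r x * deriv r x) (at x)"
    by (rule DERIV_cong_open[OF _ S(2) x]) (use r in auto)
  then have a': "deriv a x = 2 * r x * deriv r x" using a1 DERIV_unique by blast
  have rp: "r x > 0" and ap: "a x > 0" using r apos x by auto
  have nn: "n t x / (2 * r x) = deriv a x / a x / 4 - b x / (2 * a x) + q t / 8 * (2 * (I x + \<omega> t) * (1 / r x)) + deriv \<omega> t * (1 / r x) / 2"
    using rp unfolding a' r(2)[OF x] n_def J_eq by (simp add: field_simps power2_eq_square)
  show "((\<lambda>x. C * exp ((ln (deriv T t) + ln (a x)) / 4 - B x + q t / 8 * (I x + \<omega> t)^2 + deriv \<omega> t * I x / 2 - W t))
     has_real_derivative M t x * (n t x / (2 * r x))) (at x)"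
    unfolding nn M_eq[OF t x]
  proof (rule DERIV_const_exp)
    show "((\<lambda>x. (ln (deriv T t) + ln (a x)) / 4 - B x + q t / 8 * (I x + \<omega> t)^2 + deriv \<omega> t * I x / 2 - W t)
      has_real_derivative deriv a x / a x / 4 - b x / (2 * a x) + q t / 8 * (2 * (I x + \<omega> t) * (1 / r x))
        + deriv \<omega> t * (1 / r x) / 2) (at x)"
      using ap by (auto intro!: derivative_eq_intros a1 B DERIV_I x)
  qed
qed

text \<open>The derivative of the exponent is a quadratic polynomial in \<open>I x\<close>. The
  Riccati equation for \<open>q\<close>, the oscillator equation and the choice of \<open>W\<close>
  make it equal to the square that the space derivatives produce plus
  \<open>c2 * (I x)^2 + c1 * I x + c0\<close>; the hypothesis on \<open>K\<close> identifies this
  remainder.\<close>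

lemma DERIV_M_t:
  assumes t: "t \<in> Tint" and x: "x \<in> S"
  shows "((\<lambda>t. M t x) has_real_derivative M t x * (q t / 4 + (q t * (I x + \<omega> t) / 2 + deriv \<omega> t)^2 / 4 + K x)) (at t)"
proof (rule DERIV_cong_open[OF _ Tint(2) t M_eq[symmetric, OF _ x]])
  have p: "deriv T t > 0" using T t by auto
  have nn: "q t / 4 + (q t * (I x + \<omega> t) / 2 + deriv \<omega> t)^2 / 4 + K x
     = q t / 4 + ((q t)^2 / 2 + 8 * c2) / 8 * (I x + \<omega> t)^2 + q t / 8 * (2 * (I x + \<omega> t) * deriv \<omega> t)
       + (2 * c1 - 4 * c2 * \<omega> t) * I x / 2 - (c2 * (\<omega> t)^2 - 1/4 * (deriv \<omega> t)^2 - c0)"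
    unfolding K_quadratic[OF x] by (simp add: field_simps power2_eq_square)
  show "((\<lambda>t. C * exp ((ln (deriv T t) + ln (a x)) / 4 - B x + q t / 8 * (I x + \<omega> t)^2 + deriv \<omega> t * I x / 2 - W t))
     has_real_derivative M t x * (q t / 4 + (q t * (I x + \<omega> t) / 2 + deriv \<omega> t)^2 / 4 + K x)) (at t)"
    unfolding nn M_eq[OF t x]
  proof (rule DERIV_const_exp)
    show "((\<lambda>t. (ln (deriv T t) + ln (a x)) / 4 - B x + q t / 8 * (I x + \<omega> t)^2 + deriv \<omega> t * I x / 2 - W t)
      has_real_derivative q t / 4 + ((q t)^2 / 2 + 8 * c2) / 8 * (I x + \<omega> t)^2 + q t / 8 * (2 * (I x + \<omega> t) * deriv \<omega> t)
       + (2 * c1 - 4 * c2 * \<omega> t) * I x / 2 - (c2 * (\<omega> t)^2 - 1/4 * (deriv \<omega> t)^2 - c0)) (at t)"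
      using p by (auto intro!: derivative_eq_intros DERIV_T DERIV_\<omega> W t simp: field_simps)
  qed
qed

lemma DERIV_X_x: "t \<in> Tint \<Longrightarrow> x \<in> S \<Longrightarrow> ((\<lambda>x. X t x) has_real_derivative sqrt (deriv T t) / r x) (at x)"
  unfolding X_def by (auto intro!: derivative_eq_intros DERIV_I)

lemma DERIV_X_t:
  assumes t: "t \<in> Tint"
  shows "((\<lambda>t. X t x) has_real_derivative sqrt (deriv T t) * (q t * (I x + \<omega> t) / 2 + deriv \<omega> t)) (at t)"
proof -
  have p: "deriv T t > 0" using T t by auto
  define h where "h = sqrt (deriv T t)"
  have h: "h > 0" "deriv T t = h * h" using p by (auto simp: h_def less_imp_le)
  have "((\<lambda>t. sqrt (deriv T t)) has_real_derivative q t * deriv T t * (inverse h / 2)) (at t)"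
    unfolding h_def by (rule DERIV_cong[OF DERIV_chain2[OF DERIV_real_sqrt[OF p] DERIV_T(2)[OF t]]]) simp
  then have "((\<lambda>t. sqrt (deriv T t)) has_real_derivative h * q t / 2) (at t)"
    by (rule DERIV_cong) (use h in \<open>simp add: field_simps\<close>)
  from DERIV_mult[OF this DERIV_add[OF DERIV_const DERIV_\<omega>(1)[OF t]]] show ?thesis
    unfolding X_def h_def[symmetric] by (rule DERIV_cong) (simp add: h_def field_simps)
qed

lemma DERIV_n: "t \<in> Tint \<Longrightarrow> x \<in> S \<Longrightarrow> ((\<lambda>x. n t x) has_real_derivative deriv J x + q t / (2 * r x)) (at x)"
  unfolding n_def by (auto intro!: derivative_eq_intros DERIV_J DERIV_I)

text \<open>One identity serves both directions: the factor \<open>M t x * deriv T t\<close> is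
  nonzero, so u solves the given equation at a point exactly when w solves the heat equation at its
  image.\<close>

lemma operator_transform:
  assumes N: "open N" "N \<subseteq> Tint \<times> S" "(t, x) \<in> N"
    and w: "smooth_on Om (\<lambda>p. w (fst p) (snd p))" "open Om"
    and u: "\<And>t x. (t, x) \<in> N \<Longrightarrow> (T t, X t x) \<in> Om \<and> u t x = M t x * w (T t) (X t x)"
  shows "pt u t x - (a x * pxx u t x + b x * px u t x + c x * u t x)
    = M t x * deriv T t * (pt w (T t) (X t x) - pxx w (T t) (X t x))"
proof -
  define F where "F = (\<lambda>p. w (fst p) (snd p))"
  have F: "smooth_on Om F" "smooth_on Om (Dx F)"
    using w(1) by (auto simp: F_def intro: smooth_on_dir_deriv basis2)
  define ux where "ux = (\<lambda>y. M t y * (n t y / (2 * r y) * F (T t, X t y) + sqrt (deriv T t) / r y * Dx F (T t, X t y)))"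
  have tx: "t \<in> Tint" "x \<in> S" using N by auto
  have evx: "\<forall>\<^sub>F y in nhds x. (t, y) \<in> N"
  proof -
    have "((\<lambda>y. (t, y)) \<longlongrightarrow> (t, x)) (nhds x)" by (intro tendsto_intros) (simp add: filterlim_ident)
    then show ?thesis using N by (auto dest: topological_tendstoD)
  qed
  have evt: "\<forall>\<^sub>F s in nhds t. (s, x) \<in> N"
  proof -
    have "((\<lambda>s. (s, x)) \<longlongrightarrow> (t, x)) (nhds t)" by (intro tendsto_intros) (simp add: filterlim_ident)
    then show ?thesis using N by (auto dest: topological_tendstoD)
  qed
  have dF: "((\<lambda>y. G (T t, X t y)) has_real_derivative sqrt (deriv T t) / r y * Dx G (T t, X t y)) (at y)"
    if "smooth_on Om G" and ty: "(t, y) \<in> N" for G y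
  proof -
    have y: "y \<in> S" using N ty by auto
    show ?thesis
      using DERIV_curve2[OF that(1) w(2), of "\<lambda>y. T t" y "X t" 0 "sqrt (deriv T t) / r y"]
        DERIV_X_x[OF tx(1) y] u[OF ty] by auto
  qed
  have px: "px u t y = ux y" if ty: "(t, y) \<in> N" for y
  proof -
    have y: "y \<in> S" using N ty by auto
    have "((\<lambda>y. M t y * F (T t, X t y)) has_real_derivative ux y) (at y)"
      unfolding ux_def
      by (rule derivative_eq_intros DERIV_M_x[OF tx(1) y] dF[OF F(1) ty] refl)+ (simp add: algebra_simps)
    moreover have "\<forall>\<^sub>F z in nhds y. u t z = M t z * F (T t, X t z)"
    proof -
      have "((\<lambda>y. (t, y)) \<longlongrightarrow> (t, y)) (nhds y)" by (intro tendsto_intros) (simp add: filterlim_ident)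
      then have "\<forall>\<^sub>F z in nhds y. (t, z) \<in> N" using N(1) ty by (auto dest: topological_tendstoD)
      then show ?thesis by eventually_elim (use u in \<open>auto simp: F_def\<close>)
    qed
    ultimately show ?thesis unfolding px_def by (rule deriv_eqI_ev)
  qed
  define A where "A = F (T t, X t x)"
  define A1 where "A1 = Dx F (T t, X t x)"
  define A2 where "A2 = Dx (Dx F) (T t, X t x)"
  define At where "At = Dt F (T t, X t x)"
  define s where "s = sqrt (deriv T t)"
  have s: "s * s = deriv T t" "s > 0" using T(4)[OF tx(1)] by (auto simp: s_def less_imp_le)
  have rp: "r x > 0" using r tx by auto
  have d1: "((\<lambda>y. n t y / (2 * r y)) has_real_derivative
      (deriv J x + q t / (2 * r x)) / (2 * r x) - n t x * deriv r x / (2 * r x ^ 2)) (at x)"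
    by (rule DERIV_cong[OF DERIV_divide[OF DERIV_n[OF tx] DERIV_cmult[OF DERIV_r[OF tx(2)], of 2]]])
       (use rp in \<open>simp_all add: field_simps power2_eq_square\<close>)
  have d2: "((\<lambda>y. sqrt (deriv T t) / r y) has_real_derivative - (s * deriv r x / r x ^ 2)) (at x)"
    by (rule DERIV_cong[OF DERIV_divide[OF DERIV_const DERIV_r[OF tx(2)]]])
       (use rp in \<open>simp_all add: s_def field_simps power2_eq_square\<close>)
  have "(ux has_real_derivative M t x * (n t x / (2 * r x)) * (n t x / (2 * r x) * A + s / r x * A1)
      + M t x * (((deriv J x + q t / (2 * r x)) / (2 * r x) - n t x * deriv r x / (2 * r x ^ 2)) * A + n t x / (2 * r x) * (s / r x * A1)
           - s * deriv r x / r x ^ 2 * A1 + s / r x * (s / r x * A2))) (at x)"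
    unfolding ux_def
    by (rule derivative_eq_intros DERIV_M_x tx dF F N(3) d1 d2 refl)+
       (simp add: A_def A1_def A2_def s_def algebra_simps)
  then have pxx: "pxx u t x = M t x * (n t x / (2 * r x)) * (n t x / (2 * r x) * A + s / r x * A1)
      + M t x * (((deriv J x + q t / (2 * r x)) / (2 * r x) - n t x * deriv r x / (2 * r x ^ 2)) * A + n t x / (2 * r x) * (s / r x * A1)
           - s * deriv r x / r x ^ 2 * A1 + s / r x * (s / r x * A2))" (is "_ = ?xx")
  proof -
    assume "(ux has_real_derivative ?xx) (at x)"
    moreover have "\<forall>\<^sub>F y in nhds x. px u t y = ux y" using evx by eventually_elim (use px in auto)
    ultimately show ?thesis unfolding pxx_def by (rule deriv_eqI_ev)
  qed
  have axx: "a x * pxx u t x = M t x * (n t x ^ 2 / 4 * A + n t x * s * A1 + (r x * deriv J x / 2 + q t / 4 - n t x * deriv r x / 2) * A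
      - s * deriv r x * A1 + deriv T t * A2)"
    unfolding pxx r(2)[OF tx(2)] s(1)[symmetric] using rp by (simp add: field_simps power2_eq_square)
  have bx: "b x * px u t x = M t x * ((deriv r x - J x) * (n t x / 2 * A + s * A1))"
    unfolding px[OF N(3)] ux_def J_eq using rp by (simp add: A_def A1_def s_def field_simps)
  have ptu: "pt u t x = M t x * ((q t / 4 + (q t * (I x + \<omega> t) / 2 + deriv \<omega> t)^2 / 4 + K x) * A
       + deriv T t * At + s * (q t * (I x + \<omega> t) / 2 + deriv \<omega> t) * A1)"
  proof -
    have "((\<lambda>t. F (T t, X t x)) has_real_derivative deriv T t * At + s * (q t * (I x + \<omega> t) / 2 + deriv \<omega> t) * A1) (at t)"
      using DERIV_curve2[OF F(1) w(2), of T t "\<lambda>t. X t x", OF _ DERIV_T(1)[OF tx(1)] DERIV_X_t[OF tx(1)]] u[OF N(3)]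
      by (simp add: At_def A1_def s_def)
    from DERIV_mult[OF DERIV_M_t[OF tx] this]
    have d: "((\<lambda>t. M t x * F (T t, X t x)) has_real_derivative M t x * ((q t / 4 + (q t * (I x + \<omega> t) / 2 + deriv \<omega> t)^2 / 4 + K x) * A
       + deriv T t * At + s * (q t * (I x + \<omega> t) / 2 + deriv \<omega> t) * A1)) (at t)"
      by (rule DERIV_cong) (simp add: A_def algebra_simps)
    have "\<forall>\<^sub>F s in nhds t. u s x = M s x * F (T s, X s x)"
      using evt by eventually_elim (use u in \<open>auto simp: F_def\<close>)
    with d show ?thesis unfolding pt_def by (rule deriv_eqI_ev)
  qed
  have cu: "c x * u t x = M t x * (c x * A)" using u[OF N(3)] by (simp add: A_def F_def)
  have w': "pt w (T t) (X t x) = At" "pxx w (T t) (X t x) = A2"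
    using partials_eq_dir_deriv[OF w, of "T t" "X t x"] u[OF N(3)] by (auto simp: At_def A2_def F_def)
  \<comment> \<open>With \<open>n = J + e\<close>, the coefficient of \<open>A1\<close> in the space
    operator reduces to \<open>s * e\<close> and that of \<open>A\<close> to q/4 + e^2/4 + K. Both
    coincide with the coefficients in the time derivative, which leaves only
    \<open>deriv T t * (At - A2)\<close>.\<close>
  define e where "e = q t * (I x + \<omega> t) / 2 + deriv \<omega> t"
  have ne: "n t x = J x + e" by (simp add: n_def e_def)
  show ?thesis
    unfolding axx bx ptu cu w' e_def[symmetric] ne K_eq
    by (simp add: field_simps power2_eq_square)
qed

section \<open>The explicit formula as a point transformation\<close>

definition Phi :: "real \<times> real \<times> real \<Rightarrow> real \<times> real \<times> real" where
  "Phi = (\<lambda>(t, x, u). (T t, X t x, u / M t x))"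

abbreviation D :: "(real \<times> real \<times> real) set" where "D \<equiv> Tint \<times> S \<times> UNIV"

lemma open_D: "open D"
  using Tint S by (intro open_Times) auto

lemma X_eq_iff:
  assumes "t \<in> Tint" "x \<in> S" "x' \<in> S"
  shows "X t x = X t x' \<longleftrightarrow> x = x'"
  using T(4)[OF assms(1)] inv_I(1) assms(2,3) by (auto simp: X_def inj_on_eq_iff)

lemma T_eq_iff: "t \<in> Tint \<Longrightarrow> t' \<in> Tint \<Longrightarrow> T t = T t' \<longleftrightarrow> t = t'"
  using inv_T(1) by (simp add: inj_on_eq_iff)

lemma inj_Phi: "inj_on Phi D"
  by (rule inj_onI) (auto simp: Phi_def T_eq_iff X_eq_iff M_nz)

text \<open>The functions \<open>\<tau>\<close> and \<open>\<xi>\<close> are arbitrary because the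
  lemma is applied twice: to the coordinate projections for \<open>Phi\<close>, and to the time and
  space components of the inverse map.\<close>

lemma smooth_along:
  assumes U: "open U" and \<tau>: "smooth_on U \<tau>" "\<tau> ` U \<subseteq> Tint" and \<xi>: "smooth_on U \<xi>" "\<xi> ` U \<subseteq> S"
  shows "smooth_on U (\<lambda>p. X (\<tau> p) (\<xi> p))" "smooth_on U (\<lambda>p. M (\<tau> p) (\<xi> p))"
proof -
  note tc = smooth_on_compose[OF U Tint(2) _ \<tau>] and xc = smooth_on_compose[OF U S(2) _ \<xi>]
  note s = tc[OF smooth_dT] tc[OF smooth_\<omega>] tc[OF smooth_d\<omega>] tc[OF smooth_q] tc[OF smooth_W]
    xc[OF smooth_I] xc[OF smooth_B] xc[OF smooth(1)]
  show "smooth_on U (\<lambda>p. X (\<tau> p) (\<xi> p))" unfolding X_def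
    by (intro smooth_on_mult smooth_on_add smooth_on_sqrt s U) (use \<tau>(2) T(4) in auto)
  have "smooth_on U (\<lambda>p. C * (deriv T (\<tau> p) * a (\<xi> p)) powr (1/4) * exp (- B (\<xi> p)
      + q (\<tau> p) * (1/8) * (I (\<xi> p) + \<omega> (\<tau> p))^2 + deriv \<omega> (\<tau> p) * I (\<xi> p) * (1/2) - W (\<tau> p)))"
    by (intro smooth_on_mult smooth_on_add smooth_on_diff smooth_on_minus smooth_on_power smooth_on_exp smooth_on_powr
        smooth_on_const s U) (use \<tau>(2) T(4) \<xi>(2) apos in \<open>auto intro!: mult_pos_pos\<close>)
  then show "smooth_on U (\<lambda>p. M (\<tau> p) (\<xi> p))" by (simp add: M_def q_def mult.commute)
qed

lemma smooth_Phi: "smooth_on D Phi"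
proof -
  have im: "fst ` D \<subseteq> Tint" "(\<lambda>p. fst (snd p)) ` D \<subseteq> S" by auto
  note al = smooth_along[OF open_D smooth_on_fst[OF open_D] im(1) smooth_on_fst_snd[OF open_D] im(2)]
  have "smooth_on D (\<lambda>p. (T (fst p), X (fst p) (fst (snd p)), snd (snd p) / M (fst p) (fst (snd p))))"
    unfolding smooth_on_Pair
  proof (intro conjI al smooth_on_divide smooth_on_snd_snd open_D)
    show "smooth_on D (\<lambda>p. T (fst p))"
      by (rule smooth_on_compose[OF open_D Tint(2) smooth_T smooth_on_fst[OF open_D] im(1)])
  qed (use M_nz in auto)
  moreover have "Phi = (\<lambda>p. (T (fst p), X (fst p) (fst (snd p)), snd (snd p) / M (fst p) (fst (snd p))))"
    by (auto simp: Phi_def)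
  ultimately show ?thesis by simp
qed

lemma open_Phi_D: "open (Phi ` D)"
  by (rule invariance_of_domain[OF smooth_on_imp_continuous_on_vec[OF smooth_Phi] open_D inj_Phi])

text \<open>The inverse is explicit: t from inverting \<open>T\<close>, then x from inverting
  \<open>I\<close> at the second coordinate divided by sqrt(T'(t)) and shifted by
  \<open>\<omega> t\<close>, and finally u by multiplication with \<open>M t x\<close>. Each
  ingredient is smooth.\<close>

lemma smooth_inv_Phi: "smooth_on (Phi ` D) (inv_into D Phi)"
proof -
  let ?E = "Phi ` D"
  define Ti where "Ti = inv_into Tint T"
  define Ii where "Ii = inv_into S I"
  define \<tau> where "\<tau> = (\<lambda>p::real \<times> real \<times> real. Ti (fst p))"
  define \<xi> where "\<xi> = (\<lambda>p::real \<times> real \<times> real. Ii (fst (snd p) / sqrt (deriv T (\<tau> p)) - \<omega> (\<tau> p)))"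
  have \<tau>: "\<tau> (Phi (t, x, u)) = t" and \<xi>: "\<xi> (Phi (t, x, u)) = x"
    and arg: "fst (snd (Phi (t, x, u))) / sqrt (deriv T (\<tau> (Phi (t, x, u)))) - \<omega> (\<tau> (Phi (t, x, u))) = I x"
    if "t \<in> Tint" "x \<in> S" for t x u
  proof -
    show 1: "\<tau> (Phi (t, x, u)) = t" using that inv_T(1) by (simp add: \<tau>_def Phi_def Ti_def)
    show 2: "fst (snd (Phi (t, x, u))) / sqrt (deriv T (\<tau> (Phi (t, x, u)))) - \<omega> (\<tau> (Phi (t, x, u))) = I x"
      unfolding 1 using T(4)[OF that(1)] by (simp add: Phi_def X_def)
    show "\<xi> (Phi (t, x, u)) = x" unfolding \<xi>_def 2 using that inv_I(1) by (simp add: Ii_def)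
  qed
  have im: "\<tau> ` ?E \<subseteq> Tint" "\<xi> ` ?E \<subseteq> S" using \<tau> \<xi> by auto
  have s\<tau>: "smooth_on ?E \<tau>" unfolding \<tau>_def Ti_def
    by (rule smooth_on_compose[OF open_Phi_D inv_T(2,3) smooth_on_fst[OF open_Phi_D]]) (auto simp: Phi_def)
  have s\<xi>: "smooth_on ?E \<xi>" unfolding \<xi>_def Ii_def
  proof (rule smooth_on_compose[OF open_Phi_D inv_I(2,3)])
    show "smooth_on ?E (\<lambda>p. fst (snd p) / sqrt (deriv T (\<tau> p)) - \<omega> (\<tau> p))"
      by (intro smooth_on_diff smooth_on_divide smooth_on_sqrt smooth_on_fst_snd open_Phi_D
          smooth_on_compose[OF open_Phi_D Tint(2) smooth_dT s\<tau> im(1)]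
          smooth_on_compose[OF open_Phi_D Tint(2) smooth_\<omega> s\<tau> im(1)])
        (use im(1) T(4) in force)+
    show "(\<lambda>p. fst (snd p) / sqrt (deriv T (\<tau> p)) - \<omega> (\<tau> p)) ` ?E \<subseteq> I ` S"
      using arg by fastforce
  qed
  have "smooth_on ?E (\<lambda>p. (\<tau> p, \<xi> p, snd (snd p) * M (\<tau> p) (\<xi> p)))"
    unfolding smooth_on_Pair
    by (intro conjI s\<tau> s\<xi> smooth_on_mult smooth_on_snd_snd open_Phi_D smooth_along im)
  then show ?thesis
  proof (rule smooth_on_cong[OF open_Phi_D, rotated])
    fix p assume "p \<in> ?E"
    then obtain t x u where tx: "t \<in> Tint" "x \<in> S" "p = Phi (t, x, u)" by auto
    then have "inv_into D Phi p = (t, x, u)" using inj_Phi by simp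
    then show "(\<tau> p, \<xi> p, snd (snd p) * M (\<tau> p) (\<xi> p)) = inv_into D Phi p"
      using tx \<tau>[OF tx(1,2)] \<xi>[OF tx(1,2)] M_nz[OF tx(1,2)] by (simp add: Phi_def)
  qed
qed

lemma continuous_TX: "continuous_on (Tint \<times> S) (\<lambda>p. (T (fst p), X (fst p) (snd p)))"
proof -
  have o: "open (Tint \<times> S)" using Tint S by (intro open_Times)
  have "smooth_on (Tint \<times> S) (\<lambda>p. T (fst p))"
    by (rule smooth_on_compose[OF o Tint(2) smooth_T smooth_on_fst[OF o]]) auto
  moreover have "smooth_on (Tint \<times> S) (\<lambda>p. X (fst p) (snd p))"
    by (rule smooth_along[OF o smooth_on_fst[OF o] _ smooth_on_snd[OF o]]) auto
  ultimately show ?thesis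
    by (intro smooth_on_imp_continuous_on_vec) (simp add: smooth_on_Pair)
qed

text \<open>A transformed function is only required to have its graph inside the image of the graph
  of \<open>u\<close>, so its domain may be a proper part of the image. Injectivity recovers the
  relation between \<open>u'\<close> and \<open>u\<close> at each point.\<close>

lemma maps_forward: "maps_solutions (lsol a b c S) heatsol Phi D"
  unfolding maps_solutions_def
proof (intro allI impI, elim conjE)
  fix Om u Om' u'
  assume u: "lsol a b c S Om u" and gr: "graph u Om \<subseteq> D"
    and Om': "open Om'" and u': "smooth_on Om' (\<lambda>p. u' (fst p) (snd p))"
    and sub: "graph u' Om' \<subseteq> Phi ` graph u Om"
  have Om: "Om \<subseteq> Tint \<times> S" using gr by (auto simp: graph_def)
  have pre: "\<exists>t x. (t, x) \<in> Om \<and> s = T t \<and> y = X t x \<and> u' s y = u t x / M t x"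
    if "(s, y) \<in> Om'" for s y
  proof -
    have "(s, y, u' s y) \<in> Phi ` graph u Om" using that sub by (auto simp: graph_def)
    then show ?thesis by (auto simp: graph_def Phi_def)
  qed
  \<comment> \<open>The operator identity needs its relation on an open set around the point. This
    pullback of \<open>Om'\<close> is open by continuity, and injectivity of \<open>T\<close> and of
    each \<open>X t\<close> on their intervals places it inside \<open>Om\<close>.\<close>
  define N where "N = (Tint \<times> S) \<inter> (\<lambda>p. (T (fst p), X (fst p) (snd p))) -` Om'"
  have N: "open N" unfolding N_def
    using Tint S Om' by (intro continuous_open_preimage[OF continuous_TX]) (auto intro: open_Times)
  have NN: "(t, x) \<in> Om \<and> (T t, X t x) \<in> Om' \<and> u t x = M t x * u' (T t) (X t x)" if tx: "(t, x) \<in> N" for t x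
  proof -
    have *: "t \<in> Tint" "x \<in> S" "(T t, X t x) \<in> Om'" using tx by (auto simp: N_def)
    obtain t' x' where 1: "(t', x') \<in> Om" "T t = T t'" "X t x = X t' x'" "u' (T t) (X t x) = u t' x' / M t' x'"
      using pre[OF *(3)] by auto
    have "t' = t" using 1 * Om T_eq_iff by auto
    moreover have "x' = x" using 1 * Om X_eq_iff \<open>t' = t\<close> by auto
    ultimately show ?thesis using 1 * M_nz by auto
  qed
  show "heatsol Om' u'"
    unfolding heatsol_def lsol_def
  proof (intro conjI Om' u' ballI)
    fix p assume p: "p \<in> Om'"
    obtain s y where sy: "p = (s, y)" by (cases p)
    obtain t x where tx: "(t, x) \<in> Om" "s = T t" "y = X t x" using pre p sy by blast
    then have txN: "(t, x) \<in> N" using Om p sy by (auto simp: N_def)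
    have "M t x * deriv T t * (pt u' (T t) (X t x) - pxx u' (T t) (X t x))
      = pt u t x - (a x * pxx u t x + b x * px u t x + c x * u t x)"
      by (rule operator_transform[OF N _ txN u' Om', symmetric]) (use NN in \<open>auto simp: N_def\<close>)
    also have "\<dots> = 0" using u tx(1) by (auto simp: lsol_def)
    finally have "pt u' s y = pxx u' s y"
      using M_nz[of t x] T(4)[of t] tx Om by auto
    then show "case p of (t, x) \<Rightarrow> pt u' t x = 1 * pxx u' t x + 0 * px u' t x + 0 * u' t x"
      by (simp add: sy)
  qed auto
qed

text \<open>Here the transformed function lives on the (t, x) side, so \<open>Om'\<close> itself is
  the open set for the operator identity.\<close>

lemma maps_backward: "maps_solutions heatsol (lsol a b c S) (inv_into D Phi) (Phi ` D)"
  unfolding maps_solutions_def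
proof (intro allI impI, elim conjE)
  fix Om w Om' u
  assume w: "heatsol Om w" and gr: "graph w Om \<subseteq> Phi ` D"
    and Om': "open Om'" and u: "smooth_on Om' (\<lambda>p. u (fst p) (snd p))"
    and sub: "graph u Om' \<subseteq> inv_into D Phi ` graph w Om"
  have wOm: "smooth_on Om (\<lambda>p. w (fst p) (snd p))" "open Om" using w by (auto simp: heatsol_def lsol_def)
  have pre: "t \<in> Tint \<and> x \<in> S \<and> (T t, X t x) \<in> Om \<and> u t x = M t x * w (T t) (X t x)"
    if tx: "(t, x) \<in> Om'" for t x
  proof -
    have "(t, x, u t x) \<in> inv_into D Phi ` graph w Om" using sub tx by (auto simp: graph_def)
    then obtain s y where sy: "(s, y) \<in> Om" "(t, x, u t x) = inv_into D Phi (s, y, w s y)"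
      by (auto simp: graph_def)
    have "(s, y, w s y) \<in> Phi ` D" using gr sy(1) by (auto simp: graph_def)
    then have "Phi (t, x, u t x) = (s, y, w s y)" "(t, x, u t x) \<in> D"
      unfolding sy(2) by (rule f_inv_into_f, rule inv_into_into)
    then show ?thesis using sy(1) M_nz[of t x] by (auto simp: Phi_def field_simps)
  qed
  show "lsol a b c S Om' u"
    unfolding lsol_def
  proof (intro conjI Om' u ballI)
    show "Om' \<subseteq> UNIV \<times> S" using pre by auto
    fix p assume p: "p \<in> Om'"
    obtain t x where tx: "p = (t, x)" by (cases p)
    have "pt u t x - (a x * pxx u t x + b x * px u t x + c x * u t x)
      = M t x * deriv T t * (pt w (T t) (X t x) - pxx w (T t) (X t x))"
      by (rule operator_transform[OF Om' _ _ wOm]) (use pre p tx in auto)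
    also have "\<dots> = 0" using w pre[of t x] p tx by (auto simp: heatsol_def lsol_def)
    finally show "case p of (t, x) \<Rightarrow> pt u t x = a x * pxx u t x + b x * px u t x + c x * u t x"
      by (simp add: tx)
  qed
qed

theorem maps_to_heat_Phi: "maps_to_heat a b c S Tint Phi"
  unfolding maps_to_heat_def Let_def point_transformation_def
  using open_D inj_Phi open_Phi_D smooth_Phi smooth_inv_Phi maps_forward maps_backward Tint S by auto

end

section \<open>Jets of transformed heat polynomials\<close>

text \<open>A relation rather than a value: derivative facts can be chained by rule composition, so
  a long product is differentiated in one term.\<close>

definition has_dd :: "'a::real_normed_vector \<Rightarrow> ('a \<Rightarrow> real) \<Rightarrow> real \<Rightarrow> 'a \<Rightarrow> bool" where
  "has_dd v f d x \<longleftrightarrow> ((\<lambda>h. f (x + h *\<^sub>R v)) has_real_derivative d) (at 0)"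

lemma has_dd_imp_eq: "has_dd v f d x \<Longrightarrow> dir_deriv v f x = d"
  unfolding has_dd_def dir_deriv_def by (rule DERIV_imp_deriv)

lemma has_dd_smooth:
  fixes f :: "'a::euclidean_space \<Rightarrow> real"
  shows "smooth_on U f \<Longrightarrow> open U \<Longrightarrow> x \<in> U \<Longrightarrow> has_dd v f (dir_deriv v f x) x"
  using smooth_on_DERIV_line[of U f x 0 v] by (simp add: has_dd_def)

lemma has_dd_const: "has_dd v (\<lambda>x. k) 0 x"
  by (simp add: has_dd_def)

lemma has_dd_add: "has_dd v f d x \<Longrightarrow> has_dd v g e x \<Longrightarrow> has_dd v (\<lambda>x. f x + g x) (d + e) x"
  unfolding has_dd_def by (rule DERIV_add)

lemma has_dd_diff: "has_dd v f d x \<Longrightarrow> has_dd v g e x \<Longrightarrow> has_dd v (\<lambda>x. f x - g x) (d - e) x"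
  unfolding has_dd_def by (rule DERIV_diff)

lemma has_dd_mult: "has_dd v f d x \<Longrightarrow> has_dd v g e x \<Longrightarrow> has_dd v (\<lambda>x. f x * g x) (d * g x + f x * e) x"
  unfolding has_dd_def by (rule DERIV_cong, erule (1) DERIV_mult) simp

lemma has_dd_compose:
  "(h has_real_derivative h') (at (f x)) \<Longrightarrow> has_dd v f d x \<Longrightarrow> has_dd v (\<lambda>x. h (f x)) (h' * d) x"
  unfolding has_dd_def using DERIV_chain2[of h h' "\<lambda>k. f (x + k *\<^sub>R v)" 0 d] by simp

lemma has_dd_compose2:
  assumes "smooth_on V F" "open V" "(\<alpha> x, \<beta> x) \<in> V" "has_dd v \<alpha> d x" "has_dd v \<beta> e x"
  shows "has_dd v (\<lambda>x. F (\<alpha> x, \<beta> x)) (d * Dt F (\<alpha> x, \<beta> x) + e * Dx F (\<alpha> x, \<beta> x)) x"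
  using DERIV_curve2[OF assms(1,2), of "\<lambda>k. \<alpha> (x + k *\<^sub>R v)" 0 "\<lambda>k. \<beta> (x + k *\<^sub>R v)" d e] assms(3-5)
  by (simp add: has_dd_def)

lemma has_dd_compose3:
  assumes "smooth_on V F" "open V" "(\<alpha> x, \<beta> x, \<gamma> x) \<in> V" "has_dd v \<alpha> d x" "has_dd v \<beta> e x" "has_dd v \<gamma> f x"
  shows "has_dd v (\<lambda>x. F (\<alpha> x, \<beta> x, \<gamma> x))
    (d * D1 F (\<alpha> x, \<beta> x, \<gamma> x) + e * D2 F (\<alpha> x, \<beta> x, \<gamma> x) + f * D3 F (\<alpha> x, \<beta> x, \<gamma> x)) x"
  using DERIV_curve3[OF assms(1,2), of "\<lambda>k. \<alpha> (x + k *\<^sub>R v)" 0 "\<lambda>k. \<beta> (x + k *\<^sub>R v)" "\<lambda>k. \<gamma> (x + k *\<^sub>R v)" d e f] assms(3-6)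
  by (simp add: has_dd_def)

text \<open>The device by which an identity valid on an open set is differentiated: compute the
  derivative of each side by rules and equate.\<close>

lemma has_dd_unique:
  assumes "open U" "x \<in> U" "\<And>y. y \<in> U \<Longrightarrow> f y = g y" "has_dd v f d x" "has_dd v g e x"
  shows "d = e"
  using dir_deriv_cong[OF assms(1-3), where v = v] has_dd_imp_eq[OF assms(4)] has_dd_imp_eq[OF assms(5)] by simp

lemma dir_deriv_zero:
  assumes "open U" "x \<in> U" "\<And>y. y \<in> U \<Longrightarrow> f y = 0"
  shows "dir_deriv v f x = 0"
  using dir_deriv_cong[OF assms, where v = v] has_dd_imp_eq[OF has_dd_const[of v 0 x]] by simp

lemma has_dd_fst: "has_dd v (fst :: real \<times> 'b::real_normed_vector \<Rightarrow> real) (fst v) x"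
proof -
  have "((\<lambda>h. fst x + h * fst v) has_real_derivative fst v) (at 0)"
    by (auto intro!: derivative_eq_intros)
  then show ?thesis by (simp add: has_dd_def)
qed

lemma has_dd_snd: "has_dd v (snd :: 'b::real_normed_vector \<times> real \<Rightarrow> real) (snd v) x"
proof -
  have "((\<lambda>h. snd x + h * snd v) has_real_derivative snd v) (at 0)"
    by (auto intro!: derivative_eq_intros)
  then show ?thesis by (simp add: has_dd_def)
qed

text \<open>The heat polynomial with $w = w_0$, $w_y = p$, $w_s = w_{yy} = r$, $w_{sy} = 0$, $w_{ss} = z$ at $(s_0, y_0)$.\<close>

definition hpoly :: "real \<Rightarrow> real \<Rightarrow> real \<Rightarrow> real \<Rightarrow> real \<Rightarrow> real \<Rightarrow> real \<Rightarrow> real \<Rightarrow> real" where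
  "hpoly s0 y0 w0 p r z s y = w0 + p * (y - y0) + r * ((y - y0)^2 / 2 + (s - s0))
     + z * ((y - y0)^4 / 24 + (s - s0) * (y - y0)^2 / 2 + (s - s0)^2 / 2)"

lemma hpoly_DERIV_s:
  "((\<lambda>s. hpoly s0 y0 w0 p r z s y) has_real_derivative r + z * ((y - y0)^2 / 2 + (s - s0))) (at s)"
  unfolding hpoly_def by (auto intro!: derivative_eq_intros simp: field_simps power2_eq_square)

lemma hpoly_DERIV_y:
  "((\<lambda>y. hpoly s0 y0 w0 p r z s y) has_real_derivative p + r * (y - y0) + z * ((y - y0)^3 / 6 + (s - s0) * (y - y0))) (at y)"
  unfolding hpoly_def by (auto intro!: derivative_eq_intros simp: field_simps power2_eq_square power3_eq_cube)

lemma hpoly_heat: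
  assumes "open Om"
  shows "heatsol Om (hpoly s0 y0 w0 p r z)"
proof -
  let ?w = "hpoly s0 y0 w0 p r z"
  have 1: "pt ?w s y = r + z * ((y - y0)^2 / 2 + (s - s0))" for s y
    unfolding pt_def by (rule DERIV_imp_deriv[OF hpoly_DERIV_s])
  have 2: "px ?w s y = p + r * (y - y0) + z * ((y - y0)^3 / 6 + (s - s0) * (y - y0))" for s y
    unfolding px_def by (rule DERIV_imp_deriv[OF hpoly_DERIV_y])
  have "((\<lambda>y. p + r * (y - y0) + z * ((y - y0)^3 / 6 + (s - s0) * (y - y0))) has_real_derivative
      r + z * ((y - y0)^2 / 2 + (s - s0))) (at y)" for s y
    by (auto intro!: derivative_eq_intros simp: field_simps power2_eq_square)
  then have 3: "pxx ?w s y = r + z * ((y - y0)^2 / 2 + (s - s0))" for s y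
    unfolding pxx_def 2 by (rule DERIV_imp_deriv)
  have "smooth_on Om (\<lambda>q. w0 + p * (snd q - y0) + r * ((snd q - y0)^2 * (1/2) + (fst q - s0))
     + z * ((snd q - y0)^4 * (1/24) + (fst q - s0) * (snd q - y0)^2 * (1/2) + (fst q - s0)^2 * (1/2)))"
    by (intro smooth_on_add smooth_on_mult smooth_on_diff smooth_on_power smooth_on_const smooth_on_fst smooth_on_snd assms)
  then show ?thesis using assms by (simp add: heatsol_def lsol_def 1 3 hpoly_def)
qed

text \<open>The inverse of a point transformation in components: (s, y, w) are the coordinates on
  the side of the heat equation, and \<open>\<tau>\<close>, \<open>\<xi>\<close>,
  \<open>\<upsilon>\<close> give the original time, position and unknown. The number in
  \<open>det\<close> is the Jacobian determinant, and \<open>maps\<close> is the solution-mapping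
  property in coordinates.\<close>

locale heat_preimage = parabolic +
  fixes E :: "(real \<times> real \<times> real) set" and \<tau> \<xi> \<upsilon> :: "real \<times> real \<times> real \<Rightarrow> real"
  assumes E: "open E" and smooth_E: "smooth_on E \<tau>" "smooth_on E \<xi>" "smooth_on E \<upsilon>"
    and \<xi>_S: "q \<in> E \<Longrightarrow> \<xi> q \<in> S"
    and det: "q \<in> E \<Longrightarrow> D1 \<tau> q * (D2 \<xi> q * D3 \<upsilon> q - D3 \<xi> q * D2 \<upsilon> q)
       - D2 \<tau> q * (D1 \<xi> q * D3 \<upsilon> q - D3 \<xi> q * D1 \<upsilon> q)
       + D3 \<tau> q * (D1 \<xi> q * D2 \<upsilon> q - D2 \<xi> q * D1 \<upsilon> q) \<noteq> 0"
    and maps: "heatsol Om w \<Longrightarrow> graph w Om \<subseteq> E \<Longrightarrow> open Om' \<Longrightarrow> smooth_on Om' (\<lambda>p. u (fst p) (snd p)) \<Longrightarrow>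
       (\<And>t x. (t, x) \<in> Om' \<Longrightarrow> \<exists>s y. (s, y) \<in> Om \<and> t = \<tau> (s, y, w s y) \<and> x = \<xi> (s, y, w s y) \<and> u t x = \<upsilon> (s, y, w s y))
       \<Longrightarrow> lsol a b c S Om' u"
begin

text \<open>For a heat polynomial w, \<open>fs\<close> to \<open>fyy\<close> are the derivatives of
  f(s, y, w(s, y)) at the chosen point; w_sy = 0 there, so \<open>fsy\<close> has no such term.
  Where (s, y) maps locally invertibly to (\<tau>, \<xi>), a transformed solution u exists near the
  image point. The conclusions are the chain rule up to second order for \<upsilon> = u(\<tau>,
  \<xi>), together with the equation for u; the numbers obtained are the derivatives of u.\<close>

lemma jet:
  fixes s0 y0 w0 p r z :: real
  defines "q \<equiv> (s0, y0, w0)"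
  defines "fs \<equiv> \<lambda>f. D1 f q + r * D3 f q"
    and "fy \<equiv> \<lambda>f. D2 f q + p * D3 f q"
    and "fss \<equiv> \<lambda>f. D1 (D1 f) q + r * D3 (D1 f) q + (z * D3 f q + r * (D1 (D3 f) q + r * D3 (D3 f) q))"
    and "fsy \<equiv> \<lambda>f. D1 (D2 f) q + r * D3 (D2 f) q + p * (D1 (D3 f) q + r * D3 (D3 f) q)"
    and "fyy \<equiv> \<lambda>f. D2 (D2 f) q + p * D3 (D2 f) q + (r * D3 f q + p * (D2 (D3 f) q + p * D3 (D3 f) q))"
  assumes q: "q \<in> E" and \<Delta>: "fs \<tau> * fy \<xi> - fy \<tau> * fs \<xi> \<noteq> 0"
  obtains ut ux utt utx uxx where
    "fs \<upsilon> = fs \<tau> * ut + fs \<xi> * ux" "fy \<upsilon> = fy \<tau> * ut + fy \<xi> * ux"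
    "fss \<upsilon> = fss \<tau> * ut + fs \<tau> * (fs \<tau> * utt + fs \<xi> * utx) + (fss \<xi> * ux + fs \<xi> * (fs \<tau> * utx + fs \<xi> * uxx))"
    "fsy \<upsilon> = fsy \<tau> * ut + fy \<tau> * (fs \<tau> * utt + fs \<xi> * utx) + (fsy \<xi> * ux + fy \<xi> * (fs \<tau> * utx + fs \<xi> * uxx))"
    "fyy \<upsilon> = fyy \<tau> * ut + fy \<tau> * (fy \<tau> * utt + fy \<xi> * utx) + (fyy \<xi> * ux + fy \<xi> * (fy \<tau> * utx + fy \<xi> * uxx))"
    "ut = a (\<xi> q) * uxx + b (\<xi> q) * ux + c (\<xi> q) * \<upsilon> q"
proof -
  define w where "w = hpoly s0 y0 w0 p r z"
  define w1 where "w1 = (\<lambda>k::real \<times> real. w (fst k) (snd k))"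
  have sw: "smooth_on UNIV w1" using hpoly_heat[of UNIV] by (simp add: heatsol_def lsol_def w_def w1_def)
  define lift where "lift = (\<lambda>k::real \<times> real. (fst k, snd k, w1 k))"
  have slift: "smooth_on Om lift" if "open Om" for Om unfolding lift_def smooth_on_Pair
    using that smooth_on_subset[OF open_UNIV that _ sw] by (auto intro: smooth_on_fst smooth_on_snd)
  have w0: "w1 (s0, y0) = w0" by (simp add: w1_def w_def hpoly_def)
  define Ew where "Ew = lift -` E"
  have Ew: "open Ew" unfolding Ew_def
    using continuous_open_preimage[OF smooth_on_imp_continuous_on_vec[OF slift[OF open_UNIV]] open_UNIV E] by simp
  have qEw: "(s0, y0) \<in> Ew" using q by (simp add: Ew_def lift_def w0 q_def)
  define ws where "ws = (\<lambda>k::real \<times> real. r + z * ((snd k - y0)^2 / 2 + (fst k - s0)))"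
  define wy where "wy = (\<lambda>k::real \<times> real. p + r * (snd k - y0) + z * ((snd k - y0)^3 / 6 + (fst k - s0) * (snd k - y0)))"
  have dws: "has_dd (1,0) w1 (ws k) k" for k
  proof -
    have "((\<lambda>h. w (fst k + h) (snd k)) has_real_derivative ws k) (at 0)"
      using DERIV_shift[of "\<lambda>s. w s (snd k)" "ws k" 0 "fst k"] hpoly_DERIV_s[of s0 y0 w0 p r z "snd k" "fst k"]
      by (simp add: w_def ws_def add.commute)
    then show ?thesis by (simp add: has_dd_def w1_def)
  qed
  have dwy: "has_dd (0,1) w1 (wy k) k" for k
  proof -
    have "((\<lambda>h. w (fst k) (snd k + h)) has_real_derivative wy k) (at 0)"
      using DERIV_shift[of "\<lambda>y. w (fst k) y" "wy k" 0 "snd k"] hpoly_DERIV_y[of s0 y0 w0 p r z "fst k" "snd k"]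
      by (simp add: w_def wy_def add.commute)
    then show ?thesis by (simp add: has_dd_def w1_def)
  qed
  have dd: "ws (s0, y0) = r" "wy (s0, y0) = p" "has_dd (1,0) ws z (s0, y0)" "has_dd (1,0) wy 0 (s0, y0)" "has_dd (0,1) wy r (s0, y0)"
    unfolding ws_def wy_def has_dd_def by (auto intro!: derivative_eq_intros)
  have hs: "has_dd (1,0) (\<lambda>k. f (lift k)) (D1 f (lift k) + ws k * D3 f (lift k)) k"
    and hy: "has_dd (0,1) (\<lambda>k. f (lift k)) (D2 f (lift k) + wy k * D3 f (lift k)) k"
    if f: "smooth_on E f" and k: "k \<in> Ew" for f k
  proof -
    have kE: "(fst k, snd k, w1 k) \<in> E" using k by (simp add: Ew_def lift_def)
    show "has_dd (1,0) (\<lambda>k. f (lift k)) (D1 f (lift k) + ws k * D3 f (lift k)) k"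
      using has_dd_compose3[OF f E kE has_dd_fst has_dd_snd dws] by (simp add: lift_def)
    show "has_dd (0,1) (\<lambda>k. f (lift k)) (D2 f (lift k) + wy k * D3 f (lift k)) k"
      using has_dd_compose3[OF f E kE has_dd_fst has_dd_snd dwy] by (simp add: lift_def)
  qed
  have lq: "lift (s0, y0) = q" by (simp add: lift_def w0 q_def)
  have sm: "smooth_on Ew (\<lambda>k. f (lift k))" if "smooth_on E f" for f :: "_ \<Rightarrow> real"
    by (rule smooth_on_compose[OF Ew E that slift[OF Ew]]) (auto simp: Ew_def)
  have sd: "smooth_on E (D1 f)" "smooth_on E (D2 f)" "smooth_on E (D3 f)" if "smooth_on E f" for f
    using that by (auto intro: smooth_on_dir_deriv basis3)
  have hss: "has_dd (1,0) (\<lambda>k. D1 f (lift k) + ws k * D3 f (lift k)) (fss f) (s0, y0)"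
    and hsy: "has_dd (1,0) (\<lambda>k. D2 f (lift k) + wy k * D3 f (lift k)) (fsy f) (s0, y0)"
    and hyy: "has_dd (0,1) (\<lambda>k. D2 f (lift k) + wy k * D3 f (lift k)) (fyy f) (s0, y0)"
    if f: "smooth_on E f" for f
    using has_dd_add[OF hs[OF sd(1)[OF f] qEw] has_dd_mult[OF dd(3) hs[OF sd(3)[OF f] qEw]]]
      has_dd_add[OF hs[OF sd(2)[OF f] qEw] has_dd_mult[OF dd(4) hs[OF sd(3)[OF f] qEw]]]
      has_dd_add[OF hy[OF sd(2)[OF f] qEw] has_dd_mult[OF dd(5) hy[OF sd(3)[OF f] qEw]]]
    by (simp_all add: fss_def fsy_def fyy_def dd(1,2) lq)
  let ?h = "\<lambda>f k. f (lift k)"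
  have Dhs: "Dt (?h f) k = D1 f (lift k) + ws k * D3 f (lift k)" "Dx (?h f) k = D2 f (lift k) + wy k * D3 f (lift k)"
    if "smooth_on E f" "k \<in> Ew" for f k using has_dd_imp_eq hs hy that by blast+
  \<comment> \<open>The assumption \<open>\<Delta>\<close> says precisely that (s, y) to (\<tau>,
    \<xi>), taken along the graph of w, has nonzero Jacobian.\<close>
  have nz: "Dt (?h \<tau>) (s0, y0) * Dx (?h \<xi>) (s0, y0) - Dx (?h \<tau>) (s0, y0) * Dt (?h \<xi>) (s0, y0) \<noteq> 0"
    using \<Delta> by (simp add: Dhs smooth_E qEw lq dd(1,2) fs_def fy_def)
  obtain U V g where U: "open U" "U \<subseteq> Ew" "(s0, y0) \<in> U" and V: "open V"
    and hom: "homeomorphism U V (\<lambda>k. (?h \<tau> k, ?h \<xi> k)) g" and g: "smooth_on V g"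
    using smooth_inverse_function2[OF sm[OF smooth_E(1)] sm[OF smooth_E(2)] Ew qEw nz] by metis
  \<comment> \<open>The transformed solution: return from (t, x) to (s, y) by the local inverse and
    read off the third component on the lifted graph.\<close>
  define u where "u = (\<lambda>t x. ?h \<upsilon> (g (t, x)))"
  define G where "G = (\<lambda>k. u (fst k) (snd k))"
  have gV: "g ` V \<subseteq> Ew" using hom U(2) by (auto simp: homeomorphism_def)
  have G: "smooth_on V G" unfolding G_def u_def
    using smooth_on_compose[OF V Ew sm[OF smooth_E(3)] g gV] by simp
  have sol: "lsol a b c S V u"
  proof (rule maps)
    show "heatsol Ew w" unfolding w_def by (rule hpoly_heat[OF Ew])
    show "graph w Ew \<subseteq> E" by (auto simp: graph_def Ew_def lift_def w1_def)
    show "smooth_on V (\<lambda>p. u (fst p) (snd p))" using G by (simp add: G_def)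
    fix t x assume tx: "(t, x) \<in> V"
    obtain s y where sy: "g (t, x) = (s, y)" by (cases "g (t, x)")
    have "(s, y) \<in> Ew" using gV tx sy by force
    moreover have "(?h \<tau> (s, y), ?h \<xi> (s, y)) = (t, x)" using hom tx sy by (metis homeomorphism_apply2)
    ultimately show "\<exists>s y. (s, y) \<in> Ew \<and> t = \<tau> (s, y, w s y) \<and> x = \<xi> (s, y, w s y) \<and> u t x = \<upsilon> (s, y, w s y)"
      using sy by (intro exI[of _ s] exI[of _ y]) (auto simp: u_def lift_def w1_def)
  qed (rule V)
  define im where "im = (\<lambda>k. (?h \<tau> k, ?h \<xi> k))"
  have imV: "im k \<in> V" and uim: "?h \<upsilon> k = G (?h \<tau> k, ?h \<xi> k)" if "k \<in> U" for k
  proof -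
    show "im k \<in> V" using that hom by (auto simp: homeomorphism_def im_def)
    show "?h \<upsilon> k = G (?h \<tau> k, ?h \<xi> k)" using homeomorphism_apply1[OF hom that] by (simp add: G_def u_def)
  qed
  have sE: "smooth_on E \<tau>" "smooth_on E \<xi>" "smooth_on E \<upsilon>" by (rule smooth_E)+
  have first: "D1 \<upsilon> (lift k) + ws k * D3 \<upsilon> (lift k) = (D1 \<tau> (lift k) + ws k * D3 \<tau> (lift k)) * Dt G (im k) + (D1 \<xi> (lift k) + ws k * D3 \<xi> (lift k)) * Dx G (im k)"
    "D2 \<upsilon> (lift k) + wy k * D3 \<upsilon> (lift k) = (D2 \<tau> (lift k) + wy k * D3 \<tau> (lift k)) * Dt G (im k) + (D2 \<xi> (lift k) + wy k * D3 \<xi> (lift k)) * Dx G (im k)"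
    if k: "k \<in> U" for k
  proof -
    have kE: "k \<in> Ew" using k U by auto
    note c2 = has_dd_compose2[where V = V and \<alpha> = "\<lambda>k. \<tau> (lift k)" and \<beta> = "\<lambda>k. \<xi> (lift k)" and x = "k", OF G V imV[OF k, unfolded im_def]]
    show "D1 \<upsilon> (lift k) + ws k * D3 \<upsilon> (lift k) = (D1 \<tau> (lift k) + ws k * D3 \<tau> (lift k)) * Dt G (im k) + (D1 \<xi> (lift k) + ws k * D3 \<xi> (lift k)) * Dx G (im k)"
      using has_dd_unique[OF U(1) k uim hs[OF sE(3) kE] c2[OF hs[OF sE(1) kE] hs[OF sE(2) kE]]] by (simp add: im_def)
    show "D2 \<upsilon> (lift k) + wy k * D3 \<upsilon> (lift k) = (D2 \<tau> (lift k) + wy k * D3 \<tau> (lift k)) * Dt G (im k) + (D2 \<xi> (lift k) + wy k * D3 \<xi> (lift k)) * Dx G (im k)"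
      using has_dd_unique[OF U(1) k uim hy[OF sE(3) kE] c2[OF hy[OF sE(1) kE] hy[OF sE(2) kE]]] by (simp add: im_def)
  qed
  let ?m = "im (s0, y0)"
  have mV: "?m \<in> V" by (rule imV[OF U(3)])
  have m: "?m = (\<tau> q, \<xi> q)" by (simp add: im_def lq)
  have sG: "smooth_on V (Dt G)" "smooth_on V (Dx G)" using G by (auto intro: smooth_on_dir_deriv basis2)
  note cs = has_dd_compose2[where V = V and \<alpha> = "\<lambda>k. \<tau> (lift k)" and \<beta> = "\<lambda>k. \<xi> (lift k)" and x = "(s0, y0)", OF _ V imV[OF U(3), unfolded im_def] hs[OF sE(1) qEw] hs[OF sE(2) qEw], folded im_def]
  note cy = has_dd_compose2[where V = V and \<alpha> = "\<lambda>k. \<tau> (lift k)" and \<beta> = "\<lambda>k. \<xi> (lift k)" and x = "(s0, y0)", OF _ V imV[OF U(3), unfolded im_def] hy[OF sE(1) qEw] hy[OF sE(2) qEw], folded im_def]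
  \<comment> \<open>This merges the two mixed derivatives, so that three second derivatives of u
    remain as unknowns.\<close>
  have sym: "Dx (Dt G) ?m = Dt (Dx G) ?m" by (rule dir_deriv_commute[OF G V mV basis2(2,1)])
  show thesis
  proof (rule that[of "Dt G ?m" "Dx G ?m" "Dt (Dt G) ?m" "Dt (Dx G) ?m" "Dx (Dx G) ?m"])
    show "fs \<upsilon> = fs \<tau> * Dt G ?m + fs \<xi> * Dx G ?m" "fy \<upsilon> = fy \<tau> * Dt G ?m + fy \<xi> * Dx G ?m"
      using first[OF U(3)] by (simp_all add: lq dd(1,2) fs_def fy_def)
    have "fss \<upsilon> = fss \<tau> * Dt G ?m + fs \<tau> * (fs \<tau> * Dt (Dt G) ?m + fs \<xi> * Dx (Dt G) ?m)
        + (fss \<xi> * Dx G ?m + fs \<xi> * (fs \<tau> * Dt (Dx G) ?m + fs \<xi> * Dx (Dx G) ?m))"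
      using has_dd_unique[OF U(1,3) first(1)[unfolded im_def] hss[OF sE(3)]
         has_dd_add[OF has_dd_mult[OF hss[OF sE(1)] cs[OF sG(1)]] has_dd_mult[OF hss[OF sE(2)] cs[OF sG(2)]]]]
      by (simp add: im_def lq dd(1,2) fs_def)
    then show "fss \<upsilon> = fss \<tau> * Dt G ?m + fs \<tau> * (fs \<tau> * Dt (Dt G) ?m + fs \<xi> * Dt (Dx G) ?m)
        + (fss \<xi> * Dx G ?m + fs \<xi> * (fs \<tau> * Dt (Dx G) ?m + fs \<xi> * Dx (Dx G) ?m))" by (simp only: sym)
    have "fsy \<upsilon> = fsy \<tau> * Dt G ?m + fy \<tau> * (fs \<tau> * Dt (Dt G) ?m + fs \<xi> * Dx (Dt G) ?m)
        + (fsy \<xi> * Dx G ?m + fy \<xi> * (fs \<tau> * Dt (Dx G) ?m + fs \<xi> * Dx (Dx G) ?m))"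
      using has_dd_unique[OF U(1,3) first(2)[unfolded im_def] hsy[OF sE(3)]
         has_dd_add[OF has_dd_mult[OF hsy[OF sE(1)] cs[OF sG(1)]] has_dd_mult[OF hsy[OF sE(2)] cs[OF sG(2)]]]]
      by (simp add: im_def lq dd(1,2) fs_def fy_def)
    then show "fsy \<upsilon> = fsy \<tau> * Dt G ?m + fy \<tau> * (fs \<tau> * Dt (Dt G) ?m + fs \<xi> * Dt (Dx G) ?m)
        + (fsy \<xi> * Dx G ?m + fy \<xi> * (fs \<tau> * Dt (Dx G) ?m + fs \<xi> * Dx (Dx G) ?m))" by (simp only: sym)
    have "fyy \<upsilon> = fyy \<tau> * Dt G ?m + fy \<tau> * (fy \<tau> * Dt (Dt G) ?m + fy \<xi> * Dx (Dt G) ?m)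
        + (fyy \<xi> * Dx G ?m + fy \<xi> * (fy \<tau> * Dt (Dx G) ?m + fy \<xi> * Dx (Dx G) ?m))"
      using has_dd_unique[OF U(1,3) first(2)[unfolded im_def] hyy[OF sE(3)]
         has_dd_add[OF has_dd_mult[OF hyy[OF sE(1)] cy[OF sG(1)]] has_dd_mult[OF hyy[OF sE(2)] cy[OF sG(2)]]]]
      by (simp add: im_def lq dd(1,2) fy_def)
    then show "fyy \<upsilon> = fyy \<tau> * Dt G ?m + fy \<tau> * (fy \<tau> * Dt (Dt G) ?m + fy \<xi> * Dt (Dx G) ?m)
        + (fyy \<xi> * Dx G ?m + fy \<xi> * (fy \<tau> * Dt (Dx G) ?m + fy \<xi> * Dx (Dx G) ?m))" by (simp only: sym)
    have mV': "(\<tau> q, \<xi> q) \<in> V" using mV m by simp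
    have "pt u (\<tau> q) (\<xi> q) = a (\<xi> q) * pxx u (\<tau> q) (\<xi> q) + b (\<xi> q) * px u (\<tau> q) (\<xi> q) + c (\<xi> q) * u (\<tau> q) (\<xi> q)"
      using sol mV' unfolding lsol_def by blast
    moreover have "u (\<tau> q) (\<xi> q) = \<upsilon> q" using uim[OF U(3)] by (simp add: lq G_def)
    ultimately show "Dt G ?m = a (\<xi> q) * Dx (Dx G) ?m + b (\<xi> q) * Dx G ?m + c (\<xi> q) * \<upsilon> q"
      using partials_eq_dir_deriv[OF G[unfolded G_def] V mV'] by (simp add: m G_def)
  qed
qed

end

section \<open>The determining equations\<close>

context heat_preimage
begin

lemma smooth_D:
  "smooth_on E f \<Longrightarrow> smooth_on E (D1 f)" "smooth_on E f \<Longrightarrow> smooth_on E (D2 f)" "smooth_on E f \<Longrightarrow> smooth_on E (D3 f)"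
  by (auto intro: smooth_on_dir_deriv basis3)

text \<open>Two polynomials that differ only in w_ss give the same u_t and u_x, and, since
  \<open>a\<close> is positive, the equation forces the same u_xx. Only u_tt and u_tx can react.
  Subtraction leaves three linear equations for these two changes, compatible only if \<tau>_y + p
  \<tau>_w = 0; two admissible slopes p then separate the terms.\<close>

lemma time_first_derivs: 
  assumes q: "q \<in> E"
  shows "D2 \<tau> q = 0" "D3 \<tau> q = 0"
proof -
  obtain s0 y0 w0 where q0: "q = (s0, y0, w0)" by (cases q)
  define t1 where "t1 = D1 \<tau> q" define t2 where "t2 = D2 \<tau> q" define t3 where "t3 = D3 \<tau> q"
  define x1 where "x1 = D1 \<xi> q" define x2 where "x2 = D2 \<xi> q" define x3 where "x3 = D3 \<xi> q"
  define v1 where "v1 = D1 \<upsilon> q" define v2 where "v2 = D2 \<upsilon> q" define v3 where "v3 = D3 \<upsilon> q"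
  note defs = t1_def t2_def t3_def x1_def x2_def x3_def v1_def v2_def v3_def
  have dt: "t1 * (x2 * v3 - x3 * v2) - t2 * (x1 * v3 - x3 * v1) + t3 * (x1 * v2 - x2 * v1) \<noteq> 0"
    using det[OF q] by (simp add: defs)
  have key: "t2 + p * t3 = 0" if \<Delta>: "(t1 + r * t3) * (x2 + p * x3) - (t2 + p * t3) * (x1 + r * x3) \<noteq> 0" for p r
  proof -
    have \<Delta>': "(D1 \<tau> (s0, y0, w0) + r * D3 \<tau> (s0, y0, w0)) * (D2 \<xi> (s0, y0, w0) + p * D3 \<xi> (s0, y0, w0))
      - (D2 \<tau> (s0, y0, w0) + p * D3 \<tau> (s0, y0, w0)) * (D1 \<xi> (s0, y0, w0) + r * D3 \<xi> (s0, y0, w0)) \<noteq> 0"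
      using \<Delta> by (simp add: defs q0)
    have qE: "(s0, y0, w0) \<in> E" using q q0 by simp
    obtain ut ux utt utx uxx where 0: "v1 + r * v3 = (t1 + r * t3) * ut + (x1 + r * x3) * ux"
      "v2 + p * v3 = (t2 + p * t3) * ut + (x2 + p * x3) * ux"
      "D1 (D1 \<upsilon>) q + r * D3 (D1 \<upsilon>) q + (0 * v3 + r * (D1 (D3 \<upsilon>) q + r * D3 (D3 \<upsilon>) q)) =
        (D1 (D1 \<tau>) q + r * D3 (D1 \<tau>) q + (0 * t3 + r * (D1 (D3 \<tau>) q + r * D3 (D3 \<tau>) q))) * ut
        + (t1 + r * t3) * ((t1 + r * t3) * utt + (x1 + r * x3) * utx)
        + ((D1 (D1 \<xi>) q + r * D3 (D1 \<xi>) q + (0 * x3 + r * (D1 (D3 \<xi>) q + r * D3 (D3 \<xi>) q))) * ux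
        + (x1 + r * x3) * ((t1 + r * t3) * utx + (x1 + r * x3) * uxx))"
      "D1 (D2 \<upsilon>) q + r * D3 (D2 \<upsilon>) q + p * (D1 (D3 \<upsilon>) q + r * D3 (D3 \<upsilon>) q) =
        (D1 (D2 \<tau>) q + r * D3 (D2 \<tau>) q + p * (D1 (D3 \<tau>) q + r * D3 (D3 \<tau>) q)) * ut
        + (t2 + p * t3) * ((t1 + r * t3) * utt + (x1 + r * x3) * utx)
        + ((D1 (D2 \<xi>) q + r * D3 (D2 \<xi>) q + p * (D1 (D3 \<xi>) q + r * D3 (D3 \<xi>) q)) * ux
        + (x2 + p * x3) * ((t1 + r * t3) * utx + (x1 + r * x3) * uxx))"
      "D2 (D2 \<upsilon>) q + p * D3 (D2 \<upsilon>) q + (r * v3 + p * (D2 (D3 \<upsilon>) q + p * D3 (D3 \<upsilon>) q)) =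
        (D2 (D2 \<tau>) q + p * D3 (D2 \<tau>) q + (r * t3 + p * (D2 (D3 \<tau>) q + p * D3 (D3 \<tau>) q))) * ut
        + (t2 + p * t3) * ((t2 + p * t3) * utt + (x2 + p * x3) * utx)
        + ((D2 (D2 \<xi>) q + p * D3 (D2 \<xi>) q + (r * x3 + p * (D2 (D3 \<xi>) q + p * D3 (D3 \<xi>) q))) * ux
        + (x2 + p * x3) * ((t2 + p * t3) * utx + (x2 + p * x3) * uxx))"
      "ut = a (\<xi> q) * uxx + b (\<xi> q) * ux + c (\<xi> q) * \<upsilon> q"
      using jet[OF qE \<Delta>', of 0, folded q0, folded defs] by blast
    obtain ut' ux' utt' utx' uxx' where 1: "v1 + r * v3 = (t1 + r * t3) * ut' + (x1 + r * x3) * ux'"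
      "v2 + p * v3 = (t2 + p * t3) * ut' + (x2 + p * x3) * ux'"
      "D1 (D1 \<upsilon>) q + r * D3 (D1 \<upsilon>) q + (1 * v3 + r * (D1 (D3 \<upsilon>) q + r * D3 (D3 \<upsilon>) q)) =
        (D1 (D1 \<tau>) q + r * D3 (D1 \<tau>) q + (1 * t3 + r * (D1 (D3 \<tau>) q + r * D3 (D3 \<tau>) q))) * ut'
        + (t1 + r * t3) * ((t1 + r * t3) * utt' + (x1 + r * x3) * utx')
        + ((D1 (D1 \<xi>) q + r * D3 (D1 \<xi>) q + (1 * x3 + r * (D1 (D3 \<xi>) q + r * D3 (D3 \<xi>) q))) * ux'
        + (x1 + r * x3) * ((t1 + r * t3) * utx' + (x1 + r * x3) * uxx'))"
      "D1 (D2 \<upsilon>) q + r * D3 (D2 \<upsilon>) q + p * (D1 (D3 \<upsilon>) q + r * D3 (D3 \<upsilon>) q) =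
        (D1 (D2 \<tau>) q + r * D3 (D2 \<tau>) q + p * (D1 (D3 \<tau>) q + r * D3 (D3 \<tau>) q)) * ut'
        + (t2 + p * t3) * ((t1 + r * t3) * utt' + (x1 + r * x3) * utx')
        + ((D1 (D2 \<xi>) q + r * D3 (D2 \<xi>) q + p * (D1 (D3 \<xi>) q + r * D3 (D3 \<xi>) q)) * ux'
        + (x2 + p * x3) * ((t1 + r * t3) * utx' + (x1 + r * x3) * uxx'))"
      "D2 (D2 \<upsilon>) q + p * D3 (D2 \<upsilon>) q + (r * v3 + p * (D2 (D3 \<upsilon>) q + p * D3 (D3 \<upsilon>) q)) =
        (D2 (D2 \<tau>) q + p * D3 (D2 \<tau>) q + (r * t3 + p * (D2 (D3 \<tau>) q + p * D3 (D3 \<tau>) q))) * ut'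
        + (t2 + p * t3) * ((t2 + p * t3) * utt' + (x2 + p * x3) * utx')
        + ((D2 (D2 \<xi>) q + p * D3 (D2 \<xi>) q + (r * x3 + p * (D2 (D3 \<xi>) q + p * D3 (D3 \<xi>) q))) * ux'
        + (x2 + p * x3) * ((t2 + p * t3) * utx' + (x2 + p * x3) * uxx'))"
      "ut' = a (\<xi> q) * uxx' + b (\<xi> q) * ux' + c (\<xi> q) * \<upsilon> q"
      using jet[OF qE \<Delta>', of 1, folded q0, folded defs] by blast
    define ts xs ty xy where "ts = t1 + r * t3" and "xs = x1 + r * x3" and "ty = t2 + p * t3" and "xy = x2 + p * x3"
    note ab = ts_def[symmetric] xs_def[symmetric] ty_def[symmetric] xy_def[symmetric]
    have D: "ts * xy - ty * xs \<noteq> 0" using \<Delta> by (simp add: ab)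
    have "(ts * xy - ty * xs) * (ut' - ut) = 0" "(ts * xy - ty * xs) * (ux' - ux) = 0"
      using 0(1,2) 1(1,2) unfolding ab by algebra+
    then have uu: "ut' = ut" "ux' = ux" using D by auto
    have "a (\<xi> q) * (uxx' - uxx) = 0" using 0(6) 1(6) unfolding uu by (simp add: algebra_simps)
    then have xx: "uxx' = uxx" using apos[OF \<xi>_S[OF q]] by auto
    \<comment> \<open>The effect on the ss-equation of raising w_ss by one, which the changes in
      u_tt and u_tx must compensate.\<close>
    define N where "N = v3 - ut * t3 - ux * x3"
    define dtt where "dtt = utt' - utt" define dtx where "dtx = utx' - utx"
    have e1: "N = ts * ts * dtt + 2 * ts * xs * dtx"
      using 0(3) 1(3) unfolding uu xx ab N_def dtt_def dtx_def by algebra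
    have e2: "0 = ty * ts * dtt + (ty * xs + xy * ts) * dtx"
      using 0(4) 1(4) unfolding uu xx ab N_def dtt_def dtx_def by algebra
    have e3: "0 = ty * ty * dtt + 2 * ty * xy * dtx"
      using 0(5) 1(5) unfolding uu xx ab N_def dtt_def dtx_def by algebra
    \<comment> \<open>The combination \<open>ty * ty\<close> times \<open>e1\<close>, minus
      \<open>2 * ts * ty\<close> times \<open>e2\<close>, plus \<open>ts * ts\<close> times
      \<open>e3\<close> eliminates both changes.\<close>
    have "ty * ty * N = 0" using e1 e2 e3 by algebra
    \<comment> \<open>If \<open>N\<close> vanished, the first-order equations would make the
      gradient of \<open>\<upsilon>\<close> the combination of those of \<open>\<tau>\<close> and
      \<open>\<xi>\<close> with coefficients \<open>ut\<close> and \<open>ux\<close>, against the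
      nonzero Jacobian.\<close>
    moreover have "N \<noteq> 0"
    proof
      assume N: "N = 0"
      have "v3 = ut * t3 + ux * x3" using N by (simp add: N_def)
      moreover have "v1 = ut * t1 + ux * x1" using 0(1) calculation by (simp add: algebra_simps)
      moreover have "v2 = ut * t2 + ux * x2" using 0(2) calculation(1) by (simp add: algebra_simps)
      ultimately have "t1 * (x2 * v3 - x3 * v2) - t2 * (x1 * v3 - x3 * v1) + t3 * (x1 * v2 - x2 * v1) = 0"
        by algebra
      then show False using dt by simp
    qed
    ultimately have "ty = 0" by simp
    then show ?thesis by (simp add: ty_def)
  qed
  define m0 where "m0 = t1 * x2 - t2 * x1" define m1 where "m1 = t1 * x3 - t3 * x1" define m2 where "m2 = t3 * x2 - t2 * x3"
  \<comment> \<open>The products of p and r cancel, so the planar Jacobian is affine in the two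
    slopes jointly.\<close>
  have \<Delta>eq: "(t1 + r * t3) * (x2 + p * x3) - (t2 + p * t3) * (x1 + r * x3) = m0 + p * m1 + r * m2" for p r
    by (simp add: m0_def m1_def m2_def algebra_simps)
  \<comment> \<open>Expansion of the three-dimensional Jacobian along the derivatives of
    \<open>\<upsilon>\<close>.\<close>
  have "v3 * m0 - v2 * m1 - v1 * m2 \<noteq> 0"
    using dt by (simp add: m0_def m1_def m2_def algebra_simps)
  then have nz: "m0 \<noteq> 0 \<or> m1 \<noteq> 0 \<or> m2 \<noteq> 0" by auto
  have key': "t2 + p * t3 = 0" if "m0 + p * m1 + r * m2 \<noteq> 0" for p r
    using key[of r p] that \<Delta>eq by simp
  have "t2 = 0 \<and> t3 = 0"
  proof (cases "m2 = 0")
    case False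
    have 0: "t2 + p * t3 = 0" for p
      \<comment> \<open>For any p, this r makes the planar Jacobian equal to 1.\<close>
      by (rule key'[of p "(1 - m0 - p * m1) / m2"]) (use False in simp)
    show ?thesis using 0[of 0] 0[of 1] by simp
  next
    case True
    have 0: "m0 + p * m1 \<noteq> 0 \<Longrightarrow> t2 + p * t3 = 0" for p using key'[of p 0] by simp
    have "m0 \<noteq> 0 \<or> m1 \<noteq> 0" using nz True by simp
    \<comment> \<open>A nonzero affine function of p has at most one root, so at least two of p = 0,
      1, 2 are admissible.\<close>
    then consider "m0 \<noteq> 0" "m0 + m1 \<noteq> 0" | "m0 \<noteq> 0" "m0 + 2 * m1 \<noteq> 0" | "m0 + m1 \<noteq> 0" "m0 + 2 * m1 \<noteq> 0"
      by force
    then show ?thesis by cases (use 0[of 0] 0[of 1] 0[of 2] in auto)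
  qed
  then show "D2 \<tau> q = 0" "D3 \<tau> q = 0" by (simp_all add: t2_def t3_def)
qed

text \<open>Once \<tau> depends on s only, the planar Jacobian is \<tau>_s (\<xi>_y + p \<xi>_w),
  which does not involve r. Eliminating the derivatives of u leaves a polynomial relation that is
  affine in r, valid whenever \<xi>_y + p \<xi>_w is nonzero; its coefficients in r and p carry all
  the remaining information.\<close>

lemma space_first_derivs:
  assumes q: "q \<in> E"
  shows "D3 \<xi> q = 0" "(D2 \<xi> q)^2 = a (\<xi> q) * D1 \<tau> q" "D2 \<xi> q \<noteq> 0" "D1 \<tau> q \<noteq> 0" "D3 \<upsilon> q \<noteq> 0"
    and reduced_equation: "(D2 \<xi> q)^2 * (D1 \<upsilon> q * D2 \<xi> q - D1 \<xi> q * (D2 \<upsilon> q + p * D3 \<upsilon> q)) =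
      (D2 \<xi> q)^2 * ((D2 (D2 \<upsilon>) q + p * D3 (D2 \<upsilon>) q + p * (D2 (D3 \<upsilon>) q + p * D3 (D3 \<upsilon>) q)) * D2 \<xi> q
        - (D2 (D2 \<xi>) q + p * D3 (D2 \<xi>) q + p * (D2 (D3 \<xi>) q + p * D3 (D3 \<xi>) q)) * (D2 \<upsilon> q + p * D3 \<upsilon> q))
      + D1 \<tau> q * (D2 \<xi> q)^2 * (b (\<xi> q) * (D2 \<upsilon> q + p * D3 \<upsilon> q) + c (\<xi> q) * \<upsilon> q * D2 \<xi> q)"
proof -
  obtain s0 y0 w0 where q0: "q = (s0, y0, w0)" by (cases q)
  note z = time_first_derivs[OF q]
  have zz: "D2 (D2 \<tau>) q = 0" "D3 (D2 \<tau>) q = 0" "D2 (D3 \<tau>) q = 0" "D3 (D3 \<tau>) q = 0"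
    using time_first_derivs by (auto intro: dir_deriv_zero[OF E q])
  define t1 where "t1 = D1 \<tau> q"
  define x1 where "x1 = D1 \<xi> q" define x2 where "x2 = D2 \<xi> q" define x3 where "x3 = D3 \<xi> q"
  define v1 where "v1 = D1 \<upsilon> q" define v2 where "v2 = D2 \<upsilon> q" define v3 where "v3 = D3 \<upsilon> q"
  note defs = t1_def x1_def x2_def x3_def v1_def v2_def v3_def
  have dt: "t1 * (x2 * v3 - x3 * v2) \<noteq> 0"
    using det[OF q] by (simp add: defs z)
  define A where "A = a (\<xi> q)"
  define hx where "hx = (\<lambda>p. D2 (D2 \<xi>) q + p * D3 (D2 \<xi>) q + p * (D2 (D3 \<xi>) q + p * D3 (D3 \<xi>) q))"
  define hv where "hv = (\<lambda>p. D2 (D2 \<upsilon>) q + p * D3 (D2 \<upsilon>) q + p * (D2 (D3 \<upsilon>) q + p * D3 (D3 \<upsilon>) q))"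
  \<comment> \<open>The result of eliminating \<open>ut\<close>, \<open>ux\<close> and
    \<open>uxx\<close> from the first-order equations, the yy-equation and the equation for
    u.\<close>
  have key: "(x2 + p * x3)^2 * ((v1 + r * v3) * (x2 + p * x3) - (x1 + r * x3) * (v2 + p * v3)) =
      t1 * A * ((hv p + r * v3) * (x2 + p * x3) - (hx p + r * x3) * (v2 + p * v3))
      + t1 * (x2 + p * x3)^2 * (b (\<xi> q) * (v2 + p * v3) + c (\<xi> q) * \<upsilon> q * (x2 + p * x3))"
    if nz: "x2 + p * x3 \<noteq> 0" for p r
  proof -
    have \<Delta>': "(D1 \<tau> (s0, y0, w0) + r * D3 \<tau> (s0, y0, w0)) * (D2 \<xi> (s0, y0, w0) + p * D3 \<xi> (s0, y0, w0))
      - (D2 \<tau> (s0, y0, w0) + p * D3 \<tau> (s0, y0, w0)) * (D1 \<xi> (s0, y0, w0) + r * D3 \<xi> (s0, y0, w0)) \<noteq> 0"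
      using nz dt by (simp add: z[unfolded q0] defs q0)
    have qE: "(s0, y0, w0) \<in> E" using q q0 by simp
    obtain ut ux uxx where 0: "v1 + r * v3 = t1 * ut + (x1 + r * x3) * ux"
      "v2 + p * v3 = (x2 + p * x3) * ux"
      "D2 (D2 \<upsilon>) q + p * D3 (D2 \<upsilon>) q + (r * v3 + p * (D2 (D3 \<upsilon>) q + p * D3 (D3 \<upsilon>) q)) =
        (D2 (D2 \<xi>) q + p * D3 (D2 \<xi>) q + (r * x3 + p * (D2 (D3 \<xi>) q + p * D3 (D3 \<xi>) q))) * ux
         + (x2 + p * x3) * ((x2 + p * x3) * uxx)"
      "ut = A * uxx + b (\<xi> q) * ux + c (\<xi> q) * \<upsilon> q"
      using jet[OF qE \<Delta>', of 0, folded q0, folded A_def,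
          unfolded z zz mult_zero_left mult_zero_right add_0_left add_0_right, folded defs]
      by blast
    show ?thesis using 0 unfolding hx_def hv_def by algebra
  qed
  \<comment> \<open>The coefficient of r, isolated by comparing r = 0 and r = 1. The factor
    \<open>x2 * v3 - x3 * v2\<close> is nonzero by the Jacobian.\<close>
  have sq: "(x2 + p * x3)^2 = t1 * A" if nz: "x2 + p * x3 \<noteq> 0" for p
  proof -
    have "((x2 + p * x3)^2 - t1 * A) * (x2 * v3 - x3 * v2) = 0"
      using key[OF nz, of 0] key[OF nz, of 1] by algebra
    then show ?thesis using dt by simp
  qed
  \<comment> \<open>Otherwise \<open>x2 + p * x3\<close> takes both values 1 and 2 for suitable p,
    while its square is the fixed number \<open>t1 * A\<close>.\<close>
  have x3: "x3 = 0"
  proof (rule ccontr)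
    assume n: "x3 \<noteq> 0"
    then have "x2 + (1 - x2) / x3 * x3 = 1" "x2 + (2 - x2) / x3 * x3 = 2" by (simp_all add: field_simps)
    then show False using sq[of "(1 - x2) / x3"] sq[of "(2 - x2) / x3"] by simp
  qed
  have nz: "x2 \<noteq> 0" "t1 \<noteq> 0" "v3 \<noteq> 0" using dt x3 by auto
  have sq0: "x2^2 = A * t1" using sq[of 0] nz by (simp add: mult.commute)
  show "D3 \<xi> q = 0" "(D2 \<xi> q)^2 = a (\<xi> q) * D1 \<tau> q" "D2 \<xi> q \<noteq> 0" "D1 \<tau> q \<noteq> 0" "D3 \<upsilon> q \<noteq> 0"
    using x3 sq0 nz by (simp_all add: defs A_def)
  have "x2^2 * (v1 * x2 - x1 * (v2 + p * v3)) = x2^2 * (hv p * x2 - hx p * (v2 + p * v3))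
      + t1 * x2^2 * (b (\<xi> q) * (v2 + p * v3) + c (\<xi> q) * \<upsilon> q * x2)"
    using key[of p 0] sq0 nz by (simp add: x3 mult.commute[of t1 A])
  then show "(D2 \<xi> q)^2 * (D1 \<upsilon> q * D2 \<xi> q - D1 \<xi> q * (D2 \<upsilon> q + p * D3 \<upsilon> q)) =
      (D2 \<xi> q)^2 * ((D2 (D2 \<upsilon>) q + p * D3 (D2 \<upsilon>) q + p * (D2 (D3 \<upsilon>) q + p * D3 (D3 \<upsilon>) q)) * D2 \<xi> q
        - (D2 (D2 \<xi>) q + p * D3 (D2 \<xi>) q + p * (D2 (D3 \<xi>) q + p * D3 (D3 \<xi>) q)) * (D2 \<upsilon> q + p * D3 \<upsilon> q))
      + D1 \<tau> q * (D2 \<xi> q)^2 * (b (\<xi> q) * (D2 \<upsilon> q + p * D3 \<upsilon> q) + c (\<xi> q) * \<upsilon> q * D2 \<xi> q)"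
    by (simp add: defs hx_def hv_def)
qed

text \<open>The reduced relation holds for every p and is polynomial in p. Comparing p = 1 with p =
  -1 extracts the linear coefficient, which is the first equation; p = 0 gives the second.
  Independence of \<xi> from w removes its mixed derivatives beforehand.\<close>

lemma determining_equations:
  assumes q: "q \<in> E"
  shows "- D3 \<upsilon> q * D1 \<xi> q = 2 * D2 (D3 \<upsilon>) q * D2 \<xi> q - D3 \<upsilon> q * D2 (D2 \<xi>) q + D1 \<tau> q * b (\<xi> q) * D3 \<upsilon> q"
    "D1 \<upsilon> q * D2 \<xi> q - D2 \<upsilon> q * D1 \<xi> q = D2 (D2 \<upsilon>) q * D2 \<xi> q - D2 \<upsilon> q * D2 (D2 \<xi>) q
       + D1 \<tau> q * b (\<xi> q) * D2 \<upsilon> q + D1 \<tau> q * c (\<xi> q) * \<upsilon> q * D2 \<xi> q"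
proof -
  have z: "D2 (D3 \<xi>) q = 0" "D3 (D3 \<xi>) q = 0"
    using space_first_derivs(1) by (auto intro: dir_deriv_zero[OF E q])
  have c: "D3 (D2 \<xi>) q = 0" "D3 (D2 \<upsilon>) q = D2 (D3 \<upsilon>) q"
    using dir_deriv_commute[OF smooth_E(2) E q basis3(3,2)] dir_deriv_commute[OF smooth_E(3) E q basis3(3,2)] z by auto
  have n: "D2 \<xi> q \<noteq> 0" using space_first_derivs[OF q] by simp
  have e: "D1 \<upsilon> q * D2 \<xi> q - D1 \<xi> q * (D2 \<upsilon> q + p * D3 \<upsilon> q) =
      (D2 (D2 \<upsilon>) q + p * D2 (D3 \<upsilon>) q + p * (D2 (D3 \<upsilon>) q + p * D3 (D3 \<upsilon>) q)) * D2 \<xi> q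
        - D2 (D2 \<xi>) q * (D2 \<upsilon> q + p * D3 \<upsilon> q)
      + D1 \<tau> q * (b (\<xi> q) * (D2 \<upsilon> q + p * D3 \<upsilon> q) + c (\<xi> q) * \<upsilon> q * D2 \<xi> q)" (is "?L p = ?R p") for p
  proof -
    have "(D2 \<xi> q)^2 * ?L p = (D2 \<xi> q)^2 * ?R p"
      using reduced_equation[OF q, of p] unfolding z c by (simp add: algebra_simps)
    then show ?thesis using n by simp
  qed
  show "- D3 \<upsilon> q * D1 \<xi> q = 2 * D2 (D3 \<upsilon>) q * D2 \<xi> q - D3 \<upsilon> q * D2 (D2 \<xi>) q + D1 \<tau> q * b (\<xi> q) * D3 \<upsilon> q"
    using e[of 1] e[of "-1"] by algebra
  show "D1 \<upsilon> q * D2 \<xi> q - D2 \<upsilon> q * D1 \<xi> q = D2 (D2 \<upsilon>) q * D2 \<xi> q - D2 \<upsilon> q * D2 (D2 \<xi>) q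
       + D1 \<tau> q * b (\<xi> q) * D2 \<upsilon> q + D1 \<tau> q * c (\<xi> q) * \<upsilon> q * D2 \<xi> q"
    using e[of 0] by (simp add: algebra_simps)
qed

end

context parabolic
begin

text \<open>The first and second derivatives of $K$ with respect to $I$.\<close>

definition k1 :: "real \<Rightarrow> real" where "k1 x = r x * deriv K x"
definition k2 :: "real \<Rightarrow> real" where "k2 x = r x * deriv k1 x"

lemma smooth_k1: "smooth_on S k1"
  unfolding k1_def[abs_def] by (intro smooth_on_mult smooth_r smooth_on_real_deriv smooth_K S)

lemma smooth_k2: "smooth_on S k2"
  unfolding k2_def[abs_def] by (intro smooth_on_mult smooth_r smooth_on_real_deriv smooth_k1 S)

text \<open>Three integrations with respect to \<open>I\<close>: a function with zero derivative on
  the interval is constant, first \<open>k2\<close>, then \<open>k1\<close> minus its linear part,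
  then \<open>K\<close> minus its quadratic part. The constant value of \<open>k2\<close> is twice
  the leading coefficient.\<close>

lemma K_quadraticI:
  assumes z: "\<And>x. x \<in> S \<Longrightarrow> deriv k2 x = 0"
  shows "\<exists>c0 c1 c2. \<forall>x\<in>S. K x = c2 * (I x)^2 + c1 * I x + c0"
proof -
  have conv: "convex S" using S(1) by (simp add: is_interval_convex_1)
  have const: "\<exists>e. \<forall>x\<in>S. f x = e" if "\<And>x. x \<in> S \<Longrightarrow> (f has_real_derivative 0) (at x)" for f :: "real \<Rightarrow> real"
  proof -
    have "\<And>x. x \<in> S \<Longrightarrow> (f has_real_derivative 0) (at x within S)"
      using that has_field_derivative_at_within by blast
    from has_field_derivative_zero_constant[OF conv this] show ?thesis by auto
  qed
  have d: "(K has_real_derivative k1 x / r x) (at x)" "(k1 has_real_derivative k2 x / r x) (at x)"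
    "(k2 has_real_derivative 0) (at x)" if x: "x \<in> S" for x
    using smooth_on_real_deriv(1)[OF S(2) smooth_K x] smooth_on_real_deriv(1)[OF S(2) smooth_k1 x]
      smooth_on_real_deriv(1)[OF S(2) smooth_k2 x] r(1)[OF x] z[OF x] by (simp_all add: k1_def k2_def)
  obtain e2 where e2: "\<forall>x\<in>S. k2 x = e2" using const[OF d(3)] by blast
  have "((\<lambda>x. k1 x - e2 * I x) has_real_derivative 0) (at x)" if x: "x \<in> S" for x
    using DERIV_diff[OF d(2)[OF x] DERIV_cmult[OF DERIV_I[OF x], of e2]] e2 x by simp
  then obtain e1 where e1: "\<forall>x\<in>S. k1 x - e2 * I x = e1" using const[of "\<lambda>x. k1 x - e2 * I x"] by blast
  have "((\<lambda>x. K x - (e2 / 2 * (I x * I x) + e1 * I x)) has_real_derivative 0) (at x)" if x: "x \<in> S" for x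
  proof -
    have "k1 x = e1 + e2 * I x" using e1 x by force
    then have "k1 x / r x - (e2 / 2 * (1 / r x * I x + 1 / r x * I x) + e1 * (1 / r x)) = 0"
      using r(1)[OF x] by (simp add: field_simps)
    then show ?thesis
      using DERIV_diff[OF d(1)[OF x] DERIV_add[OF DERIV_cmult[OF DERIV_mult[OF DERIV_I[OF x] DERIV_I[OF x]], of "e2 / 2"]
          DERIV_cmult[OF DERIV_I[OF x], of e1]]] by simp
  qed
  then obtain e0 where e0: "\<forall>x\<in>S. K x - (e2 / 2 * (I x * I x) + e1 * I x) = e0"
    using const[of "\<lambda>x. K x - (e2 / 2 * (I x * I x) + e1 * I x)"] by blast
  have "\<forall>x\<in>S. K x = e2 / 2 * (I x)^2 + e1 * I x + e0"
    using e0 by (auto simp: power2_eq_square algebra_simps)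
  then show ?thesis by blast
qed

end

context heat_preimage
begin

section \<open>The determining equations in the coordinate \<open>I\<close>\<close>

lemma smooth_along_\<xi>: "smooth_on S h \<Longrightarrow> smooth_on E (\<lambda>q. h (\<xi> q))"
  for h :: "real \<Rightarrow> real"
  using smooth_on_compose[OF E S(2) _ smooth_E(2)] \<xi>_S by blast

lemma has_dd_along_\<xi>:
  assumes "smooth_on S h" "q \<in> E"
  shows "has_dd v (\<lambda>q. h (\<xi> q)) (deriv h (\<xi> q) * dir_deriv v \<xi> q) q"
  by (rule has_dd_compose[OF smooth_on_real_deriv(1)[OF S(2) assms(1) \<xi>_S[OF assms(2)]] has_dd_smooth[OF smooth_E(2) E assms(2)]])

text \<open>Together with \<open>\<eta>\<close> these are the y- and s-derivatives of
  \<open>I\<close> composed with \<open>\<xi>\<close>, that is, of the original position measured in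
  the coordinate where the leading coefficient is 1.\<close>

definition \<sigma> :: "real \<times> real \<times> real \<Rightarrow> real" where "\<sigma> q = D2 \<xi> q / r (\<xi> q)"
definition \<eta> :: "real \<times> real \<times> real \<Rightarrow> real" where "\<eta> q = D1 \<xi> q / r (\<xi> q)"
abbreviation g :: "real \<times> real \<times> real \<Rightarrow> real" where "g \<equiv> D3 \<upsilon>"

lemma r_\<xi>: "q \<in> E \<Longrightarrow> r (\<xi> q) > 0" using r \<xi>_S by auto

lemma \<xi>_derivs: "q \<in> E \<Longrightarrow> D2 \<xi> q = r (\<xi> q) * \<sigma> q" "q \<in> E \<Longrightarrow> D1 \<xi> q = r (\<xi> q) * \<eta> q"
  using r_\<xi>[of q] by (auto simp: \<sigma>_def \<eta>_def)

lemma \<sigma>_nz: "q \<in> E \<Longrightarrow> \<sigma> q \<noteq> 0"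
  using space_first_derivs(3)[of q] \<xi>_derivs(1)[of q] by auto

lemma smooth_\<sigma>\<eta>: "smooth_on E \<sigma>" "smooth_on E \<eta>"
  unfolding \<sigma>_def[abs_def] \<eta>_def[abs_def]
  by (intro smooth_on_divide E smooth_D smooth_E smooth_along_\<xi> smooth_r, use r_\<xi> in force)+

lemma \<sigma>_sq: "q \<in> E \<Longrightarrow> \<sigma> q * \<sigma> q = D1 \<tau> q"
proof -
  assume q: "q \<in> E"
  have "(r (\<xi> q))^2 * (\<sigma> q * \<sigma> q) = (r (\<xi> q))^2 * D1 \<tau> q"
    using space_first_derivs(2)[OF q] \<xi>_derivs(1)[OF q] r(2)[OF \<xi>_S[OF q]] by (simp add: power2_eq_square)
  then show ?thesis using r_\<xi>[OF q] by simp
qed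

text \<open>The square of \<open>\<sigma>\<close> is \<tau>_s, which does not depend on y because
  \<tau> does not; dividing by the nonzero \<open>\<sigma>\<close> gives the claim.\<close>

lemma D2_\<sigma>: assumes q: "q \<in> E" shows "D2 \<sigma> q = 0"
proof -
  note d = has_dd_smooth[OF smooth_\<sigma>\<eta>(1) E q, of "(0,1,0)"]
  have "D2 \<sigma> q * \<sigma> q + \<sigma> q * D2 \<sigma> q = D2 (D1 \<tau>) q"
    by (rule has_dd_unique[OF E q \<sigma>_sq has_dd_mult[OF d d] has_dd_smooth[OF smooth_D(1)[OF smooth_E(1)] E q]])
  also have "\<dots> = D1 (D2 \<tau>) q" by (rule dir_deriv_commute[OF smooth_E(1) E q basis3(2,1)])
  also have "\<dots> = 0" by (rule dir_deriv_zero[OF E q time_first_derivs(1)])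
  finally show ?thesis using \<sigma>_nz[OF q] by simp
qed

text \<open>Both sides are mixed derivatives of \<open>I\<close> composed with
  \<open>\<xi>\<close>.\<close>

lemma D1_\<sigma>: assumes q: "q \<in> E" shows "D2 \<eta> q = D1 \<sigma> q"
proof -
  define \<theta> where "\<theta> = (\<lambda>q. I (\<xi> q))"
  have s: "smooth_on E \<theta>" unfolding \<theta>_def by (rule smooth_along_\<xi>[OF smooth_I])
  have d: "D2 \<theta> q = \<sigma> q" "D1 \<theta> q = \<eta> q" if "q \<in> E" for q
    using has_dd_imp_eq[OF has_dd_along_\<xi>[OF smooth_I that]] DERIV_imp_deriv[OF DERIV_I[OF \<xi>_S[OF that]]]
    by (auto simp: \<theta>_def \<sigma>_def \<eta>_def)
  have "D2 \<eta> q = D2 (D1 \<theta>) q" by (rule dir_deriv_cong[OF E q]) (use d in auto)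
  also have "\<dots> = D1 (D2 \<theta>) q" by (rule dir_deriv_commute[OF s E q basis3(2,1)])
  also have "\<dots> = D1 \<sigma> q" by (rule dir_deriv_cong[OF E q]) (use d in auto)
  finally show ?thesis .
qed

lemma D2_D1_\<sigma>: assumes q: "q \<in> E" shows "D2 (D1 \<sigma>) q = 0"
  using dir_deriv_commute[OF smooth_\<sigma>\<eta>(1) E q basis3(2,1)] dir_deriv_zero[OF E q D2_\<sigma>] by simp

lemma D2_D1_\<eta>: assumes q: "q \<in> E" shows "D2 (D1 \<eta>) q = D1 (D1 \<sigma>) q"
  using dir_deriv_commute[OF smooth_\<sigma>\<eta>(2) E q basis3(2,1)] dir_deriv_cong[OF E q D1_\<sigma>] by simp

lemma D2_D1_D1_\<sigma>: assumes q: "q \<in> E" shows "D2 (D1 (D1 \<sigma>)) q = 0"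
  using dir_deriv_commute[OF smooth_D(1)[OF smooth_\<sigma>\<eta>(1)] E q basis3(2,1)] dir_deriv_zero[OF E q D2_D1_\<sigma>] by simp

lemma D2_D2_\<xi>: assumes q: "q \<in> E" shows "D2 (D2 \<xi>) q = deriv r (\<xi> q) * r (\<xi> q) * (\<sigma> q * \<sigma> q)"
  using has_dd_unique[OF E q \<xi>_derivs(1) has_dd_smooth[OF smooth_D(2)[OF smooth_E(2)] E q]
      has_dd_mult[OF has_dd_along_\<xi>[OF smooth_r q] has_dd_smooth[OF smooth_\<sigma>\<eta>(1) E q, of "(0,1,0)"]]]
  by (simp add: D2_\<sigma>[OF q] \<xi>_derivs[OF q])

lemma smooth_g: "smooth_on E g" by (rule smooth_D(3)[OF smooth_E(3)])

lemma g_nz: "q \<in> E \<Longrightarrow> g q \<noteq> 0" by (rule space_first_derivs)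

lemma b_eq: "q \<in> E \<Longrightarrow> b (\<xi> q) = r (\<xi> q) * (deriv r (\<xi> q) - J (\<xi> q))"
  using r_\<xi>[of q] by (simp add: J_eq)

text \<open>The first determining equation rewritten. It fixes the logarithmic y-derivative of
  \<open>g\<close>; the terms with the derivative of \<open>r\<close> cancel against those in
  \<open>b\<close>.\<close>

lemma g_y:
  assumes q: "q \<in> E"
  shows "2 * \<sigma> q * D2 g q = g q * (\<sigma> q * \<sigma> q * J (\<xi> q) - \<eta> q)"
proof -
  let ?R = "r (\<xi> q)" and ?R' = "deriv r (\<xi> q)" and ?J = "J (\<xi> q)"
  have "- g q * (?R * \<eta> q) = 2 * D2 g q * (?R * \<sigma> q) - g q * (?R' * ?R * (\<sigma> q * \<sigma> q)) + \<sigma> q * \<sigma> q * (?R * (?R' - ?J)) * g q"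
    using determining_equations(1)[OF q] unfolding \<xi>_derivs[OF q] D2_D2_\<xi>[OF q] b_eq[OF q] \<sigma>_sq[OF q, symmetric] .
  then have "?R * (2 * \<sigma> q * D2 g q) = ?R * (g q * (\<sigma> q * \<sigma> q * ?J - \<eta> q))" by (simp add: algebra_simps)
  then show ?thesis using r_\<xi>[OF q] by simp
qed

text \<open>The second determining equation differentiated in w. Since \<tau> and \<xi> do not
  depend on w, only the factors containing \<open>\<upsilon>\<close> are affected, and an equation
  for \<open>g\<close> alone remains whether or not \<open>\<upsilon>\<close> is affine in
  w.\<close>

lemma g_s:
  assumes q: "q \<in> E"
  shows "D1 g q * \<sigma> q = D2 g q * \<eta> q + D2 (D2 g) q * \<sigma> q - D2 g q * \<sigma> q * \<sigma> q * J (\<xi> q)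
       + \<sigma> q * \<sigma> q * c (\<xi> q) * g q * \<sigma> q"
proof -
  let ?R = "r (\<xi> q)" and ?R' = "deriv r (\<xi> q)" and ?J = "J (\<xi> q)"
  let ?w = "(0, 0, 1) :: real \<times> real \<times> real"
  have z: "dir_deriv ?w \<xi> q = 0" by (rule space_first_derivs[OF q])
  have zz: "D3 (D1 \<xi>) q = 0" "D3 (D2 \<xi>) q = 0" "D3 (D2 (D2 \<xi>)) q = 0" "D3 (D1 \<tau>) q = 0"
  proof -
    have c: "D3 (D2 \<xi>) k = 0" if k: "k \<in> E" for k
      using dir_deriv_commute[OF smooth_E(2) E k basis3(3,2)] dir_deriv_zero[OF E k space_first_derivs(1)] by simp
    show "D3 (D2 \<xi>) q = 0" by (rule c[OF q])
    show "D3 (D1 \<xi>) q = 0"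
      using dir_deriv_commute[OF smooth_E(2) E q basis3(3,1)] dir_deriv_zero[OF E q space_first_derivs(1)] by simp
    show "D3 (D2 (D2 \<xi>)) q = 0"
      using dir_deriv_commute[OF smooth_D(2)[OF smooth_E(2)] E q basis3(3,2)] dir_deriv_zero[OF E q c] by simp
    show "D3 (D1 \<tau>) q = 0"
      using dir_deriv_commute[OF smooth_E(1) E q basis3(3,1)] dir_deriv_zero[OF E q time_first_derivs(2)] by simp
  qed
  have cc: "D3 (D1 \<upsilon>) q = D1 g q" "D3 (D2 \<upsilon>) q = D2 g q" "D3 (D2 (D2 \<upsilon>)) q = D2 (D2 g) q"
  proof -
    have c: "D3 (D2 \<upsilon>) k = D2 g k" if k: "k \<in> E" for k
      by (rule dir_deriv_commute[OF smooth_E(3) E k basis3(3,2)])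
    show "D3 (D2 \<upsilon>) q = D2 g q" by (rule c[OF q])
    show "D3 (D1 \<upsilon>) q = D1 g q" by (rule dir_deriv_commute[OF smooth_E(3) E q basis3(3,1)])
    show "D3 (D2 (D2 \<upsilon>)) q = D2 (D2 g) q"
      using dir_deriv_commute[OF smooth_D(2)[OF smooth_E(3)] E q basis3(3,2)] dir_deriv_cong[OF E q c] by simp
  qed
  have d: "has_dd ?w f (D3 f q) q" if "smooth_on E f" for f by (rule has_dd_smooth[OF that E q])
  note dd = d[OF smooth_E(3)] d[OF smooth_D(1)[OF smooth_E(3)]] d[OF smooth_D(2)[OF smooth_E(3)]] d[OF smooth_D(2)[OF smooth_D(2)[OF smooth_E(3)]]]
    d[OF smooth_D(1)[OF smooth_E(2)]] d[OF smooth_D(2)[OF smooth_E(2)]] d[OF smooth_D(2)[OF smooth_D(2)[OF smooth_E(2)]]]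
    d[OF smooth_D(1)[OF smooth_E(1)]] has_dd_along_\<xi>[OF smooth(2) q, of ?w] has_dd_along_\<xi>[OF smooth(3) q, of ?w]
  note e = has_dd_unique[OF E q determining_equations(2)
      has_dd_diff[OF has_dd_mult[OF dd(2) dd(6)] has_dd_mult[OF dd(3) dd(5)]]
      has_dd_add[OF has_dd_add[OF has_dd_diff[OF has_dd_mult[OF dd(4) dd(6)] has_dd_mult[OF dd(3) dd(7)]]
         has_dd_mult[OF has_dd_mult[OF dd(8) dd(9)] dd(3)]]
         has_dd_mult[OF has_dd_mult[OF has_dd_mult[OF dd(8) dd(10)] dd(1)] dd(6)]]]
  have "D1 g q * D2 \<xi> q - D2 g q * D1 \<xi> q = D2 (D2 g) q * D2 \<xi> q - D2 g q * D2 (D2 \<xi>) q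
       + D1 \<tau> q * b (\<xi> q) * D2 g q + D1 \<tau> q * c (\<xi> q) * g q * D2 \<xi> q"
    using e by (simp add: z zz cc)
  then have "?R * (D1 g q * \<sigma> q) = ?R * (D2 g q * \<eta> q + D2 (D2 g) q * \<sigma> q - D2 g q * \<sigma> q * \<sigma> q * ?J
       + \<sigma> q * \<sigma> q * c (\<xi> q) * g q * \<sigma> q)"
    unfolding \<xi>_derivs[OF q] D2_D2_\<xi>[OF q] b_eq[OF q] \<sigma>_sq[OF q, symmetric] by (simp add: algebra_simps)
  then show ?thesis using r_\<xi>[OF q] by simp
qed

text \<open>The y-derivative is for eliminating the second derivative of \<open>g\<close> from
  \<open>g_s\<close>, the s-derivative for comparing mixed derivatives.\<close>

lemma D_g_y:
  assumes q: "q \<in> E"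
  shows "2 * \<sigma> q * D2 (D2 g) q = D2 g q * (\<sigma> q * \<sigma> q * J (\<xi> q) - \<eta> q)
      + g q * (\<sigma> q * \<sigma> q * (deriv J (\<xi> q) * (r (\<xi> q) * \<sigma> q)) - D1 \<sigma> q)" (is ?y)
    "2 * D1 \<sigma> q * D2 g q + 2 * \<sigma> q * D1 (D2 g) q = D1 g q * (\<sigma> q * \<sigma> q * J (\<xi> q) - \<eta> q)
      + g q * ((D1 \<sigma> q * \<sigma> q + \<sigma> q * D1 \<sigma> q) * J (\<xi> q) + \<sigma> q * \<sigma> q * (deriv J (\<xi> q) * (r (\<xi> q) * \<eta> q)) - D1 \<eta> q)" (is ?s)
proof -
  have d: "has_dd v f (dir_deriv v f q) q" if "smooth_on E f" for f v by (rule has_dd_smooth[OF that E q])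
  note s = d[OF smooth_\<sigma>\<eta>(1)] and h = d[OF smooth_\<sigma>\<eta>(2)]
  note e = has_dd_unique[OF E q g_y has_dd_mult[OF has_dd_mult[OF has_dd_const[of _ 2] s] d[OF smooth_D(2)[OF smooth_g]]]
    has_dd_mult[OF d[OF smooth_g] has_dd_diff[OF has_dd_mult[OF has_dd_mult[OF s s] has_dd_along_\<xi>[OF smooth_J q]] h]]]
  show ?y using e[of "(0,1,0)"] by (simp add: D2_\<sigma>[OF q] D1_\<sigma>[OF q] \<xi>_derivs[OF q])
  show ?s using e[of "(1,0,0)"] by (simp add: \<xi>_derivs[OF q])
qed

text \<open>Eliminating the first and second y-derivatives of \<open>g\<close> from
  \<open>g_s\<close> fixes its logarithmic s-derivative. The terms in c, in the derivative of J and
  in J^2 combine to exactly \<open>K\<close>: this is how the invariant enters.\<close>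

lemma g_s_K:
  assumes q: "q \<in> E"
  shows "4 * \<sigma> q ^ 2 * D1 g q = g q * (4 * \<sigma> q ^ 4 * K (\<xi> q) - 2 * D1 \<sigma> q * \<sigma> q + 2 * J (\<xi> q) * \<eta> q * \<sigma> q ^ 2 - \<eta> q ^ 2)"
proof -
  have "4 * K (\<xi> q) = 2 * r (\<xi> q) * deriv J (\<xi> q) - J (\<xi> q) ^ 2 + 4 * c (\<xi> q)" by (simp add: K_eq)
  with g_y[OF q] g_s[OF q] D_g_y(1)[OF q] show ?thesis by algebra
qed

text \<open>Integrability of the two logarithmic derivatives of \<open>g\<close>: differentiate
  \<open>g_s_K\<close> in y and \<open>g_y\<close> in s and equate the mixed derivatives. All terms
  in \<open>J\<close> cancel.\<close>

lemma k1_equation: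
  assumes q: "q \<in> E"
  shows "2 * \<sigma> q ^ 5 * k1 (\<xi> q) = 2 * \<eta> q * D1 \<sigma> q - D1 \<eta> q * \<sigma> q"
proof -
  let ?y = "(0, 1, 0) :: real \<times> real \<times> real"
  have d: "has_dd ?y f (D2 f q) q" if "smooth_on E f" for f by (rule has_dd_smooth[OF that E q])
  note s = d[OF smooth_\<sigma>\<eta>(1)] and h = d[OF smooth_\<sigma>\<eta>(2)] and s1 = d[OF smooth_D(1)[OF smooth_\<sigma>\<eta>(1)]]
  have p: "has_dd ?y (\<lambda>q. \<sigma> q ^ n) 0 q" for n
    using has_dd_compose[OF DERIV_pow s, of n] by (simp add: D2_\<sigma>[OF q])
  have hp: "has_dd ?y (\<lambda>q. \<eta> q ^ 2) (2 * \<eta> q * D1 \<sigma> q) q"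
    using has_dd_compose[OF DERIV_pow h, of 2] by (simp add: D1_\<sigma>[OF q])
  have A: "4 * \<sigma> q ^ 2 * D2 (D1 g) q = D2 g q * (4 * \<sigma> q ^ 4 * K (\<xi> q) - 2 * D1 \<sigma> q * \<sigma> q + 2 * J (\<xi> q) * \<eta> q * \<sigma> q ^ 2 - \<eta> q ^ 2)
      + g q * (4 * \<sigma> q ^ 4 * (deriv K (\<xi> q) * (r (\<xi> q) * \<sigma> q))
        + (2 * (deriv J (\<xi> q) * (r (\<xi> q) * \<sigma> q)) * \<eta> q + 2 * J (\<xi> q) * D1 \<sigma> q) * \<sigma> q ^ 2 - 2 * \<eta> q * D1 \<sigma> q)"
    using has_dd_unique[OF E q g_s_K has_dd_mult[OF has_dd_mult[OF has_dd_const[of _ 4] p[of 2]] d[OF smooth_D(1)[OF smooth_g]]]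
      has_dd_mult[OF d[OF smooth_g] has_dd_diff[OF has_dd_add[OF has_dd_diff[OF
        has_dd_mult[OF has_dd_mult[OF has_dd_const[of _ 4] p[of 4]] has_dd_along_\<xi>[OF smooth_K q]]
        has_dd_mult[OF has_dd_mult[OF has_dd_const[of _ 2] s1] s]]
        has_dd_mult[OF has_dd_mult[OF has_dd_mult[OF has_dd_const[of _ 2] has_dd_along_\<xi>[OF smooth_J q]] h] p[of 2]]] hp]]]
    by (simp add: D2_\<sigma>[OF q] D1_\<sigma>[OF q] D2_D1_\<sigma>[OF q] \<xi>_derivs[OF q])
  have comm: "D1 (D2 g) q = D2 (D1 g) q" by (rule dir_deriv_commute[OF smooth_g E q basis3(1,2)])
  have "4 * \<sigma> q * g q * (2 * \<sigma> q ^ 5 * (r (\<xi> q) * deriv K (\<xi> q)) - (2 * \<eta> q * D1 \<sigma> q - D1 \<eta> q * \<sigma> q)) = 0"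
    using A D_g_y(2)[OF q, unfolded comm] g_s_K[OF q] g_y[OF q] by algebra
  then show ?thesis using \<sigma>_nz[OF q] g_nz[OF q] by (simp add: k1_def)
qed

lemma k2_equation:
  assumes q: "q \<in> E"
  shows "2 * \<sigma> q ^ 6 * k2 (\<xi> q) = 2 * D1 \<sigma> q * D1 \<sigma> q - D1 (D1 \<sigma>) q * \<sigma> q"
proof -
  let ?y = "(0, 1, 0) :: real \<times> real \<times> real"
  have d: "has_dd ?y f (D2 f q) q" if "smooth_on E f" for f by (rule has_dd_smooth[OF that E q])
  note s = d[OF smooth_\<sigma>\<eta>(1)] and h = d[OF smooth_\<sigma>\<eta>(2)] and s1 = d[OF smooth_D(1)[OF smooth_\<sigma>\<eta>(1)]]
    and h1 = d[OF smooth_D(1)[OF smooth_\<sigma>\<eta>(2)]]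
  have p: "has_dd ?y (\<lambda>q. \<sigma> q ^ n) 0 q" for n
    using has_dd_compose[OF DERIV_pow s, of n] by (simp add: D2_\<sigma>[OF q])
  have "2 * \<sigma> q ^ 5 * (deriv k1 (\<xi> q) * (r (\<xi> q) * \<sigma> q)) = 2 * D1 \<sigma> q * D1 \<sigma> q - D1 (D1 \<sigma>) q * \<sigma> q"
    using has_dd_unique[OF E q k1_equation has_dd_mult[OF has_dd_mult[OF has_dd_const[of _ 2] p] has_dd_along_\<xi>[OF smooth_k1 q]]
      has_dd_diff[OF has_dd_mult[OF has_dd_mult[OF has_dd_const[of _ 2] h] s1] has_dd_mult[OF h1 s]]]
    by (simp add: D2_\<sigma>[OF q] D1_\<sigma>[OF q] D2_D1_\<sigma>[OF q] D2_D1_\<eta>[OF q] \<xi>_derivs[OF q])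
  then show ?thesis unfolding k2_def by algebra
qed

text \<open>The right-hand side of \<open>k2_equation\<close> involves only \<open>\<sigma>\<close>
  and its s-derivatives, hence no y; neither does \<sigma>^6 on the left. Since \<xi>_y is nonzero,
  \<open>k2\<close> has zero derivative at the point \<open>\<xi> q\<close>.\<close>

lemma deriv_k2:
  assumes q: "q \<in> E"
  shows "deriv k2 (\<xi> q) = 0"
proof -
  let ?y = "(0, 1, 0) :: real \<times> real \<times> real"
  have d: "has_dd ?y f (D2 f q) q" if "smooth_on E f" for f by (rule has_dd_smooth[OF that E q])
  note s = d[OF smooth_\<sigma>\<eta>(1)] and s1 = d[OF smooth_D(1)[OF smooth_\<sigma>\<eta>(1)]]
    and s11 = d[OF smooth_D(1)[OF smooth_D(1)[OF smooth_\<sigma>\<eta>(1)]]]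
  have p: "has_dd ?y (\<lambda>q. \<sigma> q ^ n) 0 q" for n
    using has_dd_compose[OF DERIV_pow s, of n] by (simp add: D2_\<sigma>[OF q])
  have "2 * \<sigma> q ^ 6 * (deriv k2 (\<xi> q) * (r (\<xi> q) * \<sigma> q)) = 0"
    using has_dd_unique[OF E q k2_equation has_dd_mult[OF has_dd_mult[OF has_dd_const[of _ 2] p] has_dd_along_\<xi>[OF smooth_k2 q]]
      has_dd_diff[OF has_dd_mult[OF has_dd_mult[OF has_dd_const[of _ 2] s1] s1] has_dd_mult[OF s11 s]]]
    by (simp add: D2_\<sigma>[OF q] D2_D1_\<sigma>[OF q] D2_D1_D1_\<sigma>[OF q] \<xi>_derivs[OF q])
  then show ?thesis using \<sigma>_nz[OF q] r_\<xi>[OF q] by simp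
qed

end

section \<open>Quadratic $K$ is necessary\<close>

text \<open>Multiplicativity of 3 by 3 determinants, in the expanded form in which the Jacobian
  appears.\<close>

lemma det3_mult:
  fixes a11 :: real
  shows "(a11 * (a22 * a33 - a23 * a32) - a12 * (a21 * a33 - a23 * a31) + a13 * (a21 * a32 - a22 * a31))
     * (b11 * (b22 * b33 - b23 * b32) - b12 * (b21 * b33 - b23 * b31) + b13 * (b21 * b32 - b22 * b31))
   = (a11*b11+a12*b21+a13*b31) * ((a21*b12+a22*b22+a23*b32) * (a31*b13+a32*b23+a33*b33) - (a21*b13+a22*b23+a23*b33) * (a31*b12+a32*b22+a33*b32))
   - (a11*b12+a12*b22+a13*b32) * ((a21*b11+a22*b21+a23*b31) * (a31*b13+a32*b23+a33*b33) - (a21*b13+a22*b23+a23*b33) * (a31*b11+a32*b21+a33*b31))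
   + (a11*b13+a12*b23+a13*b33) * ((a21*b11+a22*b21+a23*b31) * (a31*b12+a32*b22+a33*b32) - (a21*b12+a22*b22+a23*b32) * (a31*b11+a32*b21+a33*b31))"
  by algebra

lemma has_dd_fst_snd: "has_dd v (\<lambda>p :: real \<times> real \<times> real. fst (snd p)) (fst (snd v)) x"
proof -
  have "((\<lambda>h. fst (snd x) + h * fst (snd v)) has_real_derivative fst (snd v)) (at 0)"
    by (auto intro!: derivative_eq_intros)
  then show ?thesis by (simp add: has_dd_def)
qed

lemma has_dd_snd_snd: "has_dd v (\<lambda>p :: real \<times> real \<times> real. snd (snd p)) (snd (snd v)) x"
proof -
  have "((\<lambda>h. snd (snd x) + h * snd (snd v)) has_real_derivative snd (snd v)) (at 0)"
    by (auto intro!: derivative_eq_intros)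
  then show ?thesis by (simp add: has_dd_def)
qed

text \<open>By the chain rule the Jacobian matrices of the two mutually inverse maps multiply to the
  identity, so the product of their determinants is 1.\<close>

lemma jacobian_nonzero:
  fixes \<phi>1 \<phi>2 \<phi>3 \<psi>1 \<psi>2 \<psi>3 :: "real \<times> real \<times> real \<Rightarrow> real"
  assumes D: "open D" "smooth_on D \<phi>1" "smooth_on D \<phi>2" "smooth_on D \<phi>3"
    and E: "open E" "smooth_on E \<psi>1" "smooth_on E \<psi>2" "smooth_on E \<psi>3"
    and inv: "\<And>q. q \<in> E \<Longrightarrow> (\<psi>1 q, \<psi>2 q, \<psi>3 q) \<in> D"
      "\<And>q. q \<in> E \<Longrightarrow> \<phi>1 (\<psi>1 q, \<psi>2 q, \<psi>3 q) = fst q"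
      "\<And>q. q \<in> E \<Longrightarrow> \<phi>2 (\<psi>1 q, \<psi>2 q, \<psi>3 q) = fst (snd q)"
      "\<And>q. q \<in> E \<Longrightarrow> \<phi>3 (\<psi>1 q, \<psi>2 q, \<psi>3 q) = snd (snd q)"
    and q: "q \<in> E"
  shows "D1 \<psi>1 q * (D2 \<psi>2 q * D3 \<psi>3 q - D3 \<psi>2 q * D2 \<psi>3 q)
       - D2 \<psi>1 q * (D1 \<psi>2 q * D3 \<psi>3 q - D3 \<psi>2 q * D1 \<psi>3 q)
       + D3 \<psi>1 q * (D1 \<psi>2 q * D2 \<psi>3 q - D2 \<psi>2 q * D1 \<psi>3 q) \<noteq> 0"
proof -
  let ?p = "(\<psi>1 q, \<psi>2 q, \<psi>3 q)"
  have ch: "dir_deriv v \<psi>1 q * D1 \<phi> ?p + dir_deriv v \<psi>2 q * D2 \<phi> ?p + dir_deriv v \<psi>3 q * D3 \<phi> ?p = e"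
    if "smooth_on D \<phi>" "\<And>q. q \<in> E \<Longrightarrow> \<phi> (\<psi>1 q, \<psi>2 q, \<psi>3 q) = f q" "has_dd v f e q" for v \<phi> f e
    by (rule has_dd_unique[OF E(1) q that(2) has_dd_compose3[where \<alpha> = \<psi>1 and \<beta> = \<psi>2 and \<gamma> = \<psi>3 and x = q, OF that(1) D(1) inv(1)[OF q]] that(3)])
       (use has_dd_smooth[OF _ E(1) q] E in auto)
  note c1 = ch[OF D(2) inv(2) has_dd_fst] and c2 = ch[OF D(3) inv(3) has_dd_fst_snd] and c3 = ch[OF D(4) inv(4) has_dd_snd_snd]
  note cs = c1[of "(1,0,0)"] c1[of "(0,1,0)"] c1[of "(0,0,1)"] c2[of "(1,0,0)"] c2[of "(0,1,0)"] c2[of "(0,0,1)"]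
     c3[of "(1,0,0)"] c3[of "(0,1,0)"] c3[of "(0,0,1)"]
  have "(D1 \<phi>1 ?p * (D2 \<phi>2 ?p * D3 \<phi>3 ?p - D3 \<phi>2 ?p * D2 \<phi>3 ?p) - D2 \<phi>1 ?p * (D1 \<phi>2 ?p * D3 \<phi>3 ?p - D3 \<phi>2 ?p * D1 \<phi>3 ?p)
        + D3 \<phi>1 ?p * (D1 \<phi>2 ?p * D2 \<phi>3 ?p - D2 \<phi>2 ?p * D1 \<phi>3 ?p)) *
     (D1 \<psi>1 q * (D2 \<psi>2 q * D3 \<psi>3 q - D3 \<psi>2 q * D2 \<psi>3 q)
       - D2 \<psi>1 q * (D1 \<psi>2 q * D3 \<psi>3 q - D3 \<psi>2 q * D1 \<psi>3 q)
       + D3 \<psi>1 q * (D1 \<psi>2 q * D2 \<psi>3 q - D2 \<psi>2 q * D1 \<psi>3 q)) = 1"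
    unfolding det3_mult using cs by (simp add: mult.commute)
  then show ?thesis by force
qed

lemma smooth_on_triple:
  fixes f :: "'a::euclidean_space \<Rightarrow> real \<times> real \<times> real"
  assumes "smooth_on U f"
  shows "smooth_on U (\<lambda>p. fst (f p))" "smooth_on U (\<lambda>p. fst (snd (f p)))" "smooth_on U (\<lambda>p. snd (snd (f p)))"
  using assms smooth_on_Pair[of U "\<lambda>p. fst (f p)" "\<lambda>p. snd (f p)"]
    smooth_on_Pair[of U "\<lambda>p. fst (snd (f p))" "\<lambda>p. snd (snd (f p))"] by auto

lemma (in parabolic) maps_to_heat_imp_quadratic:
  assumes Tint: "open Tint" "Tint \<noteq> {}" and m: "maps_to_heat a b c S Tint Phi"
  shows "\<exists>c0 c1 c2. \<forall>x\<in>S. K x = c2 * (I x)^2 + c1 * I x + c0"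
proof (rule K_quadraticI)
  define D where "D = Tint \<times> S \<times> (UNIV :: real set)"
  define E where "E = Phi ` D"
  define Psi where "Psi = inv_into D Phi"
  have inj: "inj_on Phi D" and E: "open E" and sPhi: "smooth_on D Phi" and sPsi: "smooth_on E Psi" and D: "open D"
    and maps: "maps_solutions heatsol (lsol a b c S) Psi E"
    using m by (auto simp: maps_to_heat_def Let_def point_transformation_def D_def E_def Psi_def)
  have PD: "Psi q \<in> D" and PhiPsi: "Phi (Psi q) = q" if "q \<in> E" for q
    using that by (auto simp: E_def Psi_def inv_into_into f_inv_into_f)
  interpret hp: heat_preimage a b c I B S E "\<lambda>q. fst (Psi q)" "\<lambda>q. fst (snd (Psi q))" "\<lambda>q. snd (snd (Psi q))"
  proof
    show "open E" by (rule E)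
    show "smooth_on E (\<lambda>q. fst (Psi q))" "smooth_on E (\<lambda>q. fst (snd (Psi q)))" "smooth_on E (\<lambda>q. snd (snd (Psi q)))"
      by (rule smooth_on_triple[OF sPsi])+
    show "fst (snd (Psi q)) \<in> S" if "q \<in> E" for q using PD[OF that] by (auto simp: D_def)
    show "D1 (\<lambda>q. fst (Psi q)) q * (D2 (\<lambda>q. fst (snd (Psi q))) q * D3 (\<lambda>q. snd (snd (Psi q))) q - D3 (\<lambda>q. fst (snd (Psi q))) q * D2 (\<lambda>q. snd (snd (Psi q))) q)
       - D2 (\<lambda>q. fst (Psi q)) q * (D1 (\<lambda>q. fst (snd (Psi q))) q * D3 (\<lambda>q. snd (snd (Psi q))) q - D3 (\<lambda>q. fst (snd (Psi q))) q * D1 (\<lambda>q. snd (snd (Psi q))) q)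
       + D3 (\<lambda>q. fst (Psi q)) q * (D1 (\<lambda>q. fst (snd (Psi q))) q * D2 (\<lambda>q. snd (snd (Psi q))) q - D2 (\<lambda>q. fst (snd (Psi q))) q * D1 (\<lambda>q. snd (snd (Psi q))) q) \<noteq> 0"
      if "q \<in> E" for q
      by (rule jacobian_nonzero[OF D smooth_on_triple[OF sPhi] E smooth_on_triple[OF sPsi] _ _ _ _ that])
         (use PD PhiPsi in auto)
    fix Om w Om' u
    assume w: "heatsol Om w" "graph w Om \<subseteq> E" and Om': "open Om'" "smooth_on Om' (\<lambda>p. u (fst p) (snd p))"
      and ex: "\<And>t x. (t, x) \<in> Om' \<Longrightarrow> \<exists>s y. (s, y) \<in> Om \<and> t = fst (Psi (s, y, w s y)) \<and> x = fst (snd (Psi (s, y, w s y)))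
          \<and> u t x = snd (snd (Psi (s, y, w s y)))"
    have "graph u Om' \<subseteq> Psi ` graph w Om"
    proof
      fix p assume "p \<in> graph u Om'"
      then obtain t x where p: "p = (t, x, u t x)" "(t, x) \<in> Om'" by (auto simp: graph_def)
      obtain s y where "(s, y) \<in> Om" "p = Psi (s, y, w s y)"
        using ex[OF p(2)] p(1) by (auto simp: prod_eq_iff)
      then show "p \<in> Psi ` graph w Om" by (auto simp: graph_def)
    qed
    then show "lsol a b c S Om' u" using maps w Om' unfolding maps_solutions_def by blast
  qed
  fix x assume x: "x \<in> S"
  \<comment> \<open>Every x in \<open>S\<close> is the space component of the inverse at some point
    of \<open>E\<close>, namely at the image of (t, x, 0); the value 0 of the unknown is
    arbitrary.\<close>
  obtain t where t: "t \<in> Tint" using Tint by blast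
  have "(t, x, 0) \<in> D" using x t by (simp add: D_def)
  then have "Phi (t, x, 0) \<in> E" "Psi (Phi (t, x, 0)) = (t, x, 0)" using inj by (auto simp: E_def Psi_def)
  with hp.deriv_k2[of "Phi (t, x, 0)"] show "deriv k2 x = 0" by simp
qed

section \<open>Solutions of the auxiliary ordinary differential equations\<close>

lemma deriv_on_open:
  fixes f f' :: "real \<Rightarrow> real"
  assumes "open U" "\<And>t. t \<in> U \<Longrightarrow> (f has_real_derivative f' t) (at t)"
    and "\<And>t. t \<in> U \<Longrightarrow> g t = f t" and "t \<in> U"
  shows "g differentiable (at t)" "deriv g t = f' t"
proof -
  have d: "(g has_real_derivative f' t) (at t)"
    by (rule DERIV_cong_open[OF assms(2)[OF assms(4)] assms(1,4)]) (simp add: assms(3))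
  then show "g differentiable (at t)" using real_differentiable_def by blast
  show "deriv g t = f' t" by (rule DERIV_imp_deriv[OF d])
qed

text \<open>Explicit derivatives on an open set are transferred to the iterated \<open>deriv\<close>
  in which the conditions on \<open>T\<close> are phrased.\<close>

lemma constant_schwarzianI:
  assumes U: "open U" and d: "\<And>t. t \<in> U \<Longrightarrow> (T has_real_derivative T1 t) (at t)"
      "\<And>t. t \<in> U \<Longrightarrow> (T1 has_real_derivative T2 t) (at t)" "\<And>t. t \<in> U \<Longrightarrow> (T2 has_real_derivative T3 t) (at t)"
    and pos: "\<And>t. t \<in> U \<Longrightarrow> T1 t > 0" and e: "\<And>t. t \<in> U \<Longrightarrow> T3 t / T1 t - 3/2 * (T2 t / T1 t)^2 = k"
    and t: "t \<in> U"
  shows "T differentiable (at t) \<and> deriv T differentiable (at t) \<and> deriv (deriv T) differentiable (at t) \<and>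
      deriv T t > 0 \<and> schwarzian T t = k"
proof -
  have 1: "T differentiable (at t)" "deriv T t = T1 t" if "t \<in> U" for t
    using deriv_on_open[OF U d(1), of T t] that by auto
  have 2: "deriv T differentiable (at t)" "deriv (deriv T) t = T2 t" if "t \<in> U" for t
    using deriv_on_open[OF U d(2), of "deriv T" t] 1 that by auto
  have 3: "deriv (deriv T) differentiable (at t)" "deriv (deriv (deriv T)) t = T3 t" if "t \<in> U" for t
    using deriv_on_open[OF U d(3), of "deriv (deriv T)" t] 2 that by auto
  show ?thesis using 1[OF t] 2[OF t] 3[OF t] pos[OF t] e[OF t] by (simp add: schwarzian_def)
qed

text \<open>The identity has Schwarzian 0, tan(k t) has 2 k^2 and exp(k t) has -k^2/2; the sign of
  \<open>c2\<close> selects the function. Without such a \<open>T\<close>, quadratic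
  \<open>K\<close> would not yet produce any transformation.\<close>

lemma ex_constant_schwarzian:
  fixes c2 :: real
  shows "\<exists>Tint T. is_interval Tint \<and> open Tint \<and> Tint \<noteq> {} \<and>
     (\<forall>t\<in>Tint. T differentiable (at t) \<and> deriv T differentiable (at t) \<and> deriv (deriv T) differentiable (at t) \<and>
        deriv T t > 0 \<and> schwarzian T t = 8 * c2)"
proof (cases "c2 = 0" "c2 > 0" rule: bool.exhaust[case_product bool.exhaust])
  case True_True then show ?thesis by simp
next
  case True_False
  have "T differentiable (at t) \<and> deriv T differentiable (at t) \<and> deriv (deriv T) differentiable (at t) \<and>
      deriv T t > 0 \<and> schwarzian T t = 8 * c2" if "T = (\<lambda>t. t)" for t and T :: "real \<Rightarrow> real"
    unfolding that by (rule constant_schwarzianI[of UNIV _ "\<lambda>_. 1" "\<lambda>_. 0" "\<lambda>_. 0"]) (use True_False in auto)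
  then show ?thesis by (intro exI[of _ UNIV] exI[of _ "\<lambda>t. t"]) auto
next
  case False_True
  \<comment> \<open>Solves 2 k^2 = 8 c2.\<close>
  define k where "k = 2 * sqrt c2"
  have k: "k > 0" "k^2 = 4 * c2" using False_True by (auto simp: k_def power_mult_distrib)
  \<comment> \<open>On this interval |k t| < 1 < pi/2, so the tangent has no pole.\<close>
  define U where "U = {- (1/k) <..< 1/k}"
  have cos: "cos (k * t) \<noteq> 0" if "t \<in> U" for t
  proof -
    have "\<bar>k * t\<bar> < 1" using that k by (auto simp: U_def abs_less_iff field_simps)
    then have "- (pi / 2) < k * t" "k * t < pi / 2" using pi_gt3 by linarith+
    from cos_gt_zero_pi[OF this] show ?thesis by simp
  qed
  have du: "((\<lambda>t. tan (k * t)) has_real_derivative k * (1 + (tan (k * t))^2)) (at t)" if "t \<in> U" for t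
    using cos[OF that] by (auto intro!: derivative_eq_intros simp: tan_sec power_inverse)
  have "T differentiable (at t) \<and> deriv T differentiable (at t) \<and> deriv (deriv T) differentiable (at t) \<and>
      deriv T t > 0 \<and> schwarzian T t = 8 * c2" if T: "T = (\<lambda>t. tan (k * t) / k)" and t: "t \<in> U" for t and T :: "real \<Rightarrow> real"
    unfolding T
  proof (rule constant_schwarzianI[of U _ "\<lambda>t. 1 + (tan (k * t))^2" "\<lambda>t. 2 * k * tan (k * t) * (1 + (tan (k * t))^2)"
      "\<lambda>t. 2 * k^2 * (1 + 3 * (tan (k * t))^2) * (1 + (tan (k * t))^2)"])
    fix t assume t: "t \<in> U"
    show "((\<lambda>t. tan (k * t) / k) has_real_derivative 1 + (tan (k * t))^2) (at t)"
      using DERIV_cdivide[OF du[OF t], of k] k by simp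
    show "((\<lambda>t. 1 + (tan (k * t))^2) has_real_derivative 2 * k * tan (k * t) * (1 + (tan (k * t))^2)) (at t)"
      by (rule derivative_eq_intros du[OF t] refl)+ simp
    show "((\<lambda>t. 2 * k * tan (k * t) * (1 + (tan (k * t))^2)) has_real_derivative
        2 * k^2 * (1 + 3 * (tan (k * t))^2) * (1 + (tan (k * t))^2)) (at t)"
      by (rule derivative_eq_intros du[OF t] refl)+ (simp add: algebra_simps power2_eq_square)
    show p: "0 < 1 + (tan (k * t))^2" by (simp add: add_pos_nonneg)
    have "2 * k^2 * (1 + 3 * (tan (k * t))^2) * (1 + (tan (k * t))^2) / (1 + (tan (k * t))^2)
       - 3/2 * (2 * k * tan (k * t) * (1 + (tan (k * t))^2) / (1 + (tan (k * t))^2))^2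
       = 2 * k^2 * (1 + 3 * (tan (k * t))^2) - 3/2 * (2 * k * tan (k * t))^2"
      using p by simp
    also have "\<dots> = 8 * c2" using k(2) by (simp add: power_mult_distrib algebra_simps)
    finally show "2 * k^2 * (1 + 3 * (tan (k * t))^2) * (1 + (tan (k * t))^2) / (1 + (tan (k * t))^2)
       - 3/2 * (2 * k * tan (k * t) * (1 + (tan (k * t))^2) / (1 + (tan (k * t))^2))^2 = 8 * c2" .
  qed (use t in \<open>auto simp: U_def\<close>)
  moreover have "is_interval U" "open U" "0 \<in> U" using k by (auto simp: U_def)
  ultimately show ?thesis by (intro exI[of _ U] exI[of _ "\<lambda>t. tan (k * t) / k"]) auto
next
  case False_False
  \<comment> \<open>Solves -k^2/2 = 8 c2; positivity of k makes the exponential increasing.\<close>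
  define k where "k = 4 * sqrt (- c2)"
  have k: "k > 0" "k^2 = - 16 * c2" using False_False by (auto simp: k_def power_mult_distrib)
  have "T differentiable (at t) \<and> deriv T differentiable (at t) \<and> deriv (deriv T) differentiable (at t) \<and>
      deriv T t > 0 \<and> schwarzian T t = 8 * c2" if "T = (\<lambda>t. exp (k * t))" for t and T :: "real \<Rightarrow> real"
    unfolding that
  proof (rule constant_schwarzianI[of UNIV _ "\<lambda>t. k * exp (k * t)" "\<lambda>t. k^2 * exp (k * t)" "\<lambda>t. k^3 * exp (k * t)"])
    fix t
    have "k^3 * exp (k * t) / (k * exp (k * t)) = k^2" "k^2 * exp (k * t) / (k * exp (k * t)) = k"
      using k(1) by (simp_all add: power2_eq_square power3_eq_cube)
    then show "k^3 * exp (k * t) / (k * exp (k * t)) - 3/2 * (k^2 * exp (k * t) / (k * exp (k * t)))^2 = 8 * c2"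
      using k by simp
  qed (use k(1) in \<open>auto intro!: derivative_eq_intros simp: power2_eq_square power3_eq_cube\<close>)
  then show ?thesis by (intro exI[of _ UNIV] exI[of _ "\<lambda>t. exp (k * t)"]) auto
qed

text \<open>One particular solution on the whole line suffices: the constant c1/(2 c2) if
  \<open>c2\<close> is nonzero, otherwise the parabola c1 t^2. In both cases the integrand for
  \<open>W\<close> is a polynomial in t and is integrated by hand.\<close>

lemma ex_shift:
  fixes c0 c1 c2 :: real
  shows "\<exists>\<omega> W. \<forall>t. \<omega> differentiable (at t) \<and> deriv \<omega> differentiable (at t) \<and> deriv (deriv \<omega>) t + 4 * c2 * \<omega> t = 2 * c1 \<and>
     (W has_real_derivative (c2 * (\<omega> t)^2 - 1/4 * (deriv \<omega> t)^2 - c0)) (at t)"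
proof -
  have gen: ?thesis if d: "\<And>t. (\<omega> has_real_derivative \<omega>1 t) (at t)" "\<And>t. (\<omega>1 has_real_derivative \<omega>2 t) (at t)"
    and e: "\<And>t. \<omega>2 t + 4 * c2 * \<omega> t = 2 * c1"
    and W: "\<And>t. (W has_real_derivative (c2 * (\<omega> t)^2 - 1/4 * (\<omega>1 t)^2 - c0)) (at t)" for \<omega> \<omega>1 \<omega>2 W
  proof -
    have 1: "\<omega> differentiable (at t)" "deriv \<omega> t = \<omega>1 t" for t
      using deriv_on_open[OF open_UNIV d(1), of \<omega> t] by auto
    have 2: "deriv \<omega> differentiable (at t)" "deriv (deriv \<omega>) t = \<omega>2 t" for t
      using deriv_on_open[OF open_UNIV d(2), of "deriv \<omega>" t] 1 by auto
    show ?thesis by (rule exI[of _ \<omega>], rule exI[of _ W]) (use 1 2 e W in auto)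
  qed
  show ?thesis
  proof (cases "c2 = 0")
    case True
    show ?thesis
      by (rule gen[of "\<lambda>t. c1 * t^2" "\<lambda>t. 2 * c1 * t" "\<lambda>t. 2 * c1" "\<lambda>t. - (c1^2 * t^3 / 3) - c0 * t"])
         (use True in \<open>auto intro!: derivative_eq_intros simp: power2_eq_square\<close>)
  next
    case False
    show ?thesis
      by (rule gen[of "\<lambda>t. c1 / (2 * c2)" "\<lambda>t. 0" "\<lambda>t. 0" "\<lambda>t. (c2 * (c1 / (2 * c2))^2 - c0) * t"])
         (use False in \<open>auto intro!: derivative_eq_intros\<close>)
  qed
qed

theorem theorem2:
  fixes a b c I B :: "real \<Rightarrow> real" and S :: "real set"
  assumes S: "is_interval S" "open S" "S \<noteq> {}"
    and smooth: "smooth_on S a" "smooth_on S b" "smooth_on S c"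
    and apos: "\<forall>x\<in>S. a x > 0"
    and I: "\<forall>x\<in>S. (I has_real_derivative 1 / sqrt (a x)) (at x)"
    and B: "\<forall>x\<in>S. (B has_real_derivative b x / (2 * a x)) (at x)"
  shows "((\<exists>Tint Phi. is_interval Tint \<and> open Tint \<and> Tint \<noteq> {} \<and>
             maps_to_heat a b c S Tint Phi)
          \<longleftrightarrow> (\<exists>c0 c1 c2. \<forall>x\<in>S. Kf a b c x = c2 * (I x)^2 + c1 * I x + c0))
      \<and> (\<forall>c0 c1 c2. (\<forall>x\<in>S. Kf a b c x = c2 * (I x)^2 + c1 * I x + c0) \<longrightarrow>
          (\<forall>Tint T \<omega> W C.
             is_interval Tint \<and> open Tint \<and> Tint \<noteq> {} \<and>
             (\<forall>t\<in>Tint. T differentiable (at t) \<and> deriv T differentiable (at t) \<and>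
                        deriv (deriv T) differentiable (at t) \<and>
                        deriv T t > 0 \<and> schwarzian T t = 8 * c2) \<and>
             (\<forall>t\<in>Tint. \<omega> differentiable (at t) \<and> deriv \<omega> differentiable (at t) \<and>
                        deriv (deriv \<omega>) t + 4 * c2 * \<omega> t = 2 * c1) \<and>
             (\<forall>t\<in>Tint. (W has_real_derivative
                           (c2 * (\<omega> t)^2 - 1/4 * (deriv \<omega> t)^2 - c0)) (at t)) \<and>
             C \<noteq> 0
             \<longrightarrow> maps_to_heat a b c S Tint
                   (\<lambda>(t, x, u). (T t, sqrt (deriv T t) * (I x + \<omega> t),
                      u / (C * (deriv T t * a x) powr (1/4) *
                           exp (- B x
                                + deriv (deriv T) t / (8 * deriv T t) * (I x + \<omega> t)^2
                                + deriv \<omega> t * I x / 2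
                                - W t))))))"
proof -
  interpret parabolic a b c I B S
    by unfold_locales (use S smooth apos I B in auto)
  have maps: "maps_to_heat a b c S Tint
                   (\<lambda>(t, x, u). (T t, sqrt (deriv T t) * (I x + \<omega> t),
                      u / (C * (deriv T t * a x) powr (1/4) *
                           exp (- B x
                                + deriv (deriv T) t / (8 * deriv T t) * (I x + \<omega> t)^2
                                + deriv \<omega> t * I x / 2
                                - W t))))"
    if K: "\<forall>x\<in>S. Kf a b c x = c2 * (I x)^2 + c1 * I x + c0"
      and h: "is_interval Tint \<and> open Tint \<and> Tint \<noteq> {} \<and>
             (\<forall>t\<in>Tint. T differentiable (at t) \<and> deriv T differentiable (at t) \<and>
                        deriv (deriv T) differentiable (at t) \<and>
                        deriv T t > 0 \<and> schwarzian T t = 8 * c2) \<and>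
             (\<forall>t\<in>Tint. \<omega> differentiable (at t) \<and> deriv \<omega> differentiable (at t) \<and>
                        deriv (deriv \<omega>) t + 4 * c2 * \<omega> t = 2 * c1) \<and>
             (\<forall>t\<in>Tint. (W has_real_derivative
                           (c2 * (\<omega> t)^2 - 1/4 * (deriv \<omega> t)^2 - c0)) (at t)) \<and>
             C \<noteq> 0" for c0 c1 c2 Tint T \<omega> W C
  proof -
    interpret heat_map a b c I B S c0 c1 c2 Tint T \<omega> W C
      by unfold_locales (use K h in auto)
    show ?thesis using maps_to_heat_Phi unfolding Phi_def X_def M_def .
  qed
  have exists: "\<exists>Tint Phi. is_interval Tint \<and> open Tint \<and> Tint \<noteq> {} \<and> maps_to_heat a b c S Tint Phi"
    if K: "\<forall>x\<in>S. Kf a b c x = c2 * (I x)^2 + c1 * I x + c0" for c0 c1 c2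
  proof -
    obtain Tint T where T: "is_interval Tint" "open Tint" "Tint \<noteq> {}"
      "\<forall>t\<in>Tint. T differentiable (at t) \<and> deriv T differentiable (at t) \<and> deriv (deriv T) differentiable (at t) \<and>
        deriv T t > 0 \<and> schwarzian T t = 8 * c2"
      using ex_constant_schwarzian[of c2] by blast
    obtain \<omega> W where W: "\<forall>t. \<omega> differentiable (at t) \<and> deriv \<omega> differentiable (at t) \<and>
        deriv (deriv \<omega>) t + 4 * c2 * \<omega> t = 2 * c1 \<and>
        (W has_real_derivative (c2 * (\<omega> t)^2 - 1/4 * (deriv \<omega> t)^2 - c0)) (at t)"
      using ex_shift[of c2 c1 c0] by blast
    show ?thesis
      \<comment> \<open>The final argument 1 is the multiplicative constant \<open>C\<close>; any
        nonzero value would do.\<close>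
      by (rule exI[of _ Tint], rule exI, intro conjI T(1-3), rule maps[OF K, of Tint T \<omega> W 1])
         (use T W in simp)
  qed
  show ?thesis
  proof (intro conjI iffI allI impI)
    assume "\<exists>Tint Phi. is_interval Tint \<and> open Tint \<and> Tint \<noteq> {} \<and> maps_to_heat a b c S Tint Phi"
    then show "\<exists>c0 c1 c2. \<forall>x\<in>S. Kf a b c x = c2 * (I x)^2 + c1 * I x + c0"
      using maps_to_heat_imp_quadratic by blast
  next
    assume "\<exists>c0 c1 c2. \<forall>x\<in>S. Kf a b c x = c2 * (I x)^2 + c1 * I x + c0"
    then show "\<exists>Tint Phi. is_interval Tint \<and> open Tint \<and> Tint \<noteq> {} \<and> maps_to_heat a b c S Tint Phi"
      by (elim exE) (rule exists)
  qed (rule maps)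
qed

end
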